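(* Let $\eta\in C_0^\infty(\mathbb{R})$ be a bump function supported on $[-1,1]$ with $\eta=1$ on $[-1/2,1/2]$. For every sufficiently small $\varepsilon>0$ there is a constant $C>0$, independent of $\lambda$, $L$, $N$, $\phi_L$ and $\phi_N$, such that the following holds for all $\lambda\ge 1$. Let $L$ and $N$ be dyadic numbers with $N\ge L$, and let $\phi_L,\phi_N$ be functions on $\mathbb{T}_\lambda$ with $\|\phi_L\|_{L^2}=\|\phi_N\|_{L^2}=1$ whose Fourier transforms are supported in $\{\xi : |\xi|\sim L\}$ and $\{\xi : |\xi|\sim N\}$, respectively. Then $$ \left\| \eta(t)\left(e^{-\frac{t}{4\pi^2}\partial_x^3}\phi_L\right)\left(e^{-\frac{t}{4\pi^2}\partial_x^3}\phi_N\right)\right\|_{L^{4}_{t,x}(\mathbb{R}\times \mathbb{T}_{\lambda})}\le C\left[ \left(\frac{1}{\lambda}+\frac{1}{N^2}\right)^{\frac{1}{4}}L^{\frac{3}{16}+\varepsilon}N^{\frac{3}{16}+\varepsilon}+\min\left\{\frac{1}{N^{\frac14-\varepsilon}},\ \frac{1}{\lambda^{\frac14}}+\frac{1}{N^{\frac12}}\right\}L^{\frac14}N^{\frac14}\right]. $$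
   Context: $\mathbb{T}_\lambda=\mathbb{R}/\lambda\mathbb{Z}$ is the torus of period $\lambda$. For a function $\phi$ on $\mathbb{T}_\lambda$, its Fourier transform is $$\widehat{\phi}(\xi)=\int_0^\lambda e^{-2\pi i\xi x}\phi(x)\,dx,\qquad \xi\in\mathbb{Z}/\lambda,$$ where $\mathbb{Z}/\lambda=\{k/\lambda : k\in\mathbb{Z}\}$, and $\int f(\xi)\,(d\xi)_\lambda=\frac1\lambda\sum_{\xi\in\mathbb{Z}/\lambda}f(\xi)$. The $L^2$ norm of $\phi$ is that of $L^2([0,\lambda],dx)$, so that $\|\phi\|_{L^2}^2=\int|\widehat\phi(\xi)|^2(d\xi)_\lambda$. The linear propagator is $$\left(e^{-\frac{t}{4\pi^2}\partial_x^3}\phi\right)(x)=\int e^{2\pi i(\xi^3t+\xi x)}\widehat\phi(\xi)\,(d\xi)_\lambda ,$$ i.e. the $\lambda$-periodic solution of $\partial_tu+\frac{1}{4\pi^2}\partial_x^3u=0$, $u|_{t=0}=\phi$. A dyadic number is an integer power of $2$. The notation $|\xi|\sim M$ means $c_0M\le|\xi|\le C_0M$ for fixed absolute constants $0<c_0<C_0$ (on which the constant $C$ may depend); $C$ may also depend on $\varepsilon$ and $\eta$. *)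

theory Defs
  imports "HOL-Analysis.Analysis"
begin

text \<open>
  Functions on the torus of period \<open>lam\<close> are represented by \<open>lam\<close>-periodic functions on the real
  line; integrals and norms over the torus are taken over the fundamental domain \<open>{0..lam}\<close>.
\<close>

definition torus_fun :: "real \<Rightarrow> (real \<Rightarrow> complex) \<Rightarrow> bool" where
  "torus_fun lam \<phi> \<longleftrightarrow> \<phi> \<in> borel_measurable lebesgue \<and> (\<forall>x. \<phi> (x + lam) = \<phi> x)"

text \<open>The \<open>L\<^sup>p\<close> norm (\<open>0 < p < \<infinity>\<close>) takes the value \<open>\<infinity>\<close> when the integral diverges, so a finite bound
  on it includes membership in \<open>L\<^sup>p\<close>.\<close>

definition Lp_norm :: "real \<Rightarrow> 'a measure \<Rightarrow> ('a \<Rightarrow> complex) \<Rightarrow> ennreal" where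
  "Lp_norm p M f =
    (let I = (\<integral>\<^sup>+ z. ennreal (norm (f z) powr p) \<partial>M)
     in if I = \<infinity> then \<infinity> else ennreal (enn2real I powr (1 / p)))"

definition dual_lattice :: "real \<Rightarrow> real set" where
  "dual_lattice lam = range (\<lambda>k::int. real_of_int k / lam)"

definition torus_fourier :: "real \<Rightarrow> (real \<Rightarrow> complex) \<Rightarrow> real \<Rightarrow> complex" where
  "torus_fourier lam \<phi> \<xi> = (LINT x|lebesgue_on {0..lam}. cis (- 2 * pi * \<xi> * x) * \<phi> x)"

definition dual_integral :: "real \<Rightarrow> (real \<Rightarrow> complex) \<Rightarrow> complex" where
  "dual_integral lam f = (1 / lam) *\<^sub>R (\<Sum>\<^sub>\<infinity>\<xi>\<in>dual_lattice lam. f \<xi>)"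

text \<open>The propagator is given by its Fourier series. \<open>infsum\<close> is unconditional summation, with value
  \<open>0\<close> for non-summable families; for \<open>\<phi>\<close> with Fourier transform of bounded support, only finitely
  many terms are nonzero.\<close>

definition airy_flow :: "real \<Rightarrow> real \<Rightarrow> (real \<Rightarrow> complex) \<Rightarrow> real \<Rightarrow> complex" where
  "airy_flow lam t \<phi> x =
    dual_integral lam (\<lambda>\<xi>. cis (2 * pi * (\<xi> ^ 3 * t + \<xi> * x)) * torus_fourier lam \<phi> \<xi>)"

definition fourier_supported :: "real \<Rightarrow> (real \<Rightarrow> complex) \<Rightarrow> real set \<Rightarrow> bool" where
  "fourier_supported lam \<phi> S \<longleftrightarrow> (\<forall>\<xi>\<in>dual_lattice lam. torus_fourier lam \<phi> \<xi> \<noteq> 0 \<longrightarrow> \<xi> \<in> S)"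

definition freq_shell :: "real \<Rightarrow> real \<Rightarrow> real \<Rightarrow> real set" where
  "freq_shell c0 C0 M = {\<xi>. c0 * M \<le> \<bar>\<xi>\<bar> \<and> \<bar>\<xi>\<bar> \<le> C0 * M}"

definition dyadic :: "real \<Rightarrow> bool" where
  "dyadic M \<longleftrightarrow> (\<exists>k::int. M = 2 powi k)"

definition smooth :: "(real \<Rightarrow> real) \<Rightarrow> bool" where
  "smooth \<eta> \<longleftrightarrow> (\<forall>n t. (deriv ^^ n) \<eta> differentiable (at t))"

definition bump :: "(real \<Rightarrow> real) \<Rightarrow> bool" where
  "bump \<eta> \<longleftrightarrow> smooth \<eta> \<and> closure {t. \<eta> t \<noteq> 0} \<subseteq> {-1..1} \<and> (\<forall>t\<in>{-1/2..1/2}. \<eta> t = 1)"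

end

theory Submission
  imports Defs
begin

text \<open>
  The second term on the right already dominates the left-hand side, so two bounds suffice.

  The bound with \<open>N powr (1/4 - \<epsilon>)\<close> follows from \<open>\<parallel>u\<^sub>M\<parallel>\<^sub>6 \<le> C M powr \<epsilon>\<close> for a flow at frequency \<open>M\<close>, Hoelder
  \<open>L\<^sup>1\<^sup>2 \<times> L\<^sup>6\<close> and Bernstein. The sixth moment is controlled by elementary \<open>l\<^sup>2\<close> decoupling of the cubic
  into intervals of length \<open>M powr (-1/2)\<close>: in \<open>\<integral>|f\<^sub>I|\<^sup>2 |f\<^sub>J|\<^sup>4\<close> with \<open>I\<close>, \<open>J\<close> separated, orthogonality refines \<open>I\<close> to
  the square of the scale of \<open>J\<close>, Hoelder exchanges the roles of \<open>I\<close> and \<open>J\<close>, and iterating this improves any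
  decoupling exponent by an amount bounded below away from \<open>0\<close>. Conjugation reduces to positive
  frequencies.

  The bound with \<open>lam powr (-1/4) + N powr (-1/2)\<close> interpolates the bilinear \<open>L\<^sup>2\<close> estimate of separated
  frequency intervals with \<open>L\<^sup>\<infinity>\<close>; if \<open>L\<close> and \<open>N\<close> are comparable, a Whitney decomposition supplies the separation.
\<close>

section \<open>Integral inequalities and almost orthogonality\<close>

text \<open>On a bounded time interval orthogonality is only approximate; here it is made exact. All
  points (\<xi>^3, \<xi>) with \<xi> in the dual lattice lie in a grid with steps 1/lam^3 and 1/lam,
  and a weight with frequencies on that grid and inside (-1, 1) annihilates every character that is
  not \<open>resonant\<close>. The estimates hold for any measure with this property and mass
  O(lam). The length M^(-1/2) is where curvature meets unit time resolution: over a length b the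
  cubic leaves its tangent by about M b^2, which must be at least 1; hence
  \<open>1 \<le> M * \<delta>\<^sup>2\<close>. Refining I to the square of the scale of J gains
  nothing while J is as long as I, so J is first cut into 2^h parts, at a cost of 2^(4h). After p
  exchanges the saving is 2^(3/2 \<eta> h p), which overtakes the cost once \<eta> p \<ge> 5.
  Distances from the top scale double in every exchange, so h can only be about n / 2^(p+1), and the
  exponent drops by 2^(-p-1). That amount depends only on a lower bound for \<eta>, so every
  positive exponent is reached, but not 0.\<close>

locale continuous_integrable =
  fixes \<mu> :: "(real \<times> real) measure"
  assumes integrable_complex: "\<And>g :: real \<times> real \<Rightarrow> complex. continuous_on UNIV g \<Longrightarrow> integrable \<mu> g"
begin

lemma integrable_real:
  fixes g :: "real \<times> real \<Rightarrow> real"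
  assumes "continuous_on UNIV g"
  shows "integrable \<mu> g"
proof -
  have "integrable \<mu> (\<lambda>z. Re (complex_of_real (g z)))"
    by (intro integrable_Re integrable_complex continuous_intros assms)
  thus ?thesis by simp
qed

lemma integral_mono_real:
  fixes g h :: "real \<times> real \<Rightarrow> real"
  assumes "continuous_on UNIV g" "continuous_on UNIV h" "\<And>z. g z \<le> h z"
  shows "(\<integral>z. g z \<partial>\<mu>) \<le> (\<integral>z. h z \<partial>\<mu>)"
  using assms by (intro integral_mono integrable_real) auto

lemma Cauchy_Schwarz_integral:
  fixes u v :: "real \<times> real \<Rightarrow> real"
  assumes cu: "continuous_on UNIV u" and cv: "continuous_on UNIV v"
    and pos: "\<And>z. 0 \<le> u z" "\<And>z. 0 \<le> v z"
  shows "(\<integral>z. u z * v z \<partial>\<mu>)\<^sup>2 \<le> (\<integral>z. (u z)\<^sup>2 \<partial>\<mu>) * (\<integral>z. (v z)\<^sup>2 \<partial>\<mu>)"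
proof -
  define X U V where "X = (\<integral>z. u z * v z \<partial>\<mu>)" and "U = (\<integral>z. (u z)\<^sup>2 \<partial>\<mu>)" and "V = (\<integral>z. (v z)\<^sup>2 \<partial>\<mu>)"
  have nn: "0 \<le> X" "0 \<le> U" "0 \<le> V"
    unfolding X_def U_def V_def by (intro integral_nonneg_AE AE_I2; simp add: pos)+
  have key: "2 * c * X \<le> c\<^sup>2 * U + V" for c
  proof -
    have "(\<integral>z. 2 * c * (u z * v z) \<partial>\<mu>) \<le> (\<integral>z. c\<^sup>2 * (u z)\<^sup>2 + (v z)\<^sup>2 \<partial>\<mu>)"
    proof (intro integral_mono_real continuous_intros cu cv)
      fix z show "2 * c * (u z * v z) \<le> c\<^sup>2 * (u z)\<^sup>2 + (v z)\<^sup>2"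
        using sum_squares_bound[of "c * u z" "v z"] by (simp add: power_mult_distrib mult_ac)
    qed
    also have "\<dots> = c\<^sup>2 * U + V"
      unfolding U_def V_def
      by (subst Bochner_Integration.integral_add) (auto intro!: integrable_real continuous_intros cu cv)
    finally show ?thesis unfolding X_def by simp
  qed
  have "X\<^sup>2 \<le> U * V"
  proof (cases "X = 0")
    case False
    hence X: "X > 0" using nn by simp
    show ?thesis
    proof (cases "V = 0")
      case True
      \<comment> \<open>The optimal value V/X degenerates to 0 here. Any positive c with c U < 2 X
        contradicts \<open>key\<close>.\<close>
      define c where "c = X / (U+1)"
      have c: "c > 0" using X nn by (simp add: c_def)
      have "c * (2 * X) \<le> c * (c * U)" using key[of c] True by (simp add: power2_eq_square mult_ac)
      hence "2 * X \<le> c * U" using c mult_le_cancel_left_pos by blast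
      also have "c * U \<le> X" using X nn by (simp add: c_def field_simps)
      finally show ?thesis using X by simp
    next
      case False
      hence V: "V > 0" using nn by simp
      have "2 * (V/X) * X \<le> (V/X)\<^sup>2 * U + V" by (rule key)
      hence "V \<le> (V/X)\<^sup>2 * U" using X by simp
      hence "V * X\<^sup>2 \<le> V * (U * V)" using X by (simp add: field_simps power2_eq_square)
      thus ?thesis using V by simp
    qed
  qed (use nn in auto)
  thus ?thesis unfolding X_def U_def V_def .
qed

text \<open>Young's inequality for the exponents 3 and 3/2 with a free scale c, optimised at c =
  V/X. The cubed form keeps fractional powers out of all later uses.\<close>

lemma Hoelder_integral_3:
  fixes u v :: "real \<times> real \<Rightarrow> real"
  assumes cu: "continuous_on UNIV u" and cv: "continuous_on UNIV v"
    and pos: "\<And>z. 0 \<le> u z" "\<And>z. 0 \<le> v z"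
  shows "(\<integral>z. u z * (v z)\<^sup>2 \<partial>\<mu>) ^ 3 \<le> (\<integral>z. (u z) ^ 3 \<partial>\<mu>) * (\<integral>z. (v z) ^ 3 \<partial>\<mu>)\<^sup>2"
proof -
  define X U V where "X = (\<integral>z. u z * (v z)\<^sup>2 \<partial>\<mu>)" and "U = (\<integral>z. (u z)^3 \<partial>\<mu>)" and "V = (\<integral>z. (v z)^3 \<partial>\<mu>)"
  have nn: "0 \<le> X" "0 \<le> U" "0 \<le> V"
    unfolding X_def U_def V_def by (intro integral_nonneg_AE AE_I2; simp add: pos)+
  have key: "3 * c * X \<le> c ^ 3 * U + 2 * V" if c: "c \<ge> 0" for c
  proof -
    have "(\<integral>z. 3 * c * (u z * (v z)\<^sup>2) \<partial>\<mu>) \<le> (\<integral>z. c ^ 3 * (u z)^3 + 2 * (v z)^3 \<partial>\<mu>)"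
    proof (intro integral_mono_real continuous_intros cu cv)
      fix z
      \<comment> \<open>With s = c u, the factorisation s^3 - 3 s v^2 + 2 v^3 = (s - v)^2 (s + 2 v)
        is Young's inequality.\<close>
      have "0 \<le> (c * u z - v z)\<^sup>2 * (c * u z + 2 * v z)" using pos c by simp
      thus "3 * c * (u z * (v z)\<^sup>2) \<le> c ^ 3 * (u z)^3 + 2 * (v z)^3"
        by (simp add: algebra_simps power2_eq_square power3_eq_cube)
    qed
    also have "\<dots> = c ^ 3 * U + 2 * V"
      unfolding U_def V_def
      by (subst Bochner_Integration.integral_add) (auto intro!: integrable_real continuous_intros cu cv)
    finally show ?thesis unfolding X_def by simp
  qed
  have "X ^ 3 \<le> U * V\<^sup>2"
  proof (cases "X = 0")
    case False
    hence X: "X > 0" using nn by simp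
    show ?thesis
    proof (cases "V = 0")
      case True
      define c where "c = sqrt (X / (U+1))"
      have c: "c > 0" "c\<^sup>2 = X/(U+1)" using X nn by (simp_all add: c_def)
      have "3 * c * X \<le> c ^ 3 * U" using key[of c] True c by simp
      hence "c * (3 * X) \<le> c * (c\<^sup>2 * U)" by (simp add: power2_eq_square power3_eq_cube mult_ac)
      hence "3 * X \<le> X / (U+1) * U" using c mult_le_cancel_left_pos by metis
      also have "\<dots> \<le> X" using X nn by (simp add: field_simps)
      finally show ?thesis using X by simp
    next
      case False
      hence V: "V > 0" using nn by simp
      have "3 * (V/X) * X \<le> (V/X)^3 * U + 2 * V" by (rule key) (use V X in simp)
      moreover have "3 * (V/X) * X = 3 * V" using X by simp
      ultimately have "V \<le> (V/X)^3 * U" by linarith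
      hence "V * X^3 \<le> V * (U * V\<^sup>2)" using X by (simp add: field_simps power2_eq_square power3_eq_cube)
      thus ?thesis using V by simp
    qed
  qed (use nn in auto)
  thus ?thesis unfolding X_def U_def V_def .
qed

definition Lnorm :: "nat \<Rightarrow> (real \<times> real \<Rightarrow> complex) \<Rightarrow> real" where
  "Lnorm p g = root p (\<integral>z. norm (g z) ^ p \<partial>\<mu>)"

lemma integral_norm_power_nonneg: "0 \<le> (\<integral>z. norm (g z) ^ p \<partial>\<mu>)"
  by (intro integral_nonneg_AE AE_I2) simp

lemma Lnorm_nonneg: "0 \<le> Lnorm p g"
  by (cases "p = 0") (simp_all add: Lnorm_def integral_norm_power_nonneg)

lemma Lnorm_power: "0 < p \<Longrightarrow> Lnorm p g ^ p = (\<integral>z. norm (g z) ^ p \<partial>\<mu>)"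
  by (simp add: Lnorm_def integral_norm_power_nonneg)

lemma Lnorm_le:
  assumes "0 < p" "0 \<le> B" "(\<integral>z. norm (g z) ^ p \<partial>\<mu>) \<le> B ^ p"
  shows "Lnorm p g \<le> B"
proof (rule power_le_imp_le_base)
  show "Lnorm p g ^ Suc (p - 1) \<le> B ^ Suc (p - 1)"
    using assms by (simp add: Lnorm_power)
qed (use assms in auto)

text \<open>Minkowski's inequality from convexity of x^p: scale both functions to norm at most 1 and
  combine them with weights proportional to the norms.\<close>

lemma Lnorm_triangle:
  assumes p: "0 < p" and cg: "continuous_on UNIV g" and ch: "continuous_on UNIV h"
  shows "Lnorm p (\<lambda>z. g z + h z) \<le> Lnorm p g + Lnorm p h"
proof (rule field_le_epsilon)
  fix e :: real assume e: "e > 0"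
  \<comment> \<open>The extra e/2 makes both scales positive, so that division is possible even if a
    norm vanishes.\<close>
  define a b where "a = Lnorm p g + e / 2" and "b = Lnorm p h + e / 2"
  have ab: "a > 0" "b > 0" using e Lnorm_nonneg[of p g] Lnorm_nonneg[of p h] by (auto simp: a_def b_def)
  have le: "(\<integral>z. norm (g z) ^ p \<partial>\<mu>) \<le> a ^ p" "(\<integral>z. norm (h z) ^ p \<partial>\<mu>) \<le> b ^ p"
    using e Lnorm_nonneg[of p g] Lnorm_nonneg[of p h]
    by (simp_all flip: Lnorm_power[OF p] add: a_def b_def power_mono)
  define s t where "s = a / (a + b)" and "t = b / (a + b)"
  have st: "0 \<le> s" "0 \<le> t" "s + t = 1"
    using ab by (simp_all add: s_def t_def flip: add_divide_distrib)
  have s1: "s = 1 - t" using st by simp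
  have cvx: "convex_on {0::real..} (\<lambda>x. x ^ p)"
    using convex_power_odd[of p] convex_on_subset[OF convex_power_even[of p], of "{0..}"]
    by (cases "even p") auto
  have abst: "(a + b) * s = a" "(a + b) * t = b" using ab by (simp_all add: s_def t_def)
  define G H where "G = (a + b)^p * s / a ^ p" and "H = (a + b) ^ p * t / b ^ p"
  have pt: "norm (g z + h z) ^ p \<le> G * norm (g z) ^ p + H * norm (h z) ^ p" for z
  proof -
    have "norm (g z + h z) ^ p \<le> (norm (g z) + norm (h z)) ^ p"
      by (intro power_mono norm_triangle_ineq) auto
    also have "norm (g z) + norm (h z) = (a + b) * (s * (norm (g z) / a) + t * (norm (h z) / b))"
      using ab abst by (simp add: distrib_left flip: mult.assoc)
    also have "\<dots> ^ p = (a + b) ^ p * (s * (norm (g z) / a) + t * (norm (h z) / b)) ^ p"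
      by (rule power_mult_distrib)
    also have "(s * (norm (g z) / a) + t * (norm (h z) / b)) ^ p
        \<le> s * (norm (g z) / a) ^ p + t * (norm (h z) / b) ^ p"
      using convex_onD[OF cvx, of t "norm (g z) / a" "norm (h z) / b"] st ab
      by (simp add: s1)
    finally show ?thesis using ab
      by (simp add: G_def H_def power_divide algebra_simps)
  qed
  have "(\<integral>z. norm (g z + h z) ^ p \<partial>\<mu>) \<le> (\<integral>z. G * norm (g z) ^ p + H * norm (h z) ^ p \<partial>\<mu>)"
    by (intro integral_mono_real continuous_intros cg ch pt)
  also have "\<dots> = G * (\<integral>z. norm (g z) ^ p \<partial>\<mu>) + H * (\<integral>z. norm (h z) ^ p \<partial>\<mu>)"
    by (subst Bochner_Integration.integral_add) (auto intro!: integrable_real continuous_intros cg ch)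
  also have "\<dots> \<le> G * a ^ p + H * b ^ p"
    using le ab st by (intro add_mono mult_left_mono) (auto simp: G_def H_def)
  also have "\<dots> = (a + b) ^ p * (s + t)" using ab by (simp add: G_def H_def algebra_simps)
  finally have "Lnorm p (\<lambda>z. g z + h z) \<le> a + b"
    using ab p st by (intro Lnorm_le) auto
  thus "Lnorm p (\<lambda>z. g z + h z) \<le> Lnorm p g + Lnorm p h + e" by (simp add: a_def b_def)
qed

text \<open>A Schur test: after expanding the square only related pairs survive, each is split by
  the arithmetic-geometric mean, and symmetry of \<open>R\<close> turns both halves into a count of
  at most \<open>K\<close> partners.\<close>

lemma almost_orthogonal:
  fixes g :: "'i \<Rightarrow> real \<times> real \<Rightarrow> complex"
  assumes fin: "finite P" and cg: "\<And>p. p \<in> P \<Longrightarrow> continuous_on UNIV (g p)"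
    and orth: "\<And>p q. p \<in> P \<Longrightarrow> q \<in> P \<Longrightarrow> \<not> R p q \<Longrightarrow> (\<integral>z. g p z * cnj (g q z) \<partial>\<mu>) = 0"
    and sym: "\<And>p q. R p q \<Longrightarrow> R q p"
    and K: "\<And>p. p \<in> P \<Longrightarrow> real (card {q \<in> P. R p q}) \<le> K"
  shows "(\<integral>z. (norm (\<Sum>p\<in>P. g p z))\<^sup>2 \<partial>\<mu>) \<le> K * (\<Sum>p\<in>P. \<integral>z. (norm (g p z))\<^sup>2 \<partial>\<mu>)"
proof -
  define n where "n p = (\<integral>z. (norm (g p z))\<^sup>2 \<partial>\<mu>)" for p
  have nn: "0 \<le> n p" for p unfolding n_def by (rule integral_norm_power_nonneg)
  have ig: "integrable \<mu> (\<lambda>z. g p z * cnj (g q z))" if "p \<in> P" "q \<in> P" for p q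
    using that by (intro integrable_complex continuous_intros cg)
  have "complex_of_real (\<integral>z. (norm (\<Sum>p\<in>P. g p z))\<^sup>2 \<partial>\<mu>) = (\<integral>z. (\<Sum>p\<in>P. g p z) * cnj (\<Sum>p\<in>P. g p z) \<partial>\<mu>)"
    by (simp add: complex_norm_square del: of_real_power flip: integral_complex_of_real)
  also have "\<dots> = (\<integral>z. (\<Sum>p\<in>P. \<Sum>q\<in>P. g p z * cnj (g q z)) \<partial>\<mu>)"
    by (simp add: sum_product)
  also have "\<dots> = (\<Sum>p\<in>P. \<Sum>q\<in>P. \<integral>z. g p z * cnj (g q z) \<partial>\<mu>)"
    using ig by (subst Bochner_Integration.integral_sum; (intro Bochner_Integration.integrable_sum)?; simp)+
  also have "\<dots> = (\<Sum>p\<in>P. \<Sum>q\<in>{q\<in>P. R p q}. \<integral>z. g p z * cnj (g q z) \<partial>\<mu>)"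
    by (intro sum.cong refl sum.mono_neutral_right) (use fin orth in auto)
  finally have "(\<integral>z. (norm (\<Sum>p\<in>P. g p z))\<^sup>2 \<partial>\<mu>) = Re \<dots>"
    by (metis Re_complex_of_real)
  also have "\<dots> = (\<Sum>p\<in>P. \<Sum>q\<in>{q\<in>P. R p q}. Re (\<integral>z. g p z * cnj (g q z) \<partial>\<mu>))"
    by simp
  also have "\<dots> \<le> (\<Sum>p\<in>P. \<Sum>q\<in>{q\<in>P. R p q}. n p / 2 + n q / 2)"
  proof (intro sum_mono)
    fix p q assume pq: "p \<in> P" "q \<in> {q\<in>P. R p q}"
    have "Re (\<integral>z. g p z * cnj (g q z) \<partial>\<mu>) = (\<integral>z. Re (g p z * cnj (g q z)) \<partial>\<mu>)"
      using ig pq by (subst integral_Re) auto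
    also have "\<dots> \<le> (\<integral>z. (norm (g p z))\<^sup>2 / 2 + (norm (g q z))\<^sup>2 / 2 \<partial>\<mu>)"
    proof (intro integral_mono_real continuous_intros)
      fix z
      have "Re (g p z * cnj (g q z)) \<le> norm (g p z) * norm (g q z)"
        by (metis complex_Re_le_cmod complex_mod_cnj norm_mult)
      also have "\<dots> \<le> (norm (g p z))\<^sup>2 / 2 + (norm (g q z))\<^sup>2 / 2"
        using sum_squares_bound[of "norm (g p z)" "norm (g q z)"] by simp
      finally show "Re (g p z * cnj (g q z)) \<le> \<dots>" .
    qed (use cg pq in auto)
    also have "\<dots> = n p / 2 + n q / 2"
      unfolding n_def using cg pq
      by (subst Bochner_Integration.integral_add) (auto intro!: integrable_real continuous_intros)
    finally show "Re (\<integral>z. g p z * cnj (g q z) \<partial>\<mu>) \<le> n p / 2 + n q / 2" .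
  qed
  also have "\<dots> = (\<Sum>p\<in>P. \<Sum>q\<in>{q\<in>P. R p q}. n p / 2) + (\<Sum>p\<in>P. \<Sum>q\<in>{q\<in>P. R p q}. n q / 2)"
    by (simp add: sum.distrib)
  also have "(\<Sum>p\<in>P. \<Sum>q\<in>{q\<in>P. R p q}. n q / 2) = (\<Sum>q\<in>P. \<Sum>p\<in>{p\<in>P. R p q}. n q / 2)"
    by (rule sum.swap_restrict[OF fin fin])
  also have "\<dots> = (\<Sum>p\<in>P. \<Sum>q\<in>{q\<in>P. R p q}. n p / 2)"
    by (intro sum.cong refl) (auto intro: sym)
  also have "(\<Sum>p\<in>P. \<Sum>q\<in>{q\<in>P. R p q}. n p / 2) + (\<Sum>p\<in>P. \<Sum>q\<in>{q\<in>P. R p q}. n p / 2)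
      = (\<Sum>p\<in>P. real (card {q \<in> P. R p q}) * n p)"
    by (simp add: mult.commute flip: sum.distrib)
  also have "\<dots> \<le> (\<Sum>p\<in>P. K * n p)"
    using K nn by (intro sum_mono mult_right_mono) auto
  finally show ?thesis by (simp add: n_def sum_distrib_left)
qed

end

section \<open>Characters, trigonometric polynomials and resonance\<close>

definition char :: "real \<times> real \<Rightarrow> real \<times> real \<Rightarrow> complex" where
  "char p z = cis (2 * pi * (p \<bullet> z))"

lemma char_add: "char (p + q) z = char p z * char q z"
  by (simp add: char_def cis_mult inner_add_left algebra_simps)

lemma char_uminus: "char (- p) z = cnj (char p z)"
  by (simp add: char_def cis_cnj)

lemma norm_char [simp]: "norm (char p z) = 1"
  by (simp add: char_def)

lemma continuous_char [continuous_intros]: "continuous_on A (char p)"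
  unfolding char_def[abs_def] by (intro continuous_intros)

text \<open>\<open>A\<close> only has to contain the spectrum. Cancellation and repeated frequencies
  then need no bookkeeping, and products are governed by sumsets alone.\<close>

inductive_set trig :: "(real \<times> real) set \<Rightarrow> (real \<times> real \<Rightarrow> complex) set" for A where
  trig_char: "p \<in> A \<Longrightarrow> (\<lambda>z. c * char p z) \<in> trig A"
| trig_zero: "(\<lambda>z. 0) \<in> trig A"
| trig_add: "g \<in> trig A \<Longrightarrow> h \<in> trig A \<Longrightarrow> (\<lambda>z. g z + h z) \<in> trig A"

lemma trig_continuous: "g \<in> trig A \<Longrightarrow> continuous_on UNIV g"
  by (induction rule: trig.induct) (auto intro!: continuous_intros)

lemma trig_sum:
  assumes "finite P" "\<And>p. p \<in> P \<Longrightarrow> g p \<in> trig A"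
  shows "(\<lambda>z. \<Sum>p\<in>P. g p z) \<in> trig A"
  using assms by (induction rule: finite_induct) (auto intro: trig.intros)

lemma trig_cnj:
  assumes "g \<in> trig A"
  shows "(\<lambda>z. cnj (g z)) \<in> trig (uminus ` A)"
  using assms
proof (induction rule: trig.induct)
  case (trig_char p c)
  have "(\<lambda>z. cnj c * char (- p) z) \<in> trig (uminus ` A)" using trig_char by (intro trig.trig_char) auto
  thus ?case by (simp add: char_uminus)
qed (auto intro: trig.intros)

lemma trig_mult_char:
  assumes "g \<in> trig A" and "\<And>q. q \<in> A \<Longrightarrow> p + q \<in> C"
  shows "(\<lambda>z. c * char p z * g z) \<in> trig C"
  using assms(1)
proof (induction rule: trig.induct)
  case (trig_char q c')
  have "(\<lambda>z. (c * c') * char (p + q) z) \<in> trig C" using trig_char assms(2) by (intro trig.trig_char) auto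
  thus ?case by (simp add: char_add mult_ac)
qed (auto intro: trig.intros simp: distrib_left)

lemma trig_mult:
  assumes "g \<in> trig A" "h \<in> trig B" "\<And>p q. p \<in> A \<Longrightarrow> q \<in> B \<Longrightarrow> p + q \<in> C"
  shows "(\<lambda>z. g z * h z) \<in> trig C"
  using assms(1)
proof (induction rule: trig.induct)
  case (trig_char p c)
  show ?case by (rule trig_mult_char[OF assms(2)]) (use trig_char assms in auto)
qed (auto intro: trig.intros simp: distrib_right)

definition curve :: "real \<Rightarrow> real \<times> real" where
  "curve \<xi> = (\<xi> ^ 3, \<xi>)"

text \<open>The group of frequencies with period lam^3 in time and lam in space. It contains the
  curve over the dual lattice, and sums and differences stay in it, so every nontrivial character
  that arises integrates to 0 over a period box.\<close>

definition grid :: "real \<Rightarrow> (real \<times> real) set" where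
  "grid lam = {p. fst p * lam ^ 3 \<in> \<int> \<and> snd p * lam \<in> \<int>}"

lemma grid_add: "p \<in> grid lam \<Longrightarrow> q \<in> grid lam \<Longrightarrow> p + q \<in> grid lam"
  by (auto simp: grid_def distrib_right)

lemma grid_diff: "p \<in> grid lam \<Longrightarrow> q \<in> grid lam \<Longrightarrow> p - q \<in> grid lam"
  by (auto simp: grid_def left_diff_distrib)

lemma curve_in_grid:
  assumes "\<xi> \<in> dual_lattice lam" "lam \<noteq> 0"
  shows "curve \<xi> \<in> grid lam"
proof -
  obtain k :: int where k: "\<xi> = real_of_int k / lam" using assms by (auto simp: dual_lattice_def)
  have "\<xi> ^ 3 * lam ^ 3 = real_of_int (k ^ 3)" "\<xi> * lam = real_of_int k"
    using assms by (simp_all add: k power_divide)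
  thus ?thesis by (simp only: curve_def grid_def mem_Collect_eq fst_conv snd_conv Ints_of_int simp_thms)
qed

text \<open>Equality in space is exact because the torus is integrated over fully; the tolerance 1
  in time is the uncertainty of a window of unit length.\<close>

definition resonant :: "real \<times> real \<Rightarrow> bool" where
  "resonant p \<longleftrightarrow> snd p = 0 \<and> \<bar>fst p\<bar> < 1"

locale resonance_measure = continuous_integrable \<mu> for \<mu> +
  fixes lam :: real
  assumes lam: "0 < lam"
    and orth: "\<And>p. p \<in> grid lam \<Longrightarrow> \<not> resonant p \<Longrightarrow> (\<integral>z. char p z \<partial>\<mu>) = 0"
begin

lemma trig_integral_zero:
  assumes "g \<in> trig A" and A: "\<And>p. p \<in> A \<Longrightarrow> p \<in> grid lam \<and> \<not> resonant p"
  shows "(\<integral>z. g z \<partial>\<mu>) = 0"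
  using assms(1)
proof (induction rule: trig.induct)
  case (trig_add g h)
  thus ?case
    by (subst Bochner_Integration.integral_add) (auto intro!: integrable_complex trig_continuous)
qed (use A orth in auto)

lemma trig_orthogonal:
  assumes g: "g \<in> trig A" and h: "h \<in> trig B" and AB: "A \<subseteq> grid lam" "B \<subseteq> grid lam"
    and nr: "\<And>p q. p \<in> A \<Longrightarrow> q \<in> B \<Longrightarrow> \<not> resonant (p - q)"
  shows "(\<integral>z. g z * cnj (h z) \<partial>\<mu>) = 0"
proof (rule trig_integral_zero)
  show "(\<lambda>z. g z * cnj (h z)) \<in> trig {p - q | p q. p \<in> A \<and> q \<in> B}"
  proof (rule trig_mult[OF g trig_cnj[OF h]])
    fix p q assume "p \<in> A" "q \<in> uminus ` B"
    then obtain r where "r \<in> B" "p + q = p - r" by auto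
    thus "p + q \<in> {p - q | p q. p \<in> A \<and> q \<in> B}" using \<open>p \<in> A\<close> by blast
  qed
next
  fix p assume "p \<in> {p - q | p q. p \<in> A \<and> q \<in> B}"
  then obtain q r where "q \<in> A" "r \<in> B" "p = q - r" by blast
  thus "p \<in> grid lam \<and> \<not> resonant p" using AB nr grid_diff[of q lam r] by auto
qed

end

text \<open>With \<open>\<psi> \<xi> = (\<xi> - c)\<^sup>2 (\<xi> + 2 c)\<close>, the cubic minus its tangent at \<open>c\<close>, resonance forces
  \<open>\<psi> \<xi> - \<psi> \<xi>'\<close> to be \<open>O(1 + M b\<^sup>2)\<close>, while \<open>\<psi>\<close> has slope at least \<open>3 M d\<close> at distance \<open>d\<close> from \<open>c\<close>.\<close>

lemma resonance_bound:
  fixes \<kappa> :: real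
  assumes M: "0 < M" and \<kappa>: "1 \<le> \<kappa>" and b: "1 \<le> M * b\<^sup>2" and d: "0 < d"
    and range: "{\<xi>, \<xi>', c, x, y, w} \<subseteq> {M..\<kappa> * M}"
    and close: "\<bar>x - c\<bar> \<le> b" "\<bar>y - c\<bar> \<le> b" "\<bar>w - c\<bar> \<le> b"
    and sep: "c + d \<le> \<xi> \<and> c + d \<le> \<xi>' \<or> \<xi> + d \<le> c \<and> \<xi>' + d \<le> c"
    and res: "resonant ((curve \<xi> + curve c + curve x) - (curve \<xi>' + curve y + curve w))"
  shows "\<bar>\<xi> - \<xi>'\<bar> * d \<le> 3 * \<kappa> * b\<^sup>2"
proof -
  define \<psi> where "\<psi> s = (s - c)\<^sup>2 * (s + 2 * c)" for s
  have psi: "\<psi> s = s ^ 3 - c ^ 3 - 3 * c\<^sup>2 * (s - c)" for s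
    by (simp add: \<psi>_def algebra_simps power2_eq_square power3_eq_cube)
  have small: "0 \<le> \<psi> s" "\<psi> s \<le> 3 * \<kappa> * M * b\<^sup>2" if "\<bar>s - c\<bar> \<le> b" "s \<in> {M..\<kappa>*M}" for s
  proof -
    have c: "c \<in> {M..\<kappa>*M}" using range by auto
    show "0 \<le> \<psi> s" using that c M by (simp add: \<psi>_def)
    have "(s - c)\<^sup>2 \<le> b\<^sup>2" using that by (metis abs_ge_zero power2_abs power_mono)
    hence "\<psi> s \<le> b\<^sup>2 * (3 * (\<kappa> * M))"
      unfolding \<psi>_def using that c M by (intro mult_mono) auto
    thus "\<psi> s \<le> 3 * \<kappa> * M * b\<^sup>2" by (simp add: mult_ac)
  qed
  have e1: "\<xi> + c + x = \<xi>' + y + w" and e2: "\<bar>(\<xi>^3 + c^3 + x^3) - (\<xi>'^3 + y^3 + w^3)\<bar> < 1"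
    using res by (auto simp: resonant_def curve_def)
  \<comment> \<open>The point c is missing on the left because \<psi> vanishes there, and the
    tangent part of \<psi> enters only through the difference of the space frequencies, which is
    0.\<close>
  have "(\<psi> \<xi> + \<psi> x) - (\<psi> \<xi>' + \<psi> y + \<psi> w) = (\<xi>^3 + c^3 + x^3) - (\<xi>'^3 + y^3 + w^3) - 3 * c\<^sup>2 * ((\<xi> + c + x) - (\<xi>' + y + w))"
    unfolding psi by (simp add: algebra_simps power2_eq_square power3_eq_cube)
  hence "\<bar>(\<psi> \<xi> + \<psi> x) - (\<psi> \<xi>' + \<psi> y + \<psi> w)\<bar> < 1" using e1 e2 by simp
  moreover have "0 \<le> \<psi> x" "\<psi> x \<le> 3 * \<kappa> * M * b\<^sup>2" "0 \<le> \<psi> y" "\<psi> y \<le> 3 * \<kappa> * M * b\<^sup>2"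
     "0 \<le> \<psi> w" "\<psi> w \<le> 3 * \<kappa> * M * b\<^sup>2"
    using small close range by auto
  ultimately have up: "\<bar>\<psi> \<xi> - \<psi> \<xi>'\<bar> \<le> 1 + 6 * \<kappa> * M * b\<^sup>2" by linarith
  \<comment> \<open>The divided difference of \<psi>. Having both points on the same side of c, at
    distance d, gives it a definite sign and a lower bound.\<close>
  define Q where "Q = \<xi>\<^sup>2 + \<xi> * \<xi>' + \<xi>'\<^sup>2 - 3 * c\<^sup>2"
  have eq: "\<psi> \<xi> - \<psi> \<xi>' = (\<xi> - \<xi>') * Q"
    unfolding psi Q_def by (simp add: algebra_simps power2_eq_square power3_eq_cube)
  have pos: "M \<le> \<xi>" "M \<le> \<xi>'" "M \<le> c" using range by auto
  have Q: "3 * M * d \<le> \<bar>Q\<bar>"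
    using sep
  proof
    assume "c + d \<le> \<xi> \<and> c + d \<le> \<xi>'"
    hence "(c + d) * (c + d) \<le> \<xi> * \<xi>" "(c + d) * (c + d) \<le> \<xi> * \<xi>'" "(c + d) * (c + d) \<le> \<xi>' * \<xi>'"
      using d M pos by (auto intro!: mult_mono)
    hence "3 * ((c + d) * (c + d)) - 3 * c\<^sup>2 \<le> Q" by (simp add: Q_def power2_eq_square)
    moreover have "3 * ((c + d) * (c + d)) - 3 * c\<^sup>2 = 6 * (c * d) + 3 * (d * d)"
      by (simp add: algebra_simps power2_eq_square)
    moreover have "M * d \<le> c * d" "0 \<le> d * d" "0 \<le> M * d" using pos d M by (auto intro: mult_right_mono)
    ultimately have "3 * (M * d) \<le> \<bar>Q\<bar>" by linarith
    thus ?thesis by simp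
  next
    assume s: "\<xi> + d \<le> c \<and> \<xi>' + d \<le> c"
    hence "\<xi> * \<xi> \<le> (c - d) * (c - d)" "\<xi> * \<xi>' \<le> (c - d) * (c - d)" "\<xi>' * \<xi>' \<le> (c - d) * (c - d)"
      using d M pos by (auto intro!: mult_mono)
    hence "Q \<le> 3 * ((c - d) * (c - d)) - 3 * c\<^sup>2" by (simp add: Q_def power2_eq_square)
    moreover have "3 * ((c - d) * (c - d)) - 3 * c\<^sup>2 = - 3 * (c * d) - 3 * (d * (c - d))"
      by (simp add: algebra_simps power2_eq_square)
    moreover have "M * d \<le> c * d" "0 \<le> d * (c - d)" using pos d M s by (auto intro: mult_right_mono)
    ultimately have "3 * (M * d) \<le> \<bar>Q\<bar>" by linarith
    thus ?thesis by simp
  qed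
  have "\<bar>\<xi> - \<xi>'\<bar> * (3 * M * d) \<le> \<bar>\<xi> - \<xi>'\<bar> * \<bar>Q\<bar>" using Q by (intro mult_left_mono) auto
  also have "\<dots> \<le> 1 + 6 * \<kappa> * M * b\<^sup>2" using up by (simp add: eq abs_mult)
  \<comment> \<open>The time tolerance 1 is absorbed by the curvature term, as M b^2 is at least
    1.\<close>
  also have "\<dots> \<le> 9 * \<kappa> * (M * b\<^sup>2)"
  proof -
    have "1 * 1 \<le> \<kappa> * (M * b\<^sup>2)" using \<kappa> b by (intro mult_mono) auto
    thus ?thesis by (simp add: mult_ac)
  qed
  finally have "(3 * M) * (\<bar>\<xi> - \<xi>'\<bar> * d) \<le> (3 * M) * (3 * \<kappa> * b\<^sup>2)" by (simp add: mult_ac)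
  moreover have "0 < 3 * M" using M by simp
  ultimately show ?thesis by (metis mult_le_cancel_left_pos)
qed

section \<open>Whitney decomposition\<close>

text \<open>The bilinear Whitney decomposition of \<open>f\<^sup>2\<close>: adjacent intervals of a dyadic grid split into
  one adjacent pair and three separated pairs one level below.\<close>

locale whitney =
  fixes \<nu> :: "('z \<Rightarrow> complex) \<Rightarrow> real" and P :: "('z \<Rightarrow> complex) set"
    and f :: "nat \<Rightarrow> nat \<Rightarrow> 'z \<Rightarrow> complex" and S :: "nat \<Rightarrow> nat \<Rightarrow> real" and \<beta> :: "nat \<Rightarrow> real"
  assumes P_mult: "\<And>j i i'. (\<lambda>z. f j i z * f j i' z) \<in> P"
    and P_add: "\<And>g h. g \<in> P \<Longrightarrow> h \<in> P \<Longrightarrow> (\<lambda>z. g z + h z) \<in> P"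
    and triangle: "\<And>g h. g \<in> P \<Longrightarrow> h \<in> P \<Longrightarrow> \<nu> (\<lambda>z. g z + h z) \<le> \<nu> g + \<nu> h"
    and split_f: "\<And>j i. f (Suc j) i = (\<lambda>z. f j (2 * i) z + f j (2 * i + 1) z)"
    and split_S: "\<And>j i. S (Suc j) i = S j (2 * i) + S j (2 * i + 1)"
    and S_nonneg: "\<And>j i. 0 \<le> S j i"
    and separated: "\<And>j i i'. i + 2 \<le> i' \<Longrightarrow> \<nu> (\<lambda>z. f j i z * f j i' z) \<le> \<beta> j * sqrt (S j i * S j i')"
    and \<beta>_nonneg: "\<And>j. 0 \<le> \<beta> j"
begin

lemma sqrt_le_children:
  assumes "i \<in> {2 * k, 2 * k + 1}" "i' \<in> {2 * k', 2 * k' + 1}"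
  shows "sqrt (S j i * S j i') \<le> sqrt (S (Suc j) k * S (Suc j) k')"
  using assms S_nonneg by (intro real_sqrt_le_mono mult_mono) (auto simp: split_S)

text \<open>Each level contains a single adjacent pair, so the constant of the base level is carried
  along without being multiplied; the three separated pairs add 3 \<open>\<beta> j\<close>. Passing
  to the parents only enlarges the weight \<open>sqrt (S j i * S j i')\<close>.\<close>

lemma adjacent:
  assumes A0: "0 \<le> A0" "\<And>i. \<nu> (\<lambda>z. f 0 i z * f 0 (i + 1) z) \<le> A0 * sqrt (S 0 i * S 0 (i + 1))"
  shows "\<nu> (\<lambda>z. f j i z * f j (i + 1) z) \<le> (A0 + 3 * (\<Sum>l<j. \<beta> l)) * sqrt (S j i * S j (i + 1))"
proof (induction j arbitrary: i)
  case 0 show ?case using A0 by simp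
next
  case (Suc j)
  let ?s = "sqrt (S (Suc j) i * S (Suc j) (i + 1))"
  define p where "p k k' z = f j k z * f j k' z" for k k' z
  have pP: "p k k' \<in> P" for k k' unfolding p_def using P_mult by auto
  have eq: "(\<lambda>z. f (Suc j) i z * f (Suc j) (i + 1) z) =
     (\<lambda>z. ((p (2*i) (2*i+2) z + p (2*i) (2*i+3) z) + p (2*i+1) (2*i+3) z) + p (2*i+1) (2*i+1+1) z)"
    by (rule ext) (simp add: split_f p_def algebra_simps eval_nat_numeral)
  have sep: "\<nu> (p k k') \<le> \<beta> j * ?s" if "k \<in> {2*i, 2*i+1}" "k' \<in> {2*(i+1), 2*(i+1)+1}" "k + 2 \<le> k'" for k k'
  proof -
    have "\<nu> (p k k') \<le> \<beta> j * sqrt (S j k * S j k')" unfolding p_def using separated that by auto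
    also have "\<dots> \<le> \<beta> j * ?s" using that by (intro mult_left_mono sqrt_le_children \<beta>_nonneg) auto
    finally show ?thesis .
  qed
  have "\<nu> (p (2*i+1) (2*i+1+1)) \<le> (A0 + 3 * (\<Sum>l<j. \<beta> l)) * sqrt (S j (2*i+1) * S j (2*i+1+1))"
    unfolding p_def by (rule Suc.IH)
  also have "\<dots> \<le> (A0 + 3 * (\<Sum>l<j. \<beta> l)) * ?s"
    using A0 by (intro mult_left_mono sqrt_le_children add_nonneg_nonneg mult_nonneg_nonneg sum_nonneg \<beta>_nonneg) auto
  finally have adj: "\<nu> (p (2*i+1) (2*i+1+1)) \<le> (A0 + 3 * (\<Sum>l<j. \<beta> l)) * ?s" .
  have "\<nu> (\<lambda>z. f (Suc j) i z * f (Suc j) (i + 1) z)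
      \<le> ((\<nu> (p (2*i) (2*i+2)) + \<nu> (p (2*i) (2*i+3))) + \<nu> (p (2*i+1) (2*i+3))) + \<nu> (p (2*i+1) (2*i+1+1))"
    unfolding eq by (intro order_trans[OF triangle] add_mono P_add pP order_refl triangle)
  also have "\<dots> \<le> ((\<beta> j * ?s + \<beta> j * ?s) + \<beta> j * ?s) + (A0 + 3 * (\<Sum>l<j. \<beta> l)) * ?s"
    using sep[of "2*i" "2*i+2"] sep[of "2*i" "2*i+3"] sep[of "2*i+1" "2*i+3"] adj by (intro add_mono) auto
  finally show ?case by (simp add: algebra_simps)
qed

text \<open>The two diagonal products recombine without loss because \<open>S\<close> is additive;
  the two equal products of adjacent children add one constant of \<open>adjacent\<close> per level.
  Growth of \<open>\<beta>\<close> at rate r > 1 makes both nested sums geometric, whence the factor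
  1 / (r - 1)^2.\<close>

lemma square:
  assumes A0: "0 \<le> A0" "\<And>i. \<nu> (\<lambda>z. f 0 i z * f 0 (i + 1) z) \<le> A0 * sqrt (S 0 i * S 0 (i + 1))"
    and D0: "\<And>i. \<nu> (\<lambda>z. f 0 i z * f 0 i z) \<le> A0 * S 0 i"
    and K: "A0 \<le> K" and r: "1 < r" and \<beta>: "\<And>j. j < n \<Longrightarrow> \<beta> j \<le> K * r ^ j"
  shows "\<nu> (\<lambda>z. f n i z * f n i z) \<le> (1 + 3 / (r - 1)\<^sup>2 + 1 / (r - 1)) * K * r ^ n * S n i"
proof -
  have K0: "0 \<le> K" using A0 K by simp
  define \<alpha> where "\<alpha> j = A0 + 3 * (\<Sum>l<j. \<beta> l)" for j
  have \<alpha>0: "0 \<le> \<alpha> j" for j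
    using A0 \<beta>_nonneg by (auto simp: \<alpha>_def intro!: add_nonneg_nonneg sum_nonneg)
  have rec: "\<nu> (\<lambda>z. f j i z * f j i z) \<le> (A0 + (\<Sum>l<j. \<alpha> l)) * S j i" for j i
  proof (induction j arbitrary: i)
    case 0 show ?case using D0 by simp
  next
    case (Suc j)
    define p where "p k k' z = f j k z * f j k' z" for k k' z
    have pP: "p k k' \<in> P" for k k' unfolding p_def using P_mult by auto
    have eq: "(\<lambda>z. f (Suc j) i z * f (Suc j) i z) =
       (\<lambda>z. ((p (2*i) (2*i) z + p (2*i+1) (2*i+1) z) + p (2*i) (2*i+1) z) + p (2*i) (2*i+1) z)"
      by (rule ext) (simp add: split_f p_def algebra_simps)
    have IH: "\<nu> (p k k) \<le> (A0 + (\<Sum>l<j. \<alpha> l)) * S j k" for k unfolding p_def by (rule Suc.IH)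
    have adj: "\<nu> (p (2*i) (2*i+1)) \<le> \<alpha> j * ((S j (2*i) + S j (2*i+1)) / 2)"
    proof -
      have "\<nu> (p (2*i) (2*i+1)) \<le> \<alpha> j * sqrt (S j (2*i) * S j (2*i+1))"
        unfolding p_def \<alpha>_def by (rule adjacent[OF A0])
      also have "sqrt (S j (2*i) * S j (2*i+1)) \<le> (S j (2*i) + S j (2*i+1)) / 2"
        by (intro arith_geo_mean_sqrt S_nonneg)
      finally show ?thesis using \<alpha>0 by (simp add: mult_left_mono)
    qed
    have "\<nu> (\<lambda>z. f (Suc j) i z * f (Suc j) i z)
      \<le> ((\<nu> (p (2*i) (2*i)) + \<nu> (p (2*i+1) (2*i+1))) + \<nu> (p (2*i) (2*i+1))) + \<nu> (p (2*i) (2*i+1))"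
      unfolding eq by (intro order_trans[OF triangle] add_mono P_add pP order_refl triangle)
    also have "\<dots> \<le> (((A0 + (\<Sum>l<j. \<alpha> l)) * S j (2*i) + (A0 + (\<Sum>l<j. \<alpha> l)) * S j (2*i+1))
        + \<alpha> j * ((S j (2*i) + S j (2*i+1)) / 2)) + \<alpha> j * ((S j (2*i) + S j (2*i+1)) / 2)"
      by (intro add_mono adj IH)
    also have "\<dots> = (A0 + (\<Sum>l<Suc j. \<alpha> l)) * S (Suc j) i"
      by (simp add: split_S field_simps)
    finally show ?case .
  qed
  have geo: "(\<Sum>l<j. r ^ l) \<le> r ^ j / (r - 1)" for j
    using r by (subst geometric_sum) (auto simp: divide_right_mono)
  have \<alpha>: "\<alpha> j \<le> K + 3 * K * r ^ j / (r - 1)" if "j \<le> n" for j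
  proof -
    have "(\<Sum>l<j. \<beta> l) \<le> (\<Sum>l<j. K * r ^ l)" using that by (intro sum_mono \<beta>) auto
    also have "\<dots> \<le> K * (r ^ j / (r - 1))"
      unfolding sum_distrib_left[symmetric] by (intro mult_left_mono geo K0)
    finally show ?thesis using K by (simp add: \<alpha>_def)
  qed
  have \<alpha>': "\<alpha> j \<le> K * (1 + 3 / (r - 1)) * r ^ j" if "j < n" for j
  proof -
    have "K * 1 \<le> K * r ^ j" using K0 r by (intro mult_left_mono one_le_power) auto
    thus ?thesis using \<alpha>[of j] that by (simp add: field_simps)
  qed
  have "A0 + (\<Sum>l<n. \<alpha> l) \<le> K * r ^ n + (\<Sum>l<n. K * (1 + 3 / (r - 1)) * r ^ l)"
  proof (intro add_mono sum_mono \<alpha>')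
    have "K * 1 \<le> K * r ^ n" using K0 r by (intro mult_left_mono one_le_power) auto
    thus "A0 \<le> K * r ^ n" using K by simp
  qed auto
  also have "(\<Sum>l<n. K * (1 + 3 / (r - 1)) * r ^ l) \<le> K * (1 + 3 / (r - 1)) * (r ^ n / (r - 1))"
    unfolding sum_distrib_left[symmetric] using K0 r by (intro mult_left_mono geo) auto
  also have "K * r ^ n + K * (1 + 3 / (r - 1)) * (r ^ n / (r - 1)) = (1 + 3 / (r - 1)\<^sup>2 + 1 / (r - 1)) * K * r ^ n"
    using r by (simp add: divide_simps) (simp add: algebra_simps power2_eq_square)
  finally show ?thesis using rec[of n i] S_nonneg[of n i]
    by (meson mult_right_mono order_trans add_left_mono)
qed

end

section \<open>Decoupling for the cubic\<close>

definition children :: "nat \<Rightarrow> nat \<Rightarrow> nat set" where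
  "children k i = {q. q div 2 ^ k = i}"

lemma children_eq: "children k i = {i * 2 ^ k..<(i + 1) * 2 ^ k}"
proof -
  have "q div 2 ^ k = i \<longleftrightarrow> i * 2 ^ k \<le> q \<and> q < (i + 1) * 2 ^ k" for q
    using div_nat_eqI[of "2 ^ k" i q] dividend_less_div_times[of "2 ^ k" q]
    by (auto simp: mult.commute)
  thus ?thesis unfolding children_def by (intro set_eqI) simp
qed

lemma finite_children [simp]: "finite (children k i)"
  by (simp add: children_eq)

lemma card_children: "card (children k i) = 2 ^ k"
  by (simp add: children_eq)

text \<open>Comparison with the largest term. One factor \<open>card Q\<close> is lost against the
  power mean inequality, which the choice of the number of rounds later accommodates.\<close>

lemma sum_power_le:
  fixes x :: "'i \<Rightarrow> real"
  assumes "finite Q" "\<And>q. q \<in> Q \<Longrightarrow> 0 \<le> x q" "0 < p"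
  shows "(\<Sum>q\<in>Q. x q) ^ p \<le> real (card Q) ^ p * (\<Sum>q\<in>Q. x q ^ p)"
proof (cases "Q = {}")
  case False
  define m where "m = Max (x ` Q)"
  have "m \<in> x ` Q" using assms False by (simp add: m_def)
  then obtain q where q: "q \<in> Q" "m = x q" by auto
  have "(\<Sum>q\<in>Q. x q) \<le> real (card Q) * m"
    using assms by (intro sum_bounded_above) (simp add: m_def)
  hence "(\<Sum>q\<in>Q. x q) ^ p \<le> (real (card Q) * m) ^ p"
    using assms by (intro power_mono sum_nonneg) auto
  also have "\<dots> = real (card Q) ^ p * x q ^ p" by (simp add: q power_mult_distrib)
  also have "x q ^ p \<le> (\<Sum>q\<in>Q. x q ^ p)"
    using assms q by (intro member_le_sum) auto
  finally show ?thesis by (simp add: mult_left_mono)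
qed (use assms in \<open>simp add: zero_power\<close>)

lemma sum_power_le_power_sum:
  fixes x :: "'i \<Rightarrow> real"
  assumes "finite Q" "\<And>q. q \<in> Q \<Longrightarrow> 0 \<le> x q"
  shows "(\<Sum>q\<in>Q. x q ^ Suc p) \<le> (\<Sum>q\<in>Q. x q) ^ Suc p"
proof -
  have "(\<Sum>q\<in>Q. x q ^ Suc p) \<le> (\<Sum>q\<in>Q. x q * (\<Sum>q\<in>Q. x q) ^ p)"
  proof (rule sum_mono)
    fix q assume q: "q \<in> Q"
    have "x q \<le> (\<Sum>q\<in>Q. x q)" using assms q by (intro member_le_sum) auto
    thus "x q ^ Suc p \<le> x q * (\<Sum>q\<in>Q. x q) ^ p"
      using assms q by (simp add: mult_left_mono power_mono)
  qed
  thus ?thesis by (simp add: sum_distrib_right[symmetric])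
qed

definition wave_sum :: "(real \<Rightarrow> complex) \<Rightarrow> real set \<Rightarrow> real \<times> real \<Rightarrow> complex" where
  "wave_sum a G z = (\<Sum>\<xi>\<in>G. a \<xi> * char (curve \<xi>) z)"

lemma wave_sum_trig: "finite G \<Longrightarrow> wave_sum a G \<in> trig (curve ` G)"
  unfolding wave_sum_def[abs_def] by (intro trig_sum trig_char) auto

lemma continuous_wave_sum [continuous_intros]: "continuous_on A (wave_sum a G)"
  unfolding wave_sum_def[abs_def] by (intro continuous_intros)

section \<open>Dyadic frequency cells and mixed moments\<close>

locale airy_data = resonance_measure \<mu> lam for \<mu> lam +
  fixes M \<delta> :: real and \<kappa> :: nat and F :: "real set" and a :: "real \<Rightarrow> complex"
  assumes M: "0 < M" and \<delta>: "0 < \<delta>" and \<kappa>: "1 \<le> \<kappa>" and finite_F: "finite F"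
    and F_lattice: "F \<subseteq> dual_lattice lam" and F_range: "F \<subseteq> {M..\<kappa> * M}"
begin

text \<open>Levels count upwards from width \<delta>: a cell of level j has width 2^j \<delta>, and
  its parent is found by halving the index. \<open>nat\<close> does no harm since frequencies in
  \<open>F\<close> are positive.\<close>

definition cell :: "nat \<Rightarrow> nat \<Rightarrow> real set" where
  "cell j i = {\<xi> \<in> F. nat \<lfloor>\<xi> / \<delta>\<rfloor> div 2 ^ j = i}"

abbreviation piece :: "nat \<Rightarrow> nat \<Rightarrow> real \<times> real \<Rightarrow> complex" where
  "piece j i \<equiv> wave_sum a (cell j i)"

lemma finite_cell [simp]: "finite (cell j i)"
  using finite_F by (simp add: cell_def)

lemma cell_subset: "cell j i \<subseteq> F"
  by (auto simp: cell_def)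

lemma cell_nested:
  assumes "\<xi> \<in> cell m q" "m \<le> j" "q div 2 ^ (j - m) = i"
  shows "\<xi> \<in> cell j i"
  using assms by (auto simp: cell_def simp flip: div_mult2_eq power_add)

lemma cell_bounds:
  assumes "\<xi> \<in> cell j i"
  shows "real i * (2 ^ j * \<delta>) \<le> \<xi>" "\<xi> < (real i + 1) * (2 ^ j * \<delta>)"
proof -
  define g where "g = nat \<lfloor>\<xi> / \<delta>\<rfloor>"
  have \<xi>: "0 < \<xi>" using assms M F_range by (fastforce simp: cell_def)
  have "real g \<le> \<xi> / \<delta>" "\<xi> / \<delta> < real g + 1"
    using \<xi> \<delta> by (auto simp: g_def)
  hence g: "real g * \<delta> \<le> \<xi>" "\<xi> < real (g + 1) * \<delta>" using \<delta> by (auto simp: field_simps)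
  have "g \<in> children j i" using assms by (auto simp: cell_def children_def g_def)
  hence "i * 2 ^ j \<le> g" "g + 1 \<le> (i + 1) * 2 ^ j" by (auto simp: children_eq)
  hence "real (i * 2 ^ j) \<le> real g" "real (g + 1) \<le> real ((i + 1) * 2 ^ j)" by (simp_all only: of_nat_le_iff)
  hence "real (i * 2 ^ j) * \<delta> \<le> real g * \<delta>" "real (g + 1) * \<delta> \<le> real ((i + 1) * 2 ^ j) * \<delta>"
    using \<delta> by (simp_all only: mult_le_cancel_right_pos)
  moreover have "real (i * 2 ^ j) * \<delta> = real i * (2 ^ j * \<delta>)"
      "real ((i + 1) * 2 ^ j) * \<delta> = (real i + 1) * (2 ^ j * \<delta>)"
    by (simp_all add: algebra_simps)
  ultimately show "real i * (2 ^ j * \<delta>) \<le> \<xi>" "\<xi> < (real i + 1) * (2 ^ j * \<delta>)"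
    using g by linarith+
qed

lemma sum_cell_refine:
  assumes "m \<le> j"
  shows "(\<Sum>\<xi>\<in>cell j i. h \<xi>) = (\<Sum>q\<in>children (j - m) i. \<Sum>\<xi>\<in>cell m q. h \<xi>)"
proof -
  have *: "nat \<lfloor>\<xi> / \<delta>\<rfloor> div 2 ^ m div 2 ^ (j - m) = nat \<lfloor>\<xi> / \<delta>\<rfloor> div 2 ^ j" for \<xi>
    using assms by (simp flip: div_mult2_eq power_add)
  have "(\<Sum>q\<in>children (j - m) i. \<Sum>\<xi>\<in>{\<xi> \<in> cell j i. nat \<lfloor>\<xi> / \<delta>\<rfloor> div 2 ^ m = q}. h \<xi>) = (\<Sum>\<xi>\<in>cell j i. h \<xi>)"
    by (rule sum.group[OF finite_cell finite_children]) (use * in \<open>auto simp: cell_def children_def\<close>)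
  moreover have "{\<xi> \<in> cell j i. nat \<lfloor>\<xi> / \<delta>\<rfloor> div 2 ^ m = q} = cell m q" if "q \<in> children (j - m) i" for q
    using that * by (auto simp: cell_def children_def)
  ultimately show ?thesis by simp
qed

lemma piece_refine: "m \<le> j \<Longrightarrow> piece j i z = (\<Sum>q\<in>children (j - m) i. piece m q z)"
  unfolding wave_sum_def by (rule sum_cell_refine)

lemma children_Suc_0: "children (Suc 0) i = {2 * i, 2 * i + 1}"
  by (auto simp: children_eq)

lemma piece_split: "piece (Suc j) i = (\<lambda>z. piece j (2 * i) z + piece j (2 * i + 1) z)"
  using piece_refine[of j "Suc j" i] by (auto simp: children_Suc_0)

text \<open>The first factor is only quadratic, so that orthogonality can split it while the square
  of the other piece acts as a fixed multiplier with known spectrum.\<close>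

definition mix :: "nat \<Rightarrow> nat \<Rightarrow> nat \<Rightarrow> nat \<Rightarrow> real" where
  "mix l i j k = (\<integral>z. norm (piece l i z) ^ 2 * norm (piece j k z) ^ 4 \<partial>\<mu>)"

lemma mix_nonneg: "0 \<le> mix l i j k"
  unfolding mix_def by (intro integral_nonneg_AE AE_I2) simp

text \<open>\<open>sq6\<close> is the square of the \<open>L\<^sup>6\<close> norm of a piece; \<open>energy\<close> sums these over the smallest cells, of width
  \<open>\<delta>\<close>, so that decoupling with constant \<open>D\<close> reads \<open>sq6 j i \<le> D * energy j i\<close>.\<close>

definition sq6 :: "nat \<Rightarrow> nat \<Rightarrow> real" where
  "sq6 j i = Lnorm 3 (\<lambda>z. piece j i z * piece j i z)"

lemma sq6_nonneg: "0 \<le> sq6 j i"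
  unfolding sq6_def by (rule Lnorm_nonneg)

lemma sq6_power: "sq6 j i ^ 3 = (\<integral>z. norm (piece j i z) ^ 6 \<partial>\<mu>)"
proof -
  have "(norm (piece j i z * piece j i z)) ^ 3 = norm (piece j i z) ^ 6" for z
    by (simp add: norm_mult eval_nat_numeral)
  thus ?thesis by (simp add: sq6_def Lnorm_power)
qed

definition energy :: "nat \<Rightarrow> nat \<Rightarrow> real" where
  "energy j i = (\<Sum>q\<in>children j i. sq6 0 q)"

lemma energy_nonneg: "0 \<le> energy j i"
  unfolding energy_def by (intro sum_nonneg sq6_nonneg)

lemma energy_refine:
  assumes "m \<le> j"
  shows "energy j i = (\<Sum>q\<in>children (j - m) i. energy m q)"
proof -
  have *: "x div 2 ^ m div 2 ^ (j - m) = x div 2 ^ j" for x :: nat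
    using assms by (simp flip: div_mult2_eq power_add)
  have "(\<Sum>q\<in>children (j - m) i. \<Sum>x\<in>{x \<in> children j i. x div 2 ^ m = q}. sq6 0 x) = energy j i"
    unfolding energy_def by (rule sum.group[OF finite_children finite_children]) (use * in \<open>auto simp: children_def\<close>)
  moreover have "{x \<in> children j i. x div 2 ^ m = q} = children m q" if "q \<in> children (j - m) i" for q
    using that * by (auto simp: children_def)
  ultimately show ?thesis by (simp add: energy_def)
qed

lemma energy_split: "energy (Suc j) i = energy j (2 * i) + energy j (2 * i + 1)"
  using energy_refine[of j "Suc j" i] by (simp add: children_Suc_0)

definition gap2 :: "nat \<Rightarrow> nat \<Rightarrow> bool" where
  "gap2 u v \<longleftrightarrow> u + 2 \<le> v \<or> v + 2 \<le> u"

lemma gap2_sym: "gap2 u v \<Longrightarrow> gap2 v u"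
  by (auto simp: gap2_def)

text \<open>Indices that differ by 2 leave one whole cell in between, hence the distance of a full
  width. Both points of the first cell lie on the same side of c, as \<open>resonance_bound\<close>
  requires.\<close>

lemma gap2_cells:
  assumes "gap2 u v" "\<xi> \<in> cell n u" "\<xi>' \<in> cell n u" "c \<in> cell n v"
  shows "c + 2 ^ n * \<delta> \<le> \<xi> \<and> c + 2 ^ n * \<delta> \<le> \<xi>' \<or> \<xi> + 2 ^ n * \<delta> \<le> c \<and> \<xi>' + 2 ^ n * \<delta> \<le> c"
proof -
  have D: "0 \<le> 2 ^ n * \<delta>" using \<delta> by simp
  show ?thesis
  proof (cases "u + 2 \<le> v")
    case True
    hence "(real u + 2) * (2 ^ n * \<delta>) \<le> real v * (2 ^ n * \<delta>)"
      using D by (intro mult_right_mono) auto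
    thus ?thesis using cell_bounds[OF assms(2)] cell_bounds[OF assms(3)] cell_bounds[OF assms(4)]
      by (simp add: distrib_right)
  next
    case False
    hence "v + 2 \<le> u" using assms by (simp add: gap2_def)
    hence "(real v + 2) * (2 ^ n * \<delta>) \<le> real u * (2 ^ n * \<delta>)"
      using D by (intro mult_right_mono) auto
    thus ?thesis using cell_bounds[OF assms(2)] cell_bounds[OF assms(3)] cell_bounds[OF assms(4)]
      by (simp add: distrib_right)
  qed
qed

lemma cell_close:
  assumes "x \<in> cell j k" "y \<in> cell j k"
  shows "\<bar>x - y\<bar> \<le> 2 ^ j * \<delta>"
  using cell_bounds[OF assms(1)] cell_bounds[OF assms(2)] by (simp add: distrib_right abs_le_iff)

lemma cell_index_close:
  assumes "\<xi> \<in> cell m q" "\<xi>' \<in> cell m q'" "\<bar>\<xi> - \<xi>'\<bar> \<le> 3 * real \<kappa> * (2 ^ m * \<delta>)"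
  shows "\<bar>int q - int q'\<bar> \<le> 3 * int \<kappa> + 1"
proof -
  have D: "0 < 2 ^ m * \<delta>" using \<delta> by simp
  have "\<bar>real q - real q'\<bar> * (2 ^ m * \<delta>) \<le> (3 * real \<kappa> + 1) * (2 ^ m * \<delta>)"
    using cell_bounds[OF assms(1)] cell_bounds[OF assms(2)] assms(3)
    by (cases "q \<le> q'") (auto simp: algebra_simps abs_if split: if_splits)
  hence "\<bar>real q - real q'\<bar> \<le> 3 * real \<kappa> + 1" using D by (simp only: mult_le_cancel_right_pos)
  thus ?thesis by linarith
qed

text \<open>Resonances between two subintervals of the first factor, weighted by the fourth power of a
  transversal piece of width \<open>b\<close>, occur only at distance \<open>O(b\<^sup>2 / d)\<close>.\<close>

lemma mix_orthogonal:
  assumes M\<delta>: "1 \<le> M * \<delta>\<^sup>2" and gap: "gap2 u v"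
    and l: "l \<le> n" "i div 2 ^ (n - l) = u" and j: "j \<le> n" "k div 2 ^ (n - j) = v"
    and m: "2 * j - n \<le> m" "m \<le> l"
  shows "mix l i j k \<le> (6 * real \<kappa> + 3) * (\<Sum>q\<in>children (l - m) i. mix m q j k)"
proof -
  define g where "g q z = piece m q z * (piece j k z * piece j k z)" for q z
  define B where "B = {curve x + curve y | x y. x \<in> cell j k \<and> y \<in> cell j k}"
  define A where "A q = {curve \<xi> + p | \<xi> p. \<xi> \<in> cell m q \<and> p \<in> B}" for q
  define R where "R q q' \<longleftrightarrow> \<bar>int q - int q'\<bar> \<le> 3 * int \<kappa> + 1" for q q'
  have g_trig: "g q \<in> trig (A q)" for q
  proof -
    have "(\<lambda>z. piece j k z * piece j k z) \<in> trig B"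
    proof (rule trig_mult[OF wave_sum_trig[OF finite_cell] wave_sum_trig[OF finite_cell]])
      fix p p' assume "p \<in> curve ` cell j k" "p' \<in> curve ` cell j k"
      then obtain x y where "p = curve x" "x \<in> cell j k" "p' = curve y" "y \<in> cell j k" by (elim imageE)
      thus "p + p' \<in> B" unfolding B_def by blast
    qed
    note sq = this
    show ?thesis
      unfolding g_def[abs_def]
    proof (rule trig_mult[OF wave_sum_trig[OF finite_cell] sq])
      fix p p' assume "p \<in> curve ` cell m q" "p' \<in> B"
      then obtain \<xi> where "p = curve \<xi>" "\<xi> \<in> cell m q" by (elim imageE)
      thus "p + p' \<in> A q" unfolding A_def using \<open>p' \<in> B\<close> by blast
    qed
  qed
  have A_grid: "A q \<subseteq> grid lam" for q
  proof -
    have "curve x \<in> grid lam" if "x \<in> cell j' k'" for x j' k'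
      using that F_lattice cell_subset lam by (intro curve_in_grid) auto
    thus ?thesis unfolding A_def B_def by (intro subsetI, elim CollectE exE conjE) (simp add: grid_add)
  qed
  have "(\<integral>z. (norm (\<Sum>q\<in>children (l - m) i. g q z))\<^sup>2 \<partial>\<mu>)
      \<le> (6 * real \<kappa> + 3) * (\<Sum>q\<in>children (l - m) i. \<integral>z. (norm (g q z))\<^sup>2 \<partial>\<mu>)"
  proof (rule almost_orthogonal[where R = R])
    fix q q' assume q: "q \<in> children (l - m) i" "q' \<in> children (l - m) i" "\<not> R q q'"
    show "(\<integral>z. g q z * cnj (g q' z) \<partial>\<mu>) = 0"
    proof (rule trig_orthogonal[OF g_trig g_trig A_grid A_grid])
      fix p p' assume "p \<in> A q" "p' \<in> A q'"
      then obtain \<xi> c x \<xi>' y w where p: "p = curve \<xi> + (curve c + curve x)" "p' = curve \<xi>' + (curve y + curve w)"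
        and \<xi>: "\<xi> \<in> cell m q" "\<xi>' \<in> cell m q'" and cells: "c \<in> cell j k" "x \<in> cell j k" "y \<in> cell j k" "w \<in> cell j k"
        unfolding A_def B_def by (elim CollectE exE conjE) (rule that; assumption?; simp)
      show "\<not> resonant (p - p')"
      proof
        assume "resonant (p - p')"
        hence res: "resonant ((curve \<xi> + curve c + curve x) - (curve \<xi>' + curve y + curve w))"
          by (simp add: p add.assoc)
        have nu: "\<xi> \<in> cell n u" "\<xi>' \<in> cell n u"
          using cell_nested[OF cell_nested[of \<xi> m q l i] l] cell_nested[OF cell_nested[of \<xi>' m q' l i] l] \<xi> q m
          by (auto simp: children_def)
        have nv: "c \<in> cell n v" using cell_nested[OF cells(1) j] .
        have "\<bar>\<xi> - \<xi>'\<bar> * (2 ^ n * \<delta>) \<le> 3 * real \<kappa> * (2 ^ j * \<delta>)\<^sup>2"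
        proof (rule resonance_bound[OF M _ _ _ _ _ _ _ gap2_cells[OF gap nu nv] res])
          have "1 * 1 \<le> (M * \<delta>\<^sup>2) * ((2 ^ j)\<^sup>2 :: real)"
            using M\<delta> by (intro mult_mono) (auto simp: one_le_power)
          thus "1 \<le> M * (2 ^ j * \<delta>)\<^sup>2" by (simp add: power_mult_distrib mult_ac)
          show "{\<xi>, \<xi>', c, x, y, w} \<subseteq> {M..real \<kappa> * M}"
            using \<xi> cells cell_subset F_range by blast
        qed (use \<kappa> \<delta> cells cell_close in auto)
        also have "(2 ^ j * \<delta>)\<^sup>2 = 2 ^ (2 * j) * \<delta> * \<delta>"
          by (simp add: power_mult_distrib power2_eq_square mult_2 power_add)
        \<comment> \<open>This is where \<open>2 * j - n \<le> m\<close> enters: the resonance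
          distance b^2 / d, with b = 2^j \<delta> and d = 2^n \<delta>, is at most the width of a
          cell of level m. The truncated subtraction still yields 2 j \<le> m + n.\<close>
        also have "3 * real \<kappa> * (2 ^ (2 * j) * \<delta> * \<delta>) \<le> 3 * real \<kappa> * (2 ^ (m + n) * \<delta> * \<delta>)"
          using m \<delta> by (intro mult_left_mono mult_right_mono power_increasing) auto
        also have "\<dots> = (3 * real \<kappa> * (2 ^ m * \<delta>)) * (2 ^ n * \<delta>)" by (simp add: power_add)
        finally have "\<bar>\<xi> - \<xi>'\<bar> \<le> 3 * real \<kappa> * (2 ^ m * \<delta>)"
          using \<delta> by (subst (asm) mult_le_cancel_right_pos) auto
        thus False using cell_index_close[OF \<xi>] q(3) by (simp add: R_def)
      qed
    qed
  next
    fix q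
    \<comment> \<open>The related indices form a window of radius 3 \<kappa> + 1, which has 6
      \<kappa> + 3 integers.\<close>
    have "{q' \<in> children (l - m) i. R q q'} \<subseteq> nat ` {int q - (3 * int \<kappa> + 1)..int q + (3 * int \<kappa> + 1)}"
    proof
      fix q' assume "q' \<in> {q' \<in> children (l - m) i. R q q'}"
      hence "q' = nat (int q') \<and> int q' \<in> {int q - (3 * int \<kappa> + 1)..int q + (3 * int \<kappa> + 1)}"
        by (auto simp: R_def)
      thus "q' \<in> nat ` {int q - (3 * int \<kappa> + 1)..int q + (3 * int \<kappa> + 1)}" by blast
    qed
    hence "card {q' \<in> children (l - m) i. R q q'} \<le> card {int q - (3 * int \<kappa> + 1)..int q + (3 * int \<kappa> + 1)}"
      by (intro surj_card_le) auto
    also have "\<dots> = 6 * \<kappa> + 3" by simp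
    finally have "real (card {q' \<in> children (l - m) i. R q q'}) \<le> real (6 * \<kappa> + 3)"
      by (simp only: of_nat_le_iff)
    thus "real (card {q' \<in> children (l - m) i. R q q'}) \<le> 6 * real \<kappa> + 3" by simp
  qed (auto simp: R_def g_def[abs_def] intro!: continuous_intros)
  moreover have "norm (g q z) ^ 2 = norm (piece m q z) ^ 2 * norm (piece j k z) ^ 4" for q z
    by (simp add: g_def norm_mult eval_nat_numeral mult_ac)
  moreover have "(norm (\<Sum>q\<in>children (l - m) i. g q z))\<^sup>2 = norm (piece l i z) ^ 2 * norm (piece j k z) ^ 4" for z
    unfolding piece_refine[OF m(2), of i z] g_def sum_distrib_right[symmetric]
    by (simp add: norm_mult eval_nat_numeral mult_ac)
  ultimately show ?thesis by (simp add: mix_def)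
qed

text \<open>Cauchy-Schwarz for f^2 g^4 = (f^2 g) g^3: the square of the first factor is f^4 g^2, in
  which the two pieces have exchanged roles.\<close>

lemma mix_swap: "(mix l i j k)\<^sup>2 \<le> mix j k l i * sq6 j k ^ 3"
proof -
  let ?f = "\<lambda>z. norm (piece l i z)" and ?g = "\<lambda>z. norm (piece j k z)"
  have "(\<integral>z. (?f z ^ 2 * ?g z) * ?g z ^ 3 \<partial>\<mu>)\<^sup>2 \<le> (\<integral>z. (?f z ^ 2 * ?g z)\<^sup>2 \<partial>\<mu>) * (\<integral>z. (?g z ^ 3)\<^sup>2 \<partial>\<mu>)"
    by (intro Cauchy_Schwarz_integral continuous_intros) auto
  moreover have "(x ^ 2 * y) * y ^ 3 = x ^ 2 * y ^ 4" "(x ^ 2 * y)\<^sup>2 = y ^ 2 * x ^ 4" "(y ^ 3)\<^sup>2 = y ^ 6" for x y :: real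
    by (simp_all add: eval_nat_numeral algebra_simps)
  ultimately show ?thesis by (simp add: mix_def sq6_power)
qed

text \<open>Ends the iteration: it ignores transversality and leaves only moments to which the
  decoupling bound at hand applies.\<close>

lemma mix_Hoelder: "mix l i j k \<le> sq6 l i * sq6 j k ^ 2"
proof -
  let ?f = "\<lambda>z. norm (piece l i z)" and ?g = "\<lambda>z. norm (piece j k z)"
  have "(\<integral>z. ?f z ^ 2 * (?g z ^ 2)\<^sup>2 \<partial>\<mu>) ^ 3 \<le> (\<integral>z. (?f z ^ 2) ^ 3 \<partial>\<mu>) * (\<integral>z. (?g z ^ 2) ^ 3 \<partial>\<mu>)\<^sup>2"
    by (intro Hoelder_integral_3 continuous_intros) auto
  moreover have "(x ^ 2)\<^sup>2 = x ^ 4" "(x ^ 2) ^ 3 = x ^ 6" for x :: real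
    by (simp_all flip: power_mult)
  ultimately have "mix l i j k ^ 3 \<le> sq6 l i ^ 3 * (sq6 j k ^ 3)\<^sup>2"
    by (simp add: mix_def sq6_power)
  also have "\<dots> = (sq6 l i * sq6 j k ^ 2) ^ 3" by (simp add: power_mult_distrib flip: power_mult)
  finally show ?thesis by (subst (asm) power_mono_iff) (auto simp: sq6_nonneg mix_nonneg)
qed

text \<open>The starting point, exponent 2. It is far from sharp, but any finite exponent can be
  improved.\<close>

lemma sq6_trivial: "sq6 j i \<le> 4 ^ j * energy j i"
proof -
  have "norm (piece j i z) ^ 6 \<le> (2 ^ j) ^ 6 * (\<Sum>q\<in>children j i. norm (piece 0 q z) ^ 6)" for z
  proof -
    have "norm (piece j i z) ^ 6 \<le> (\<Sum>q\<in>children j i. norm (piece 0 q z)) ^ 6"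
      using piece_refine[of 0 j i z] by (intro power_mono) (auto intro: norm_sum)
    also have "\<dots> \<le> real (card (children j i)) ^ 6 * (\<Sum>q\<in>children j i. norm (piece 0 q z) ^ 6)"
      by (rule sum_power_le) auto
    finally show ?thesis by (simp add: card_children)
  qed
  hence "(\<integral>z. norm (piece j i z) ^ 6 \<partial>\<mu>) \<le> (\<integral>z. (2 ^ j) ^ 6 * (\<Sum>q\<in>children j i. norm (piece 0 q z) ^ 6) \<partial>\<mu>)"
    by (intro integral_mono_real continuous_intros)
  also have "\<dots> = (2 ^ j) ^ 6 * (\<Sum>q\<in>children j i. sq6 0 q ^ 3)"
    by (simp add: sq6_power, subst Bochner_Integration.integral_sum)
       (auto intro!: integrable_real continuous_intros)
  also have "(\<Sum>q\<in>children j i. sq6 0 q ^ 3) \<le> energy j i ^ 3"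
    using sum_power_le_power_sum[of "children j i" "sq6 0" 2] by (simp add: energy_def sq6_nonneg numeral_3_eq_3)
  finally have "sq6 j i ^ 3 \<le> (2 ^ j) ^ 6 * energy j i ^ 3" by (simp add: sq6_power)
  also have "((2::real) ^ j) ^ 6 = (4 ^ j) ^ 3"
  proof -
    have "((2::real) ^ j) ^ 6 = (2 ^ 2) ^ (j * 3)" by (simp only: power_mult[symmetric]) (simp add: mult_ac)
    thus ?thesis by (simp add: power_mult)
  qed
  finally have "sq6 j i ^ 3 \<le> (4 ^ j * energy j i) ^ 3" by (simp add: power_mult_distrib)
  thus ?thesis by (subst (asm) power_mono_iff) (auto simp: sq6_nonneg energy_nonneg)
qed

end

section \<open>Iterated exchange and refinement\<close>

context airy_data
begin

text \<open>Each round of exchange and refinement doubles the distance \<open>h\<close> from the top scale and gains a factor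
  \<open>2 powr (- 3/2 * \<eta> * h)\<close> over the trivial use of decoupling.\<close>

lemma mix_chain:
  assumes M\<delta>: "1 \<le> M * \<delta>\<^sup>2" and K: "0 \<le> K" and \<eta>: "0 \<le> \<eta>"
    and dec: "\<And>j i. sq6 j i \<le> K * 2 powr (\<eta> * j) * energy j i"
  shows "gap2 u v \<Longrightarrow> 2 * 2 ^ p * h \<le> n \<Longrightarrow> i div 2 ^ (2 * h) = u \<Longrightarrow> k div 2 ^ h = v \<Longrightarrow>
    mix (n - 2 * h) i (n - h) k
      \<le> (6 * real \<kappa> + 3) * K ^ 3 * 2 powr (3 * \<eta> * n - 3 / 2 * \<eta> * h * p) * energy (n - 2 * h) i * (energy (n - h) k)\<^sup>2"
proof (induction p arbitrary: u v h i k)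
  case 0
  define Si Sk where "Si = energy (n - 2 * h) i" and "Sk = energy (n - h) k"
  have S: "0 \<le> Si" "0 \<le> Sk" by (simp_all add: Si_def Sk_def energy_nonneg)
  define P where "P = (2::real) powr (\<eta> * n)"
  have P: "2 powr (\<eta> * m) \<le> P" if "m \<le> n" for m :: nat
    unfolding P_def using that \<eta> by (intro powr_mono mult_left_mono) auto
  have le: "sq6 (n - 2 * h) i \<le> K * P * Si" "sq6 (n - h) k \<le> K * P * Sk"
    unfolding Si_def Sk_def
    by (rule order_trans[OF dec], intro mult_right_mono mult_left_mono P K energy_nonneg, simp)+
  have "mix (n - 2 * h) i (n - h) k \<le> sq6 (n - 2 * h) i * sq6 (n - h) k ^ 2" by (rule mix_Hoelder)
  also have "\<dots> \<le> (K * P * Si) * (K * P * Sk) ^ 2"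
    using K S by (intro mult_mono power_mono le) (auto simp: sq6_nonneg P_def)
  also have "\<dots> = 1 * (K ^ 3 * P ^ 3 * Si * Sk\<^sup>2)" by (simp add: eval_nat_numeral algebra_simps)
  also have "\<dots> \<le> (6 * real \<kappa> + 3) * (K ^ 3 * P ^ 3 * Si * Sk\<^sup>2)"
    using K S by (intro mult_right_mono) (auto simp: P_def)
  also have "P ^ 3 = 2 powr (3 * \<eta> * n)" by (simp add: P_def powr_power mult_ac)
  finally show ?case by (simp add: Si_def Sk_def mult_ac)
next
  case (Suc p)
  define Si Sk where "Si = energy (n - 2 * h) i" and "Sk = energy (n - h) k"
  have S: "0 \<le> Si" "0 \<le> Sk" by (simp_all add: Si_def Sk_def energy_nonneg)
  define C where "C = 6 * real \<kappa> + 3"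
  have C: "0 \<le> C" by (simp add: C_def)
  define X where "X = 2 powr (3 * \<eta> * n - 3 / 2 * \<eta> * (2 * h) * p)"
  define Y where "Y = 2 powr (3 * \<eta> * n - 3 / 2 * \<eta> * h * Suc p)"
  have "h \<le> 2 ^ p * h" "2 * 2 ^ Suc p * h = 4 * (2 ^ p * h)" by simp_all
  \<comment> \<open>Every level difference below is therefore an honest subtraction.\<close>
  hence h: "4 * h \<le> n" using Suc.prems(2) by linarith
  have h': "2 * 2 ^ p * (2 * h) \<le> n" using Suc.prems(2) by simp
  have n: "n - h - (n - 4 * h) = 3 * h" "2 * (n - 2 * h) - n = n - 4 * h" "n - (n - h) = h"
     "n - (n - 2 * h) = 2 * h" "n - 2 * (2 * h) = n - 4 * h"
    using h by auto
  \<comment> \<open>With roles exchanged, piece k is refined against piece i, which lies 2h below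
    the top. The admissible level 2 (n - 2h) - n is n - 4h, so the new configuration is the
    induction hypothesis with h doubled and u, v interchanged.\<close>
  have "mix (n - h) k (n - 2 * h) i \<le> C * (\<Sum>q\<in>children (3 * h) k. mix (n - 4 * h) q (n - 2 * h) i)"
    unfolding C_def n(1)[symmetric]
    by (rule mix_orthogonal[OF M\<delta> gap2_sym[OF Suc.prems(1)], where n = n])
       (use h n Suc.prems in auto)
  also have "\<dots> \<le> C * (\<Sum>q\<in>children (3 * h) k. C * K ^ 3 * X * energy (n - 4 * h) q * Si\<^sup>2)"
  proof (intro mult_left_mono sum_mono C)
    fix q assume q: "q \<in> children (3 * h) k"
    have "q div 2 ^ (2 * (2 * h)) = q div 2 ^ (3 * h) div 2 ^ h"
      by (simp flip: div_mult2_eq power_add)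
    hence "q div 2 ^ (2 * (2 * h)) = v" using q Suc.prems by (simp add: children_def)
    from Suc.IH[OF gap2_sym[OF Suc.prems(1)] h' this Suc.prems(3)]
    show "mix (n - 4 * h) q (n - 2 * h) i \<le> C * K ^ 3 * X * energy (n - 4 * h) q * Si\<^sup>2"
      unfolding C_def X_def Si_def n by (simp add: mult_ac)
  qed
  also have "\<dots> = C\<^sup>2 * K ^ 3 * X * (\<Sum>q\<in>children (3 * h) k. energy (n - 4 * h) q) * Si\<^sup>2"
    by (simp add: sum_distrib_left sum_distrib_right power2_eq_square mult_ac)
  also have "(\<Sum>q\<in>children (3 * h) k. energy (n - 4 * h) q) = Sk"
    using energy_refine[of "n - 4 * h" "n - h" k] n by (simp add: Sk_def)
  finally have mix: "mix (n - h) k (n - 2 * h) i \<le> C\<^sup>2 * K ^ 3 * X * Sk * Si\<^sup>2" .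
  define Z where "Z = 2 powr (\<eta> * (n - h))"
  have six: "sq6 (n - h) k ^ 3 \<le> (K * Z * Sk) ^ 3"
    unfolding Sk_def Z_def by (intro power_mono dec sq6_nonneg)
  have "(mix (n - 2 * h) i (n - h) k)\<^sup>2 \<le> mix (n - h) k (n - 2 * h) i * sq6 (n - h) k ^ 3"
    by (rule mix_swap)
  also have "\<dots> \<le> (C\<^sup>2 * K ^ 3 * X * Sk * Si\<^sup>2) * (K * Z * Sk) ^ 3"
    using mix six S K by (intro mult_mono) (auto simp: sq6_nonneg X_def)
  also have "\<dots> = (C * K ^ 3 * Si * Sk\<^sup>2)\<^sup>2 * (X * Z ^ 3)"
    by (simp add: eval_nat_numeral algebra_simps)
  \<comment> \<open>The square root halves both savings: the inherited one, computed with 2h,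
    returns to its rate in h, and applying decoupling at level n - h instead of n adds 3/2 \<eta> h.
    It also turns C^2 back into C, so the constant does not grow with p.\<close>
  also have "X * Z ^ 3 = Y\<^sup>2"
  proof -
    have "real (n - h) = real n - real h" using h by (simp add: of_nat_diff)
    thus ?thesis
      unfolding X_def Y_def Z_def
      by (simp add: powr_power flip: powr_add) (simp add: algebra_simps)
  qed
  finally have "(mix (n - 2 * h) i (n - h) k)\<^sup>2 \<le> (C * K ^ 3 * Y * Si * Sk\<^sup>2)\<^sup>2"
    by (simp add: power_mult_distrib mult_ac)
  hence "mix (n - 2 * h) i (n - h) k \<le> C * K ^ 3 * Y * Si * Sk\<^sup>2"
    by (rule power2_le_imp_le) (use K S in \<open>auto simp: C_def Y_def\<close>)
  thus ?case by (simp add: C_def Y_def Si_def Sk_def)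
qed

text \<open>To start the iteration the quartic piece is cut into 2^h parts, so that the quadratic
  one can be refined by 2h levels. The crude cut costs 2^(4h), which p rounds recover with 3h to
  spare.\<close>

lemma mix_separated:
  assumes M\<delta>: "1 \<le> M * \<delta>\<^sup>2" and K: "0 \<le> K" and \<eta>: "0 \<le> \<eta>"
    and dec: "\<And>j i. sq6 j i \<le> K * 2 powr (\<eta> * j) * energy j i"
    and gap: "gap2 u v" and h: "2 * 2 ^ p * (h :: nat) \<le> n" and p: "5 \<le> \<eta> * p"
  shows "mix n u n v \<le> (6 * real \<kappa> + 3)\<^sup>2 * K ^ 3 * 2 powr (3 * \<eta> * n - 3 * h) * energy n u * (energy n v)\<^sup>2"
proof -
  define C where "C = 6 * real \<kappa> + 3"
  have C: "0 \<le> C" by (simp add: C_def)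
  define X where "X = 2 powr (3 * \<eta> * n - 3 / 2 * \<eta> * h * p)"
  have "h \<le> 2 ^ p * h" "2 * 2 ^ p * h = 2 * (2 ^ p * h)" by simp_all
  hence h2: "2 * h \<le> n" using h by linarith
  have n: "n - (n - h) = h" "n - (n - 2 * h) = 2 * h" "2 * (n - h) - n = n - 2 * h" using h2 by auto
  have pt: "norm (piece n u z) ^ 2 * norm (piece n v z) ^ 4
      \<le> (2 ^ h) ^ 4 * (\<Sum>k\<in>children h v. norm (piece n u z) ^ 2 * norm (piece (n - h) k z) ^ 4)" for z
  proof -
    have "norm (piece n v z) ^ 4 \<le> (\<Sum>k\<in>children h v. norm (piece (n - h) k z)) ^ 4"
      using piece_refine[of "n - h" n v z] n by (intro power_mono) (auto intro: norm_sum)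
    also have "\<dots> \<le> real (card (children h v)) ^ 4 * (\<Sum>k\<in>children h v. norm (piece (n - h) k z) ^ 4)"
      by (rule sum_power_le) auto
    finally have "norm (piece n v z) ^ 4 \<le> (2 ^ h) ^ 4 * (\<Sum>k\<in>children h v. norm (piece (n - h) k z) ^ 4)"
      by (simp add: card_children)
    hence "norm (piece n u z) ^ 2 * norm (piece n v z) ^ 4
      \<le> norm (piece n u z) ^ 2 * ((2 ^ h) ^ 4 * (\<Sum>k\<in>children h v. norm (piece (n - h) k z) ^ 4))"
      by (intro mult_left_mono) auto
    thus ?thesis by (simp add: sum_distrib_left mult_ac)
  qed
  have "mix n u n v \<le> (\<integral>z. (2 ^ h) ^ 4 * (\<Sum>k\<in>children h v. norm (piece n u z) ^ 2 * norm (piece (n - h) k z) ^ 4) \<partial>\<mu>)"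
    unfolding mix_def by (intro integral_mono_real continuous_intros pt)
  also have "\<dots> = (2 ^ h) ^ 4 * (\<Sum>k\<in>children h v. mix n u (n - h) k)"
    unfolding mix_def
    by (simp, subst Bochner_Integration.integral_sum) (auto intro!: integrable_real continuous_intros)
  also have "\<dots> \<le> (2 ^ h) ^ 4 * (\<Sum>k\<in>children h v. C * (\<Sum>i\<in>children (2 * h) u. mix (n - 2 * h) i (n - h) k))"
  proof (intro mult_left_mono sum_mono)
    fix k assume "k \<in> children h v"
    hence "mix n u (n - h) k \<le> C * (\<Sum>i\<in>children (n - (n - 2 * h)) u. mix (n - 2 * h) i (n - h) k)"
      unfolding C_def by (intro mix_orthogonal[OF M\<delta> gap, where n = n]) (simp_all add: n children_def)
    thus "mix n u (n - h) k \<le> C * (\<Sum>i\<in>children (2 * h) u. mix (n - 2 * h) i (n - h) k)"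
      by (simp only: n)
  qed simp
  also have "\<dots> \<le> (2 ^ h) ^ 4 * (\<Sum>k\<in>children h v. C * (\<Sum>i\<in>children (2 * h) u.
      C * K ^ 3 * X * energy (n - 2 * h) i * (energy (n - h) k)\<^sup>2))"
    unfolding C_def X_def
    by (intro mult_left_mono sum_mono mix_chain[OF M\<delta> K \<eta> dec gap h]) (auto simp: children_def)
  also have "\<dots> = (2 ^ h) ^ 4 * C\<^sup>2 * K ^ 3 * X * energy n u * (\<Sum>k\<in>children h v. (energy (n - h) k)\<^sup>2)"
  proof -
    have "energy n u = (\<Sum>i\<in>children (2 * h) u. energy (n - 2 * h) i)"
      using energy_refine[of "n - 2 * h" n u] n by simp
    hence "(\<Sum>i\<in>children (2 * h) u. C * K ^ 3 * X * energy (n - 2 * h) i * (energy (n - h) k)\<^sup>2)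
        = C * K ^ 3 * X * energy n u * (energy (n - h) k)\<^sup>2" for k
      by (simp add: sum_distrib_left sum_distrib_right mult_ac)
    thus ?thesis by (simp add: sum_distrib_left power2_eq_square mult_ac)
  qed
  also have "\<dots> \<le> (2 ^ h) ^ 4 * C\<^sup>2 * K ^ 3 * X * energy n u * (energy n v)\<^sup>2"
    using energy_refine[of "n - h" n v] n K
      sum_power_le_power_sum[of "children h v" "energy (n - h)" 1]
    by (intro mult_left_mono) (auto simp: energy_nonneg X_def numeral_2_eq_2)
  also have "\<dots> = C\<^sup>2 * K ^ 3 * ((2 ^ h) ^ 4 * X) * energy n u * (energy n v)\<^sup>2" by (simp add: mult_ac)
  also have "(2 ^ h) ^ 4 * X \<le> 2 powr (3 * \<eta> * n - 3 * h)"
  proof -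
    \<comment> \<open>The chain saves 3/2 \<eta> h p, at least 15/2 h, against the cost 4h.\<close>
    have "5 * real h \<le> \<eta> * p * h" using p by (intro mult_right_mono) auto
    hence "4 * real h + (3 * \<eta> * n - 3 / 2 * \<eta> * h * p) \<le> 3 * \<eta> * n - 3 * h" by (simp add: mult_ac)
    moreover have "(2 ^ h) ^ 4 = (2::real) powr (4 * real h)"
      by (simp add: powr_realpow flip: power_mult) (metis mult.commute of_nat_mult of_nat_numeral powr_realpow zero_less_numeral)
    ultimately show ?thesis unfolding X_def by (simp add: flip: powr_add)
  qed
  finally show ?thesis
    using K by (simp add: C_def mult_left_mono mult_right_mono energy_nonneg)
qed

text \<open>Cauchy-Schwarz for (f g)^3 = (f g^2)(f^2 g) bounds the integral by the two mixed
  moments. Its cube root turns the saving 3h into h.\<close>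

lemma bilinear_L3:
  assumes M\<delta>: "1 \<le> M * \<delta>\<^sup>2" and K: "0 \<le> K" and \<eta>: "0 \<le> \<eta>"
    and dec: "\<And>j i. sq6 j i \<le> K * 2 powr (\<eta> * j) * energy j i"
    and gap: "gap2 u v" and h: "2 * 2 ^ p * (h :: nat) \<le> n" and p: "5 \<le> \<eta> * p"
  shows "Lnorm 3 (\<lambda>z. piece n u z * piece n v z)
    \<le> (6 * real \<kappa> + 3) * K * 2 powr (\<eta> * n - h) * sqrt (energy n u * energy n v)"
proof -
  define C where "C = 6 * real \<kappa> + 3"
  have C: "1 \<le> C" by (simp add: C_def)
  define Su Sv where "Su = energy n u" and "Sv = energy n v"
  have S: "0 \<le> Su" "0 \<le> Sv" by (simp_all add: Su_def Sv_def energy_nonneg)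
  define X where "X = 2 powr (\<eta> * n - h)"
  have X0: "0 \<le> X" by (simp add: X_def)
  have X3: "2 powr (3 * \<eta> * real n - 3 * real h) = X ^ 3" by (simp add: X_def powr_power algebra_simps)
  let ?f = "\<lambda>z. norm (piece n u z)" and ?g = "\<lambda>z. norm (piece n v z)"
  define I where "I = (\<integral>z. norm (piece n u z * piece n v z) ^ 3 \<partial>\<mu>)"
  have I0: "0 \<le> I" unfolding I_def by (rule integral_norm_power_nonneg)
  have "(\<integral>z. (?f z * ?g z ^ 2) * (?f z ^ 2 * ?g z) \<partial>\<mu>)\<^sup>2 \<le> (\<integral>z. (?f z * ?g z ^ 2)\<^sup>2 \<partial>\<mu>) * (\<integral>z. (?f z ^ 2 * ?g z)\<^sup>2 \<partial>\<mu>)"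
    by (intro Cauchy_Schwarz_integral continuous_intros) auto
  moreover have "(x * y ^ 2) * (x ^ 2 * y) = (x * y) ^ 3" "(x * y ^ 2)\<^sup>2 = x ^ 2 * y ^ 4" "(x ^ 2 * y)\<^sup>2 = y ^ 2 * x ^ 4" for x y :: real
    by (simp_all add: eval_nat_numeral algebra_simps)
  ultimately have "I\<^sup>2 \<le> mix n u n v * mix n v n u"
    by (simp add: I_def mix_def norm_mult)
  also have "\<dots> \<le> (C\<^sup>2 * K ^ 3 * X ^ 3 * Su * Sv\<^sup>2) * (C\<^sup>2 * K ^ 3 * X ^ 3 * Sv * Su\<^sup>2)"
    using mix_separated[OF M\<delta> K \<eta> dec gap h p] mix_separated[OF M\<delta> K \<eta> dec gap2_sym[OF gap] h p] K S
    by (intro mult_mono) (auto simp: C_def Su_def Sv_def X3 mix_nonneg X0)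
  also have "\<dots> = (C\<^sup>2 * K ^ 3 * X ^ 3)\<^sup>2 * (Su * Sv) ^ 3"
    by (simp add: eval_nat_numeral algebra_simps)
  also have "\<dots> = (C\<^sup>2 * K ^ 3 * X ^ 3)\<^sup>2 * (sqrt (Su * Sv) ^ 3)\<^sup>2"
  proof -
    have "(sqrt (Su * Sv) ^ 3)\<^sup>2 = (Su * Sv) ^ 3"
      using S by (metis mult.commute mult_nonneg_nonneg power_mult real_sqrt_pow2)
    thus ?thesis by simp
  qed
  also have "\<dots> = (C\<^sup>2 * (K * X * sqrt (Su * Sv)) ^ 3)\<^sup>2" by (simp add: power_mult_distrib mult_ac)
  finally have "I \<le> C\<^sup>2 * (K * X * sqrt (Su * Sv)) ^ 3"
    by (rule power2_le_imp_le) (use K S in \<open>auto simp: X_def\<close>)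
  also have "\<dots> \<le> C ^ 3 * (K * X * sqrt (Su * Sv)) ^ 3"
    using C K S by (intro mult_right_mono power_increasing) (auto simp: X_def)
  also have "\<dots> = (C * K * X * sqrt (Su * Sv)) ^ 3" by (simp add: power_mult_distrib mult_ac)
  finally show ?thesis unfolding I_def
    using C K S unfolding X_def C_def Su_def Sv_def by (intro Lnorm_le) auto
qed

lemma adjacent_L3: "Lnorm 3 (\<lambda>z. piece n u z * piece n v z) \<le> sqrt (sq6 n u * sq6 n v)"
proof (rule Lnorm_le)
  let ?f = "\<lambda>z. norm (piece n u z) ^ 3" and ?g = "\<lambda>z. norm (piece n v z) ^ 3"
  have "(\<integral>z. ?f z * ?g z \<partial>\<mu>)\<^sup>2 \<le> (\<integral>z. (?f z)\<^sup>2 \<partial>\<mu>) * (\<integral>z. (?g z)\<^sup>2 \<partial>\<mu>)"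
    by (intro Cauchy_Schwarz_integral continuous_intros) auto
  hence "(\<integral>z. norm (piece n u z * piece n v z) ^ 3 \<partial>\<mu>)\<^sup>2 \<le> (sq6 n u * sq6 n v) ^ 3"
    unfolding norm_mult power_mult_distrib sq6_power power_mult[symmetric] by simp
  also have "\<dots> = (sqrt (sq6 n u * sq6 n v) ^ 3)\<^sup>2"
    by (metis mult.commute mult_nonneg_nonneg power_mult real_sqrt_pow2 sq6_nonneg)
  finally show "(\<integral>z. norm (piece n u z * piece n v z) ^ 3 \<partial>\<mu>) \<le> sqrt (sq6 n u * sq6 n v) ^ 3"
    by (rule power2_le_imp_le) (simp add: sq6_nonneg)
qed (simp_all add: sq6_nonneg)

text \<open>Whitney summation of the separated pairs: level j saves about j / 2^(p+1) in the
  exponent of 2, and since the new exponent is still positive the top level dominates the geometric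
  sum.\<close>

lemma decoupling_improve:
  assumes M\<delta>: "1 \<le> M * \<delta>\<^sup>2" and K: "1 \<le> K" and \<eta>: "0 \<le> \<eta>"
    and dec: "\<And>j i. sq6 j i \<le> K * 2 powr (\<eta> * j) * energy j i"
    and p: "5 \<le> \<eta> * p" and \<eta>': "\<eta>' = \<eta> - 1 / 2 ^ Suc p" "0 < \<eta>'" and r: "r = 2 powr \<eta>'"
  shows "sq6 n i \<le> (1 + 3 / (r - 1)\<^sup>2 + 1 / (r - 1)) * (2 * (6 * real \<kappa> + 3) * K) * 2 powr (\<eta>' * n) * energy n i"
proof -
  \<comment> \<open>The quotient is the largest h allowed at level j. Rounding it down costs at most
    a factor 2, the 2 in the constant of the conclusion.\<close>
  define \<beta> where "\<beta> j = (6 * real \<kappa> + 3) * K * 2 powr (\<eta> * j - real (j div 2 ^ Suc p))" for j :: nat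
  interpret whitney "Lnorm 3" "{g. continuous_on UNIV g}" piece energy \<beta>
  proof
    fix j i i' :: nat assume "i + 2 \<le> i'"
    moreover have "2 * 2 ^ p * (j div 2 ^ Suc p) \<le> j" by simp
    ultimately show "Lnorm 3 (\<lambda>z. piece j i z * piece j i' z) \<le> \<beta> j * sqrt (energy j i * energy j i')"
      unfolding \<beta>_def using K by (intro bilinear_L3[OF M\<delta> _ \<eta> dec _ _ p]) (auto simp: gap2_def)
  next
    show "0 \<le> \<beta> j" for j using K by (simp add: \<beta>_def)
  next
    show "(\<lambda>z. piece j i z * piece j i' z) \<in> {g. continuous_on UNIV g}" for j i i'
      unfolding mem_Collect_eq by (intro continuous_intros)
  next
    show "Lnorm 3 (\<lambda>z. g z + h z) \<le> Lnorm 3 g + Lnorm 3 h"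
      if "g \<in> {g. continuous_on UNIV g}" "h \<in> {g. continuous_on UNIV g}" for g h
      using that by (intro Lnorm_triangle) simp_all
  next
    show "(\<lambda>z. g z + h z) \<in> {g. continuous_on UNIV g}"
      if "g \<in> {g. continuous_on UNIV g}" "h \<in> {g. continuous_on UNIV g}" for g h :: "real \<times> real \<Rightarrow> complex"
      using that unfolding mem_Collect_eq by (intro continuous_intros)
  qed (rule piece_split energy_split energy_nonneg)+
  have e0: "energy 0 i = sq6 0 i" for i by (simp add: energy_def children_def)
  have "Lnorm 3 (\<lambda>z. piece n i z * piece n i z)
    \<le> (1 + 3 / (r - 1)\<^sup>2 + 1 / (r - 1)) * (2 * (6 * real \<kappa> + 3) * K) * r ^ n * energy n i"
  proof (rule square[where ?A0.0 = 1])
    fix j :: nat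
    have "j < 2 ^ Suc p * (j div 2 ^ Suc p) + 2 ^ Suc p"
      using dividend_less_div_times[of "2 ^ Suc p" j] by (simp add: mult_ac)
    hence "real j \<le> real (2 ^ Suc p * (j div 2 ^ Suc p) + 2 ^ Suc p)" by (simp only: of_nat_le_iff)
    also have "\<dots> = 2 ^ Suc p * (real (j div 2 ^ Suc p) + 1)" by (simp add: distrib_left)
    finally have "real j / 2 ^ Suc p \<le> real (j div 2 ^ Suc p) + 1" by (simp add: field_simps)
    hence "\<eta> * j - real (j div 2 ^ Suc p) \<le> 1 + \<eta>' * j" by (simp add: \<eta>' left_diff_distrib)
    hence "2 powr (\<eta> * j - real (j div 2 ^ Suc p)) \<le> 2 powr (1 + \<eta>' * j)" by simp
    also have "\<dots> = 2 * r ^ j" by (simp add: r powr_add powr_power mult_ac)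
    finally have "(6 * real \<kappa> + 3) * K * 2 powr (\<eta> * j - real (j div 2 ^ Suc p)) \<le> (6 * real \<kappa> + 3) * K * (2 * r ^ j)"
      using K by (intro mult_left_mono) auto
    also have "\<dots> = 2 * (6 * real \<kappa> + 3) * K * r ^ j" by (simp only: mult_ac)
    finally show "\<beta> j \<le> 2 * (6 * real \<kappa> + 3) * K * r ^ j" unfolding \<beta>_def .
  next
    have "1 * 1 \<le> (2 * (6 * real \<kappa> + 3)) * K" using K by (intro mult_mono) auto
    thus "1 \<le> 2 * (6 * real \<kappa> + 3) * K" by simp
  next
    show "Lnorm 3 (\<lambda>z. piece 0 i z * piece 0 (i + 1) z) \<le> 1 * sqrt (energy 0 i * energy 0 (i + 1))" for i
      unfolding e0 mult_1 by (rule adjacent_L3)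
    show "Lnorm 3 (\<lambda>z. piece 0 i z * piece 0 i z) \<le> 1 * energy 0 i" for i
      unfolding e0 mult_1 sq6_def by (rule order_refl)
    show "1 < r" using \<eta>'(2) by (simp add: r)
  qed simp
  thus ?thesis by (simp add: sq6_def r powr_power mult_ac)
qed

end

text \<open>One constant for all data, so that it will depend neither on lam nor on the frequency.
  The coefficients \<open>a\<close> are absent from the locale predicate because no assumption
  mentions them.\<close>

definition decoupling_exponent :: "nat \<Rightarrow> real \<Rightarrow> bool" where
  "decoupling_exponent \<kappa> \<eta> \<longleftrightarrow> (\<exists>K\<ge>1. \<forall>\<mu> lam M \<delta> F a. airy_data \<mu> lam M \<delta> \<kappa> F \<longrightarrow> 1 \<le> M * \<delta>\<^sup>2 \<longrightarrow>
    (\<forall>j i. airy_data.sq6 \<mu> \<delta> F a j i \<le> K * 2 powr (\<eta> * j) * airy_data.energy \<mu> \<delta> F a j i))"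

lemma decoupling_exponent_mono:
  assumes "decoupling_exponent \<kappa> \<eta>" "\<eta> \<le> \<eta>'"
  shows "decoupling_exponent \<kappa> \<eta>'"
proof -
  obtain K where K: "1 \<le> K" and dec: "\<And>\<mu> lam M \<delta> F a j i. airy_data \<mu> lam M \<delta> \<kappa> F \<Longrightarrow> 1 \<le> M * \<delta>\<^sup>2 \<Longrightarrow>
    airy_data.sq6 \<mu> \<delta> F a j i \<le> K * 2 powr (\<eta> * real j) * airy_data.energy \<mu> \<delta> F a j i"
    using assms(1) unfolding decoupling_exponent_def by (elim exE conjE) simp
  show ?thesis
    unfolding decoupling_exponent_def
  proof (intro exI[of _ K] conjI allI impI K)
    fix \<mu> lam M \<delta> F and a :: "real \<Rightarrow> complex" and j i :: nat
    assume *: "airy_data \<mu> lam M \<delta> \<kappa> F" "1 \<le> M * \<delta>\<^sup>2"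
    interpret airy_data \<mu> lam M \<delta> \<kappa> F a by fact
    have "K * 2 powr (\<eta> * j) * energy j i \<le> K * 2 powr (\<eta>' * j) * energy j i"
      using K assms(2) by (intro mult_right_mono mult_left_mono powr_mono energy_nonneg) auto
    thus "sq6 j i \<le> K * 2 powr (\<eta>' * j) * energy j i" using dec[OF *, of a j i] by linarith
  qed
qed

text \<open>The number p of rounds is tied to \<epsilon> and not to \<eta>, so the same decrement is
  available for every exponent that is at least \<epsilon>.\<close>

lemma decoupling_exponent_step:
  assumes "decoupling_exponent \<kappa> \<eta>" and \<epsilon>: "0 < \<epsilon>" "\<epsilon> \<le> \<eta>" and p: "5 \<le> \<epsilon> * real p"
  shows "decoupling_exponent \<kappa> (\<eta> - 1 / 2 ^ Suc p)"
proof -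
  obtain K where K: "1 \<le> K" and dec: "\<And>\<mu> lam M \<delta> F a j i. airy_data \<mu> lam M \<delta> \<kappa> F \<Longrightarrow> 1 \<le> M * \<delta>\<^sup>2 \<Longrightarrow>
    airy_data.sq6 \<mu> \<delta> F a j i \<le> K * 2 powr (\<eta> * real j) * airy_data.energy \<mu> \<delta> F a j i"
    using assms(1) unfolding decoupling_exponent_def by (elim exE conjE) simp
  define \<eta>' where "\<eta>' = \<eta> - 1 / 2 ^ Suc p"
  define r where "r = 2 powr \<eta>'"
  define K' where "K' = (1 + 3 / (r - 1)\<^sup>2 + 1 / (r - 1)) * (2 * (6 * real \<kappa> + 3) * K)"
  \<comment> \<open>Ensures that the decrement is smaller than \<epsilon>, so the new exponent stays
    positive and the Whitney sum geometric.\<close>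
  have "\<epsilon> * real p \<le> \<epsilon> * 2 ^ Suc p"
  proof (rule mult_left_mono)
    have "real p < 2 ^ p" by (rule of_nat_less_two_power)
    moreover have "(0::real) < 2 ^ p" "(2::real) ^ Suc p = 2 * 2 ^ p" by simp_all
    ultimately show "real p \<le> 2 ^ Suc p" by linarith
  qed (use \<epsilon> in auto)
  hence "1 / 2 ^ Suc p < \<epsilon>" using p by (simp add: field_simps)
  hence \<eta>': "0 < \<eta>'" using \<epsilon> by (simp add: \<eta>'_def)
  hence r: "1 < r" by (simp add: r_def)
  have "\<epsilon> * real p \<le> \<eta> * real p" using \<epsilon> by (intro mult_right_mono) auto
  hence p': "5 \<le> \<eta> * real p" using p by simp
  have "1 * (1 * 1) \<le> (1 + 3 / (r - 1)\<^sup>2 + 1 / (r - 1)) * (2 * (6 * real \<kappa> + 3) * K)"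
    using K r by (intro mult_mono) auto
  hence K': "1 \<le> K'" by (simp add: K'_def)
  show ?thesis
    unfolding decoupling_exponent_def \<eta>'_def[symmetric]
  proof (intro exI[of _ K'] conjI allI impI K')
    fix \<mu> lam M \<delta> F and a :: "real \<Rightarrow> complex" and j i :: nat
    assume *: "airy_data \<mu> lam M \<delta> \<kappa> F" "1 \<le> M * \<delta>\<^sup>2"
    interpret airy_data \<mu> lam M \<delta> \<kappa> F a by fact
    show "sq6 j i \<le> K' * 2 powr (\<eta>' * j) * energy j i"
      unfolding K'_def using \<epsilon>
      by (intro decoupling_improve[OF *(2) K _ dec[OF *] p' \<eta>'_def \<eta>' r_def]) auto
  qed
qed

text \<open>Finitely many equal steps lead from 2 down to \<epsilon>; the maximum in the induction
  stops the descent there.\<close>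

lemma decoupling_exponent_pos:
  assumes \<epsilon>: "0 < \<epsilon>"
  shows "decoupling_exponent \<kappa> \<epsilon>"
proof -
  obtain p :: nat where "5 / \<epsilon> \<le> real p" using real_arch_simple by blast
  hence p: "5 \<le> \<epsilon> * real p" using \<epsilon> by (simp add: field_simps)
  define c :: real where "c = 1 / 2 ^ Suc p"
  have c: "0 < c" by (simp add: c_def)
  have "decoupling_exponent \<kappa> 2"
    unfolding decoupling_exponent_def
  proof (intro exI[of _ 1] conjI allI impI)
    fix \<mu> lam M \<delta> F and a :: "real \<Rightarrow> complex" and j i :: nat
    assume "airy_data \<mu> lam M \<delta> \<kappa> F"
    then interpret airy_data \<mu> lam M \<delta> \<kappa> F a .
    have "(4::real) ^ j = 2 powr (2 * real j)" by (simp add: powr_realpow flip: powr_powr)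
    thus "sq6 j i \<le> 1 * 2 powr (2 * real j) * energy j i" using sq6_trivial[of j i] by simp
  qed simp
  hence "decoupling_exponent \<kappa> (max \<epsilon> (2 - real k * c))" for k
  proof (induction k)
    case 0 thus ?case by (auto intro: decoupling_exponent_mono)
  next
    case (Suc k)
    show ?case
    proof (cases "2 - real k * c \<le> \<epsilon>")
      case True
      thus ?thesis using Suc by (auto intro: decoupling_exponent_mono)
    next
      case False
      hence "decoupling_exponent \<kappa> (2 - real k * c - c)"
        using Suc decoupling_exponent_step[OF _ \<epsilon> _ p, of \<kappa> "2 - real k * c"] by (simp add: c_def max_def)
      thus ?thesis by (rule decoupling_exponent_mono) (simp add: algebra_simps)
    qed
  qed
  note all = this
  obtain k :: nat where "2 / c \<le> real k" using real_arch_simple by blast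
  hence "2 \<le> real k * c" using c by (simp add: field_simps)
  hence "max \<epsilon> (2 - real k * c) = \<epsilon>" using \<epsilon> by simp
  thus ?thesis using all[of k] by simp
qed

section \<open>A time weight with compactly supported spectrum\<close>

definition box_integral :: "real \<Rightarrow> real \<Rightarrow> (real \<times> real \<Rightarrow> complex) \<Rightarrow> complex" where
  "box_integral T lam g = (\<integral>z. indicator ({-T..T} \<times> {0..lam}) z *\<^sub>R g z \<partial>lborel)"

lemma box_integrable:
  fixes g :: "real \<times> real \<Rightarrow> 'a :: {banach, second_countable_topology}"
  assumes "continuous_on UNIV g"
  shows "integrable lborel (\<lambda>z. indicator ({-T..T} \<times> {0..lam}) z *\<^sub>R g z)"
  by (intro borel_integrable_compact compact_Times) (auto intro: continuous_on_subset[OF assms])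

lemma cis_integral_zero:
  assumes ab: "a \<le> b" and c: "c * (b - a) \<in> \<int>" "c \<noteq> 0"
  shows "(\<integral>t. indicator {a..b} t *\<^sub>R cis (2 * pi * (c * t)) \<partial>lborel) = 0"
proof -
  define F where "F t = cis (2 * pi * (c * t)) / (\<i> * of_real (2 * pi * c))" for t
  have c0: "\<i> * of_real (2 * pi * c) \<noteq> 0" using c by simp
  have d: "(F has_vector_derivative cis (2 * pi * (c * t))) (at t within {a..b})" for t
  proof -
    have "((\<lambda>t. cis (2 * pi * (c * t))) has_vector_derivative (2 * pi * c) *\<^sub>R (\<i> * cis (2 * pi * (c * t)))) (at t within {a..b})"
    proof -
      have "((\<lambda>s. exp (\<i> * of_real (2 * pi * c) * of_real s)) has_vector_derivative
          (\<i> * of_real (2 * pi * c)) * exp (\<i> * of_real (2 * pi * c) * of_real t)) (at t within {a..b})"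
        by (auto intro!: derivative_eq_intros has_vector_derivative_real_field)
      thus ?thesis by (simp add: cis_conv_exp scaleR_conv_of_real mult_ac)
    qed
    from has_vector_derivative_divide[OF this, of "\<i> * of_real (2 * pi * c)"]
    show ?thesis using c0 by (simp add: F_def[abs_def] scaleR_conv_of_real field_simps)
  qed
  have "(\<integral>t. indicator {a..b} t *\<^sub>R cis (2 * pi * (c * t)) \<partial>lborel) = F b - F a"
    by (rule integral_FTC_atLeastAtMost[OF ab d]) (intro continuous_intros)
  also have "F b = F a"
  proof -
    obtain k :: int where "c * (b - a) = of_int k" using c by (auto elim: Ints_cases)
    hence "c * b = c * a + of_int k" by (simp add: right_diff_distrib)
    hence "2 * pi * (c * b) = 2 * pi * (c * a) + 2 * pi * of_int k" by (simp only: distrib_left)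
    hence "cis (2 * pi * (c * b)) = cis (2 * pi * (c * a)) * cis (2 * pi * of_int k)"
      by (simp only: cis_mult)
    hence "cis (2 * pi * (c * b)) = cis (2 * pi * (c * a))" by (simp add: cis_multiple_2pi)
    thus ?thesis by (simp add: F_def)
  qed
  finally show ?thesis by simp
qed

lemma box_integral_char:
  "box_integral T lam (char p) =
    (\<integral>t. indicator {-T..T} t *\<^sub>R cis (2 * pi * (fst p * t)) \<partial>lborel) *
    (\<integral>x. indicator {0..lam} x *\<^sub>R cis (2 * pi * (snd p * x)) \<partial>lborel)"
proof -
  let ?I = "\<lambda>z. indicator ({-T..T} \<times> {0..lam}) z *\<^sub>R char p z"
  have "integrable (lborel \<Otimes>\<^sub>M lborel) ?I"
    unfolding lborel_prod by (intro box_integrable continuous_char)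
  from lborel_pair.integral_fst'[OF this]
  have "box_integral T lam (char p) = (\<integral>t. (\<integral>x. ?I (t, x) \<partial>lborel) \<partial>lborel)"
    by (simp add: box_integral_def lborel_prod)
  also have "\<dots> = (\<integral>t. (\<integral>x. (indicator {-T..T} t *\<^sub>R cis (2 * pi * (fst p * t))) *
      (indicator {0..lam} x *\<^sub>R cis (2 * pi * (snd p * x))) \<partial>lborel) \<partial>lborel)"
    by (intro Bochner_Integration.integral_cong refl)
       (auto simp: char_def inner_prod_def cis_mult distrib_left indicator_def)
  also have "\<dots> = (\<integral>t. (indicator {-T..T} t *\<^sub>R cis (2 * pi * (fst p * t))) *
      (\<integral>x. indicator {0..lam} x *\<^sub>R cis (2 * pi * (snd p * x)) \<partial>lborel) \<partial>lborel)"
    by (intro Bochner_Integration.integral_cong refl Bochner_Integration.integral_mult_right_zero)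
  also have "\<dots> = (\<integral>t. indicator {-T..T} t *\<^sub>R cis (2 * pi * (fst p * t)) \<partial>lborel) *
    (\<integral>x. indicator {0..lam} x *\<^sub>R cis (2 * pi * (snd p * x)) \<partial>lborel)"
    by (rule Bochner_Integration.integral_mult_left_zero)
  finally show ?thesis .
qed

lemma box_integral_char_zero:
  assumes "0 < T" "0 < lam" "fst p * T \<in> \<int>" "snd p * lam \<in> \<int>" "p \<noteq> 0"
  shows "box_integral T lam (char p) = 0"
proof (cases "fst p = 0")
  case True
  hence "snd p \<noteq> 0" using assms by (simp add: prod_eq_iff)
  hence "(\<integral>x. indicator {0..lam} x *\<^sub>R cis (2 * pi * (snd p * x)) \<partial>lborel) = 0"
    using assms by (intro cis_integral_zero) auto
  thus ?thesis by (simp add: box_integral_char)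
next
  case False
  have "fst p * (T - (- T)) = fst p * T + fst p * T" by (simp add: algebra_simps)
  hence "fst p * (T - (- T)) \<in> \<int>" using assms by (simp only: Ints_add)
  hence "(\<integral>t. indicator {-T..T} t *\<^sub>R cis (2 * pi * (fst p * t)) \<partial>lborel) = 0"
    using assms False by (intro cis_integral_zero) simp_all
  thus ?thesis by (simp add: box_integral_char)
qed

text \<open>All time frequencies of sums over the lattice lie in \<open>\<int> / \<lambda>\<^sup>3\<close>, so a Fejer kernel of period
  \<open>\<lambda>\<^sup>3\<close> is a majorant of the unit time interval whose frequencies are confined to \<open>(-1, 1)\<close>.\<close>

definition fejer_order :: "real \<Rightarrow> nat" where
  "fejer_order lam = max 1 (nat \<lfloor>lam ^ 3 / 8\<rfloor>)"

definition fejer :: "real \<Rightarrow> real \<Rightarrow> real" where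
  "fejer lam t = (norm (\<Sum>m<fejer_order lam. cis (2 * pi * (real m / lam ^ 3 * t))) / fejer_order lam) ^ 2"

text \<open>The time interval covers two periods of the kernel, so it contains [-1, 1] even for lam
  = 1, while characters on the grid still complete whole periods.\<close>

definition fejer_measure :: "real \<Rightarrow> (real \<times> real) measure" where
  "fejer_measure lam = density lborel
    (\<lambda>z. ennreal (indicator ({- (lam ^ 3)..lam ^ 3} \<times> {0..lam}) z * fejer lam (fst z)))"

lemma fejer_nonneg: "0 \<le> fejer lam t"
  by (simp add: fejer_def)

lemma continuous_fejer [continuous_intros]: "continuous_on A (\<lambda>z. fejer lam (fst z))"
  unfolding fejer_def by (intro continuous_intros) (auto simp: fejer_order_def)

lemma fejer_density_measurable:
  "(\<lambda>z. indicator ({- (lam ^ 3)..lam ^ 3} \<times> {0..lam}) z * fejer lam (fst z)) \<in> borel_measurable borel"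
proof -
  have "(\<lambda>z :: real \<times> real. fejer lam (fst z)) \<in> borel_measurable borel"
    by (intro borel_measurable_continuous_onI continuous_intros)
  moreover have "{- (lam ^ 3)..lam ^ 3} \<times> {0..lam} \<in> sets (borel :: (real \<times> real) measure)"
    by (intro borel_closed closed_Times) auto
  ultimately show ?thesis by (intro borel_measurable_times borel_measurable_indicator) auto
qed

lemma fejer_measure_integral:
  fixes g :: "real \<times> real \<Rightarrow> complex"
  assumes "continuous_on UNIV g"
  shows "integrable (fejer_measure lam) g"
    and "(\<integral>z. g z \<partial>fejer_measure lam) = box_integral (lam ^ 3) lam (\<lambda>z. fejer lam (fst z) *\<^sub>R g z)"
proof -
  let ?f = "\<lambda>z. indicator ({- (lam ^ 3)..lam ^ 3} \<times> {0..lam}) z * fejer lam (fst z)"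
  have g: "g \<in> borel_measurable lborel" using borel_measurable_continuous_onI[OF assms] by simp
  have f: "?f \<in> borel_measurable lborel" using fejer_density_measurable by simp
  have "integrable lborel (\<lambda>z. indicator ({- (lam ^ 3)..lam ^ 3} \<times> {0..lam}) z *\<^sub>R (fejer lam (fst z) *\<^sub>R g z))"
    by (intro box_integrable continuous_intros assms)
  thus "integrable (fejer_measure lam) g"
    unfolding fejer_measure_def by (subst integrable_density[OF g f]) (auto simp: fejer_nonneg)
  show "(\<integral>z. g z \<partial>fejer_measure lam) = box_integral (lam ^ 3) lam (\<lambda>z. fejer lam (fst z) *\<^sub>R g z)"
    unfolding fejer_measure_def box_integral_def by (subst integral_density[OF g f]) (auto simp: fejer_nonneg)
qed

lemma fejer_order_pos: "0 < fejer_order lam"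
  by (simp add: fejer_order_def)

text \<open>The upper bound confines the spectrum to (-1, 1), the lower one controls the mass. The
  alternative at the end separates the constant kernel from those with small phases.\<close>

lemma fejer_order_bounds:
  assumes "1 \<le> lam"
  shows "real (fejer_order lam) \<le> lam ^ 3" "lam ^ 3 \<le> 16 * real (fejer_order lam)"
    "fejer_order lam = 1 \<or> real (fejer_order lam) \<le> lam ^ 3 / 8"
proof -
  have l: "1 \<le> lam ^ 3" using assms by (rule one_le_power)
  show "real (fejer_order lam) \<le> lam ^ 3" "lam ^ 3 \<le> 16 * real (fejer_order lam)"
    "fejer_order lam = 1 \<or> real (fejer_order lam) \<le> lam ^ 3 / 8"
    using l unfolding fejer_order_def max_def by (auto simp: le_nat_iff split: if_splits; linarith)+
qed

text \<open>For time at most 1 every phase is at most 2 pi / 8, so all real parts are at least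
  cos(pi/4), whose square is 1/2. The divisor 8 in \<open>fejer_order\<close> is chosen for
  this.\<close>

lemma fejer_lower:
  assumes "1 \<le> lam" "\<bar>t\<bar> \<le> 1"
  shows "1 / 2 \<le> fejer lam t"
proof (cases "fejer_order lam = 1")
  case True
  thus ?thesis by (simp add: fejer_def)
next
  case False
  define R where "R = fejer_order lam"
  have R: "0 < real R" "real R \<le> lam ^ 3 / 8" using False fejer_order_bounds[OF assms(1)] fejer_order_pos by (auto simp: R_def)
  have l: "0 < lam ^ 3" using assms by simp
  have "real R * (sqrt 2 / 2) = (\<Sum>m<R. cos (pi / 4))" by (simp add: cos_45)
  also have "\<dots> \<le> (\<Sum>m<R. cos (2 * pi * (real m / lam ^ 3 * t)))"
  proof (rule sum_mono)
    fix m assume m: "m \<in> {..<R}"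
    have "\<bar>real m / lam ^ 3 * t\<bar> \<le> 1 / 8 * 1"
      unfolding abs_mult using assms m R l by (intro mult_mono) (auto simp: field_simps)
    hence "2 * pi * \<bar>real m / lam ^ 3 * t\<bar> \<le> 2 * pi * (1 / 8)" by (intro mult_left_mono) auto
    hence "cos (pi / 4) \<le> cos (2 * pi * \<bar>real m / lam ^ 3 * t\<bar>)"
      by (intro cos_monotone_0_pi_le) auto
    thus "cos (pi / 4) \<le> cos (2 * pi * (real m / lam ^ 3 * t))"
      by (cases "0 \<le> real m / lam ^ 3 * t") (auto simp: abs_if)
  qed
  also have "\<dots> = Re (\<Sum>m<R. cis (2 * pi * (real m / lam ^ 3 * t)))" by simp
  also have "\<dots> \<le> norm (\<Sum>m<R. cis (2 * pi * (real m / lam ^ 3 * t)))" by (rule complex_Re_le_cmod)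
  finally have "sqrt 2 / 2 \<le> norm (\<Sum>m<R. cis (2 * pi * (real m / lam ^ 3 * t))) / R"
    using R by (simp add: field_simps)
  hence "(sqrt 2 / 2) ^ 2 \<le> fejer lam t"
    unfolding fejer_def R_def by (intro power_mono) auto
  thus ?thesis by (simp add: power_divide)
qed

lemma fejer_measure_char:
  assumes "lam \<noteq> 0"
  shows "(\<integral>z. char p z \<partial>fejer_measure lam) =
    (\<Sum>m<fejer_order lam. \<Sum>m'<fejer_order lam.
      box_integral (lam ^ 3) lam (char (p + ((real m - real m') / lam ^ 3, 0)))) / of_nat (fejer_order lam) ^ 2"
proof -
  define R where "R = fejer_order lam"
  define e where "e m t = cis (2 * pi * (real m / lam ^ 3 * t))" for m t
  have R: "0 < R" by (simp add: R_def fejer_order_pos)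
  have "fejer lam (fst z) *\<^sub>R char p z =
      (\<Sum>m<R. \<Sum>m'<R. char (p + ((real m - real m') / lam ^ 3, 0)) z) / of_nat R ^ 2" for z
  proof -
    have "complex_of_real (fejer lam (fst z)) = (\<Sum>m<R. e m (fst z)) * cnj (\<Sum>m<R. e m (fst z)) / of_nat R ^ 2"
      unfolding fejer_def power_divide R_def[symmetric] e_def[symmetric]
      by (simp only: of_real_divide complex_norm_square) simp
    also have "\<dots> = (\<Sum>m<R. \<Sum>m'<R. e m (fst z) * cnj (e m' (fst z))) / of_nat R ^ 2"
      by (simp add: sum_product)
    also have "\<dots> = (\<Sum>m<R. \<Sum>m'<R. char ((real m - real m') / lam ^ 3, 0) z) / of_nat R ^ 2"
    proof -
      have "e m (fst z) * cnj (e m' (fst z)) = char ((real m - real m') / lam ^ 3, 0) z" for m m'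
        by (simp add: e_def char_def cis_cnj cis_mult inner_prod_def algebra_simps diff_divide_distrib)
      thus ?thesis by simp
    qed
    finally show ?thesis
      by (simp only: scaleR_conv_of_real char_add sum_distrib_left[symmetric]) simp
  qed
  note eq = this
  have "(\<integral>z. char p z \<partial>fejer_measure lam) = box_integral (lam ^ 3) lam
      (\<lambda>z. (\<Sum>m<R. \<Sum>m'<R. char (p + ((real m - real m') / lam ^ 3, 0)) z) / of_nat R ^ 2)"
    unfolding fejer_measure_integral(2)[OF continuous_char] eq ..
  also have "\<dots> = (\<integral>z. (\<Sum>m<R. \<Sum>m'<R. indicator ({- (lam^3)..lam^3} \<times> {0..lam}) z *\<^sub>R char (p + ((real m - real m') / lam ^ 3, 0)) z)
       / of_nat R ^ 2 \<partial>lborel)"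
    unfolding box_integral_def
    by (intro Bochner_Integration.integral_cong refl)
       (simp only: scaleR_conv_of_real times_divide_eq_right sum_distrib_left)
  also have "\<dots> = (\<Sum>m<R. \<Sum>m'<R. box_integral (lam ^ 3) lam (char (p + ((real m - real m') / lam ^ 3, 0)))) / of_nat R ^ 2"
  proof -
    let ?h = "\<lambda>m m' z. indicator ({- (lam^3)..lam^3} \<times> {0..lam}) z *\<^sub>R char (p + ((real m - real m') / lam ^ 3, 0)) z"
    have i: "integrable lborel (?h m m')" for m m' by (intro box_integrable continuous_char)
    have "(\<integral>z. (\<Sum>m<R. \<Sum>m'<R. ?h m m' z) \<partial>lborel) = (\<Sum>m<R. (\<integral>z. (\<Sum>m'<R. ?h m m' z) \<partial>lborel))"
      by (intro Bochner_Integration.integral_sum Bochner_Integration.integrable_sum i)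
    also have "\<dots> = (\<Sum>m<R. \<Sum>m'<R. (\<integral>z. ?h m m' z \<partial>lborel))"
      by (intro sum.cong refl Bochner_Integration.integral_sum i)
    finally show ?thesis by (simp only: box_integral_def Bochner_Integration.integral_divide_zero)
  qed
  finally show ?thesis by (simp add: R_def)
qed

text \<open>The kernel shifts a time frequency by (m - m') / lam^3, a grid element of modulus below
  1. The shifted character can be trivial only if the original frequency was resonant.\<close>

lemma resonance_measure_fejer:
  assumes lam: "1 \<le> lam"
  shows "resonance_measure (fejer_measure lam) lam"
proof
  show "integrable (fejer_measure lam) g" if "continuous_on UNIV g" for g :: "real \<times> real \<Rightarrow> complex"
    using that by (rule fejer_measure_integral)
  show "0 < lam" using lam by simp
  fix p assume p: "p \<in> grid lam" "\<not> resonant p"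
  define R where "R = fejer_order lam"
  have l: "1 \<le> lam ^ 3" using lam by (rule one_le_power)
  have "box_integral (lam ^ 3) lam (char (p + ((real m - real m') / lam ^ 3, 0))) = 0" if "m < R" "m' < R" for m m'
  proof (rule box_integral_char_zero)
    have "fst (p + ((real m - real m') / lam ^ 3, 0)) * lam ^ 3 = fst p * lam ^ 3 + (real m - real m')"
      using lam by (simp add: distrib_right)
    thus "fst (p + ((real m - real m') / lam ^ 3, 0)) * lam ^ 3 \<in> \<int>" using p by (simp add: grid_def)
    show "snd (p + ((real m - real m') / lam ^ 3, 0)) * lam \<in> \<int>" using p by (simp add: grid_def)
    have "\<bar>real m - real m'\<bar> < real R" using that by linarith
    also have "\<dots> \<le> lam ^ 3" unfolding R_def by (rule fejer_order_bounds[OF lam])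
    finally have "\<bar>(real m - real m') / lam ^ 3\<bar> < 1"
      using lam by (simp add: abs_divide divide_less_eq_1 power_abs[symmetric])
    moreover have "fst p = - ((real m - real m') / lam ^ 3)" "snd p = 0" if "p + ((real m - real m') / lam ^ 3, 0) = 0"
      using that by (simp_all add: prod_eq_iff eq_neg_iff_add_eq_0)
    ultimately have "resonant p" if "p + ((real m - real m') / lam ^ 3, 0) = 0"
      using that by (simp only: resonant_def abs_minus_cancel simp_thms)
    thus "p + ((real m - real m') / lam ^ 3, 0) \<noteq> 0" using p by auto
  qed (use lam in auto)
  thus "(\<integral>z. char p z \<partial>fejer_measure lam) = 0"
    using lam by (subst fejer_measure_char) (auto simp: R_def[symmetric])
qed

text \<open>Only the diagonal m = m' of the expanded kernel contributes, leaving 2 lam^4 divided by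
  the order; this is the origin of 32.\<close>

lemma fejer_mass:
  assumes lam: "1 \<le> lam"
  shows "(\<integral>z. 1 \<partial>fejer_measure lam) \<le> 32 * lam"
proof -
  define R where "R = fejer_order lam"
  have R: "0 < real R" by (simp add: R_def fejer_order_pos)
  have l: "1 \<le> lam ^ 3" using lam by (rule one_le_power)
  have c0: "char 0 z = 1" for z by (simp add: char_def)
  have box: "box_integral (lam ^ 3) lam (char (0 + ((real m - real m') / lam ^ 3, 0))) =
      (if m' = m then of_real (2 * lam ^ 3 * lam) else 0)" for m m'
  proof (cases "m' = m")
    case True
    have "box_integral (lam ^ 3) lam (char 0) = of_real (2 * lam ^ 3 * lam)"
      using lam l unfolding box_integral_char by (simp add: scaleR_conv_of_real)
    thus ?thesis using True by (simp add: zero_prod_def)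
  next
    case False
    have "box_integral (lam ^ 3) lam (char (0 + ((real m - real m') / lam ^ 3, 0))) = 0"
      using False lam l by (intro box_integral_char_zero) (auto simp: prod_eq_iff)
    thus ?thesis using False by simp
  qed
  have "complex_of_real (\<integral>z. 1 \<partial>fejer_measure lam) = (\<integral>z. char 0 z \<partial>fejer_measure lam)"
    by (simp add: c0 of_real_def)
  also have "\<dots> = of_real (real R * (2 * lam ^ 3 * lam) / real R ^ 2)"
    using R lam by (subst fejer_measure_char, simp, unfold R_def[symmetric] box) (simp add: power2_eq_square)
  finally have "(\<integral>z. 1 \<partial>fejer_measure lam) = real R * (2 * lam ^ 3 * lam) / real R ^ 2"
    by (simp only: of_real_eq_iff)
  also have "\<dots> = 2 * lam ^ 3 * lam / real R" using R by (simp add: power2_eq_square)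
  also have "\<dots> \<le> 32 * lam"
  proof -
    have "lam ^ 3 * lam \<le> 16 * real R * lam"
      unfolding R_def using lam by (intro mult_right_mono fejer_order_bounds(2)) auto
    thus ?thesis using R by (simp add: field_simps)
  qed
  finally show ?thesis .
qed

lemma nn_integral_strip_le:
  assumes lam: "1 \<le> lam" and g: "continuous_on UNIV g" "\<And>z. 0 \<le> g z"
  shows "(\<integral>\<^sup>+z. ennreal (indicator ({-1..1} \<times> {0..lam}) z * g z) \<partial>lborel) \<le> ennreal (2 * (\<integral>z. g z \<partial>fejer_measure lam))"
proof -
  interpret resonance_measure "fejer_measure lam" lam by (rule resonance_measure_fejer[OF lam])
  let ?f = "\<lambda>z. indicator ({- (lam ^ 3)..lam ^ 3} \<times> {0..lam}) z * fejer lam (fst z)"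
  have l: "1 \<le> lam ^ 3" using assms(1) by (rule one_le_power)
  have gm: "g \<in> borel_measurable borel" by (rule borel_measurable_continuous_onI[OF g(1)])
  have "indicator ({-1..1} \<times> {0..lam}) z * g z \<le> ?f z * (2 * g z)" for z
  proof (cases "z \<in> {-1..1} \<times> {0..lam}")
    case True
    hence "1 / 2 \<le> fejer lam (fst z)" by (intro fejer_lower assms(1)) auto
    hence "1 / 2 * (2 * g z) \<le> fejer lam (fst z) * (2 * g z)" using g by (intro mult_right_mono) auto
    thus ?thesis using True l by (auto simp: indicator_def)
  qed (use g fejer_nonneg in \<open>auto simp: indicator_def\<close>)
  hence "(\<integral>\<^sup>+z. ennreal (indicator ({-1..1} \<times> {0..lam}) z * g z) \<partial>lborel)
      \<le> (\<integral>\<^sup>+z. ennreal (?f z) * ennreal (2 * g z) \<partial>lborel)"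
    using g fejer_nonneg by (intro nn_integral_mono) (simp flip: ennreal_mult'')
  also have "\<dots> = (\<integral>\<^sup>+z. ennreal (2 * g z) \<partial>fejer_measure lam)"
    unfolding fejer_measure_def using gm fejer_density_measurable by (subst nn_integral_density) auto
  also have "\<dots> = ennreal (\<integral>z. 2 * g z \<partial>fejer_measure lam)"
    using g by (intro nn_integral_eq_integral integrable_real continuous_intros) auto
  finally show ?thesis by simp
qed

section \<open>Moment bounds\<close>

lemma card_dual_lattice_le:
  assumes lam: "0 < lam" and F: "F \<subseteq> dual_lattice lam" "F \<subseteq> {x..y}" and xy: "x \<le> y"
  shows "real (card F) \<le> lam * (y - x) + 1"
proof -
  have "F \<subseteq> (\<lambda>k::int. real_of_int k / lam) ` {\<lceil>lam * x\<rceil>..\<lfloor>lam * y\<rfloor>}"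
  proof
    fix \<xi> assume "\<xi> \<in> F"
    then obtain k :: int where k: "\<xi> = real_of_int k / lam" "x \<le> \<xi>" "\<xi> \<le> y"
      using F by (force simp: dual_lattice_def)
    have "lam * x \<le> lam * \<xi>" "lam * \<xi> \<le> lam * y" by (rule mult_left_mono; use k lam in simp)+
    moreover have "lam * \<xi> = k" using k lam by simp
    ultimately have "lam * x \<le> k" "k \<le> lam * y" by (simp_all only:)
    thus "\<xi> \<in> (\<lambda>k::int. real_of_int k / lam) ` {\<lceil>lam * x\<rceil>..\<lfloor>lam * y\<rfloor>}"
      using k by (auto simp: ceiling_le_iff le_floor_iff)
  qed
  hence "card F \<le> card {\<lceil>lam * x\<rceil>..\<lfloor>lam * y\<rfloor>}" by (intro surj_card_le) auto
  hence "real (card F) \<le> real (nat (\<lfloor>lam * y\<rfloor> - \<lceil>lam * x\<rceil> + 1))" by simp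
  also have "\<dots> \<le> max 0 (lam * y - lam * x + 1)" by linarith
  also have "\<dots> = lam * (y - x) + 1"
  proof -
    have "lam * x \<le> lam * y" using lam xy by (intro mult_left_mono) auto
    thus ?thesis by (simp add: right_diff_distrib)
  qed
  finally show ?thesis .
qed

text \<open>Adjoining the lattice point 0 uses up the additive 1 of the general count. Its absence
  matters at low frequencies, where the bounds have to decay with M.\<close>

lemma card_dual_lattice_pos_le:
  assumes lam: "0 < lam" and F: "finite F" "F \<subseteq> dual_lattice lam" "F \<subseteq> {0<..X}" and X: "0 \<le> X"
  shows "real (card F) \<le> lam * X"
proof -
  have "0 \<in> dual_lattice lam" by (auto simp: dual_lattice_def intro: image_eqI[of _ _ 0])
  hence "real (card (insert 0 F)) \<le> lam * (X - 0) + 1"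
    using F X by (intro card_dual_lattice_le lam) auto
  moreover have "0 \<notin> F" using F by auto
  ultimately show ?thesis using F by simp
qed

lemma norm_wave_sum_le:
  assumes "finite G"
  shows "norm (wave_sum a G z) ^ 2 \<le> real (card G) * (\<Sum>\<xi>\<in>G. norm (a \<xi>) ^ 2)"
proof -
  have "norm (wave_sum a G z) \<le> (\<Sum>\<xi>\<in>G. norm (a \<xi>))"
    unfolding wave_sum_def by (rule order_trans[OF norm_sum]) (simp add: norm_mult)
  hence "norm (wave_sum a G z) ^ 2 \<le> (\<Sum>\<xi>\<in>G. 1 * norm (a \<xi>)) ^ 2"
    by (intro power_mono) auto
  also have "\<dots> \<le> (\<Sum>\<xi>\<in>G. 1 ^ 2) * (\<Sum>\<xi>\<in>G. norm (a \<xi>) ^ 2)"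
    by (rule Cauchy_Schwarz_ineq_sum)
  finally show ?thesis by simp
qed

context resonance_measure
begin

abbreviation mass :: real where
  "mass \<equiv> (\<integral>z. 1 \<partial>\<mu>)"

text \<open>A pair resonant with a given one is determined by its first frequency, since the sums
  agree. That frequency lies in a window of length 2 \<rho>, which gives the count 2 \<rho> lam +
  1.\<close>

lemma bilinear_L2:
  assumes G: "finite G" "G \<subseteq> dual_lattice lam" and H: "finite H" "H \<subseteq> dual_lattice lam" and \<rho>: "0 \<le> \<rho>"
    and res: "\<And>\<xi> \<xi>' \<eta> \<eta>'. \<xi> \<in> G \<Longrightarrow> \<xi>' \<in> G \<Longrightarrow> \<eta> \<in> H \<Longrightarrow> \<eta>' \<in> H \<Longrightarrow>
      resonant ((curve \<xi> + curve \<eta>) - (curve \<xi>' + curve \<eta>')) \<Longrightarrow> \<bar>\<xi> - \<xi>'\<bar> \<le> \<rho>"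
  shows "(\<integral>z. (norm (wave_sum a G z * wave_sum b H z))\<^sup>2 \<partial>\<mu>)
    \<le> (2 * \<rho> * lam + 1) * mass * (\<Sum>\<xi>\<in>G. norm (a \<xi>) ^ 2) * (\<Sum>\<eta>\<in>H. norm (b \<eta>) ^ 2)"
proof -
  define g where "g p z = (a (fst p) * b (snd p)) * char (curve (fst p) + curve (snd p)) z" for p z
  define R where "R p q \<longleftrightarrow> resonant ((curve (fst p) + curve (snd p)) - (curve (fst q) + curve (snd q)))" for p q :: "real \<times> real"
  have trig: "g p \<in> trig {curve (fst p) + curve (snd p)}" for p
    unfolding g_def by (rule trig_char) simp
  have "(\<integral>z. (norm (\<Sum>p\<in>G \<times> H. g p z))\<^sup>2 \<partial>\<mu>) \<le> (2 * \<rho> * lam + 1) * (\<Sum>p\<in>G \<times> H. \<integral>z. (norm (g p z))\<^sup>2 \<partial>\<mu>)"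
  proof (rule almost_orthogonal[where R = R])
    fix p q assume p: "p \<in> G \<times> H" "q \<in> G \<times> H" "\<not> R p q"
    hence "fst p \<in> dual_lattice lam" "snd p \<in> dual_lattice lam" "fst q \<in> dual_lattice lam" "snd q \<in> dual_lattice lam"
      using G H by auto
    hence "curve (fst p) + curve (snd p) \<in> grid lam" "curve (fst q) + curve (snd q) \<in> grid lam"
      using lam by (auto intro!: grid_add curve_in_grid)
    thus "(\<integral>z. g p z * cnj (g q z) \<partial>\<mu>) = 0"
      using p(3) by (intro trig_orthogonal[OF trig trig]) (auto simp: R_def)
  next
    fix p assume p: "p \<in> G \<times> H"
    let ?Q = "{q \<in> G \<times> H. R p q}"
    have inj: "inj_on fst ?Q"
    proof (rule inj_onI)
      fix q q' assume "q \<in> ?Q" "q' \<in> ?Q" "fst q = fst q'"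
      thus "q = q'" by (auto simp: R_def resonant_def curve_def prod_eq_iff)
    qed
    have "fst ` ?Q \<subseteq> {fst p - \<rho>..fst p + \<rho>}"
    proof
      fix x assume "x \<in> fst ` ?Q"
      then obtain q where q: "x = fst q" "q \<in> G \<times> H" "R p q" by auto
      have "\<bar>fst p - fst q\<bar> \<le> \<rho>"
        by (rule res[of _ _ "snd p" "snd q"]) (use p q in \<open>auto simp: R_def\<close>)
      thus "x \<in> {fst p - \<rho>..fst p + \<rho>}" using q by auto
    qed
    moreover have "fst ` ?Q \<subseteq> dual_lattice lam" using G by auto
    ultimately have "real (card (fst ` ?Q)) \<le> lam * ((fst p + \<rho>) - (fst p - \<rho>)) + 1"
      using \<rho> by (intro card_dual_lattice_le lam) auto
    thus "real (card ?Q) \<le> 2 * \<rho> * lam + 1" by (simp add: card_image[OF inj] mult_ac)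
  next
    show "continuous_on UNIV (g p)" for p by (rule trig_continuous[OF trig])
    show "R q p" if "R p q" for p q using that by (auto simp: R_def resonant_def abs_minus_commute)
  qed (use G H in auto)
  also have "(\<Sum>p\<in>G \<times> H. \<integral>z. (norm (g p z))\<^sup>2 \<partial>\<mu>) = (\<Sum>p\<in>G \<times> H. (norm (a (fst p)) ^ 2 * norm (b (snd p)) ^ 2) * mass)"
    by (simp add: g_def norm_mult power_mult_distrib mult_ac)
  also have "\<dots> = mass * (\<Sum>\<xi>\<in>G. norm (a \<xi>) ^ 2) * (\<Sum>\<eta>\<in>H. norm (b \<eta>) ^ 2)"
    by (simp add: sum_distrib_right[symmetric] sum_product sum.cartesian_product case_prod_unfold)
  also have "(\<lambda>z. \<Sum>p\<in>G \<times> H. g p z) = (\<lambda>z. wave_sum a G z * wave_sum b H z)"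
    by (rule ext) (simp add: g_def wave_sum_def sum_product sum.cartesian_product case_prod_unfold char_add mult_ac)
  finally show ?thesis by (simp add: mult_ac)
qed

lemma L2_bound:
  assumes G: "finite G" "G \<subseteq> dual_lattice lam"
  shows "(\<integral>z. (norm (wave_sum a G z))\<^sup>2 \<partial>\<mu>) \<le> mass * (\<Sum>\<xi>\<in>G. norm (a \<xi>) ^ 2)"
proof -
  \<comment> \<open>The constant function 1 as second factor: its single frequency 0 forces resonant
    pairs to coincide, so \<rho> = 0 works.\<close>
  define b where "b \<xi> = (if \<xi> = 0 then 1 else 0 :: complex)" for \<xi> :: real
  have "wave_sum b {0} z = 1" for z by (simp add: wave_sum_def b_def curve_def char_def zero_prod_def[symmetric])
  moreover have "(\<integral>z. (norm (wave_sum a G z * wave_sum b {0} z))\<^sup>2 \<partial>\<mu>)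
      \<le> (2 * 0 * lam + 1) * mass * (\<Sum>\<xi>\<in>G. norm (a \<xi>) ^ 2) * (\<Sum>\<eta>\<in>{0}. norm (b \<eta>) ^ 2)"
  proof (rule bilinear_L2[OF G])
    have "0 / lam \<in> dual_lattice lam" unfolding dual_lattice_def by (rule range_eqI[of _ _ 0]) simp
    thus "{0} \<subseteq> dual_lattice lam" by simp
  qed (auto simp: resonant_def curve_def)
  ultimately show ?thesis by (simp add: b_def)
qed

lemma moment_bound:
  assumes G: "finite G" "G \<subseteq> dual_lattice lam" and n: "real (card G) \<le> n"
  shows "(\<integral>z. norm (wave_sum a G z) ^ (2 * k + 2) \<partial>\<mu>) \<le> n ^ k * mass * (\<Sum>\<xi>\<in>G. norm (a \<xi>) ^ 2) ^ (k + 1)"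
proof -
  define A where "A = (\<Sum>\<xi>\<in>G. norm (a \<xi>) ^ 2)"
  have A: "0 \<le> A" by (simp add: A_def sum_nonneg)
  have n0: "0 \<le> n" using n by (meson of_nat_0_le_iff order_trans)
  have "norm (wave_sum a G z) ^ (2 * k + 2) \<le> (n * A) ^ k * norm (wave_sum a G z) ^ 2" for z
  proof -
    have "norm (wave_sum a G z) ^ 2 \<le> real (card G) * A"
      unfolding A_def using G by (intro norm_wave_sum_le)
    also have "\<dots> \<le> n * A" by (intro mult_right_mono n A)
    finally have "(norm (wave_sum a G z) ^ 2) ^ k \<le> (n * A) ^ k" by (intro power_mono) auto
    thus ?thesis by (simp only: power_add power_mult) (rule mult_right_mono, auto)
  qed
  hence "(\<integral>z. norm (wave_sum a G z) ^ (2 * k + 2) \<partial>\<mu>) \<le> (\<integral>z. (n * A) ^ k * norm (wave_sum a G z) ^ 2 \<partial>\<mu>)"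
    by (intro integral_mono_real continuous_intros)
  also have "\<dots> = (n * A) ^ k * (\<integral>z. norm (wave_sum a G z) ^ 2 \<partial>\<mu>)" by simp
  also have "\<dots> \<le> (n * A) ^ k * (mass * A)"
    unfolding A_def using G n0 by (intro mult_left_mono L2_bound) (auto simp: sum_nonneg)
  finally show ?thesis by (simp add: A_def power_mult_distrib mult_ac)
qed

text \<open>Two of the four powers are bounded by the supremum, which costs one cardinality per
  factor; the rest is \<open>bilinear_L2\<close>.\<close>

lemma bilinear_L4:
  assumes G: "finite G" "G \<subseteq> dual_lattice lam" "real (card G) \<le> n" and H: "finite H" "H \<subseteq> dual_lattice lam" "real (card H) \<le> m"
    and \<rho>: "0 \<le> \<rho>"
    and res: "\<And>\<xi> \<xi>' \<eta> \<eta>'. \<xi> \<in> G \<Longrightarrow> \<xi>' \<in> G \<Longrightarrow> \<eta> \<in> H \<Longrightarrow> \<eta>' \<in> H \<Longrightarrow>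
      resonant ((curve \<xi> + curve \<eta>) - (curve \<xi>' + curve \<eta>')) \<Longrightarrow> \<bar>\<xi> - \<xi>'\<bar> \<le> \<rho>"
  shows "(\<integral>z. norm (wave_sum a G z * wave_sum b H z) ^ 4 \<partial>\<mu>)
    \<le> n * m * (2 * \<rho> * lam + 1) * mass * ((\<Sum>\<xi>\<in>G. norm (a \<xi>) ^ 2) * (\<Sum>\<eta>\<in>H. norm (b \<eta>) ^ 2)) ^ 2"
proof -
  define A B where "A = (\<Sum>\<xi>\<in>G. norm (a \<xi>) ^ 2)" and "B = (\<Sum>\<eta>\<in>H. norm (b \<eta>) ^ 2)"
  have AB: "0 \<le> A" "0 \<le> B" by (simp_all add: A_def B_def sum_nonneg)
  have nm: "0 \<le> n" "0 \<le> m" using G H by (meson of_nat_0_le_iff order_trans)+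
  have pt: "norm (wave_sum a G z * wave_sum b H z) ^ 4 \<le> (n * A) * (m * B) * norm (wave_sum a G z * wave_sum b H z) ^ 2" for z
  proof -
    have "norm (wave_sum a G z) ^ 2 \<le> real (card G) * A" "norm (wave_sum b H z) ^ 2 \<le> real (card H) * B"
      unfolding A_def B_def using G H by (auto intro!: norm_wave_sum_le)
    hence "norm (wave_sum a G z) ^ 2 \<le> n * A" "norm (wave_sum b H z) ^ 2 \<le> m * B"
      using G H AB by (meson mult_right_mono order_trans)+
    hence "norm (wave_sum a G z) ^ 2 * norm (wave_sum b H z) ^ 2 \<le> (n * A) * (m * B)"
      using nm AB by (intro mult_mono) auto
    hence "norm (wave_sum a G z * wave_sum b H z) ^ 2 \<le> (n * A) * (m * B)"
      by (simp add: norm_mult power_mult_distrib)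
    hence "norm (wave_sum a G z * wave_sum b H z) ^ 2 * norm (wave_sum a G z * wave_sum b H z) ^ 2
       \<le> (n * A) * (m * B) * norm (wave_sum a G z * wave_sum b H z) ^ 2"
      by (intro mult_right_mono) auto
    thus ?thesis by (simp flip: power_add)
  qed
  have "(\<integral>z. norm (wave_sum a G z * wave_sum b H z) ^ 4 \<partial>\<mu>)
      \<le> (\<integral>z. (n * A) * (m * B) * norm (wave_sum a G z * wave_sum b H z) ^ 2 \<partial>\<mu>)"
    by (intro integral_mono_real continuous_intros pt)
  also have "\<dots> = (n * A) * (m * B) * (\<integral>z. norm (wave_sum a G z * wave_sum b H z) ^ 2 \<partial>\<mu>)"
    by (rule Bochner_Integration.integral_mult_right_zero)
  also have "\<dots> \<le> (n * A) * (m * B) * ((2 * \<rho> * lam + 1) * mass * A * B)"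
    unfolding A_def B_def using nm G H
    by (intro mult_left_mono bilinear_L2 \<rho> res) (auto intro!: mult_nonneg_nonneg sum_nonneg)
  finally show ?thesis by (simp add: A_def B_def power_mult_distrib power2_eq_square mult_ac)
qed

end

lemma ex_power2_between:
  assumes "1 \<le> (x::real)"
  shows "\<exists>n. x < 2 ^ n \<and> 2 ^ n \<le> 2 * x"
proof -
  have ex: "\<exists>n. x < 2 ^ n" using real_arch_pow[of 2 x] by simp
  define n where "n = (LEAST n. x < 2 ^ n)"
  have n: "x < 2 ^ n" unfolding n_def by (rule LeastI_ex[OF ex])
  then obtain m where m: "n = Suc m" using assms by (cases n) auto
  have "\<not> x < 2 ^ m" using not_less_Least[of m "\<lambda>n. x < 2 ^ n"] m by (simp add: n_def)
  thus ?thesis using n m by (intro exI[of _ n]) auto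
qed

text \<open>\<open>B\<close> bounds the mass per unit of lam. The product of lam with the sum of
  squares is the squared torus norm, because the coefficients are Fourier transforms divided by
  lam.\<close>

definition positive_moment :: "real \<Rightarrow> nat \<Rightarrow> nat \<Rightarrow> nat \<Rightarrow> (real \<Rightarrow> real \<Rightarrow> real) \<Rightarrow> bool" where
  "positive_moment B \<kappa> p q w \<longleftrightarrow> (\<exists>C>0. \<forall>\<mu> lam M F a. resonance_measure \<mu> lam \<longrightarrow> 1 \<le> lam \<longrightarrow> (\<integral>z. 1 \<partial>\<mu>) \<le> B * lam \<longrightarrow>
    0 < M \<longrightarrow> finite F \<longrightarrow> F \<subseteq> dual_lattice lam \<longrightarrow> F \<subseteq> {M..real \<kappa> * M} \<longrightarrow>
    (\<integral>z. norm (wave_sum a F z) ^ p \<partial>\<mu>) \<le> C * w lam M * (lam * (\<Sum>\<xi>\<in>F. norm (a \<xi>) ^ 2)) ^ q)"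

text \<open>Cells of width M^(-1/2) \<le> 1 hold O(lam) frequencies, for which the trivial moment
  bound already has the right power of lam; decoupling passes from them to all of \<open>F\<close>.
  For M < 1 that width would exceed 1, but there \<open>F\<close> itself has only O(lam M)
  elements.\<close>

lemma L6_bound:
  assumes \<epsilon>: "0 < \<epsilon>" "\<epsilon> \<le> 1 / 3" and B: "1 \<le> B" and \<kappa>: "1 \<le> \<kappa>"
  shows "positive_moment B \<kappa> 6 3 (\<lambda>lam M. M powr (6 * \<epsilon>))"
proof -
  \<comment> \<open>About M^(3/2) cells cover the shell, so the decoupling loss is of order M^(3/2
    \<eta>) = M^(2 \<epsilon>), and its cube M^(6 \<epsilon>).\<close>
  define \<eta> where "\<eta> = 4 / 3 * \<epsilon>"
  have "decoupling_exponent \<kappa> \<eta>" using \<epsilon> by (intro decoupling_exponent_pos) (simp add: \<eta>_def)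
  then obtain K where K: "1 \<le> K" and dec: "\<And>\<mu> lam M \<delta> F a j i. airy_data \<mu> lam M \<delta> \<kappa> F \<Longrightarrow> 1 \<le> M * \<delta>\<^sup>2 \<Longrightarrow>
    airy_data.sq6 \<mu> \<delta> F a j i \<le> K * 2 powr (\<eta> * real j) * airy_data.energy \<mu> \<delta> F a j i"
    unfolding decoupling_exponent_def by (elim exE conjE) simp
  define C where "C = B * (real \<kappa>)\<^sup>2 + (K * (2 * \<kappa>) powr \<eta> * (4 * B)) ^ 3"
  have C: "0 < C" "B * (real \<kappa>)\<^sup>2 \<le> C" "(K * (2 * \<kappa>) powr \<eta> * (4 * B)) ^ 3 \<le> C"
    using B K \<kappa> by (auto simp: C_def intro!: add_pos_nonneg mult_pos_pos)
  show ?thesis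
    unfolding positive_moment_def
  proof (intro exI[of _ C] conjI allI impI C)
    fix \<mu> lam M F and a :: "real \<Rightarrow> complex"
    assume rm: "resonance_measure \<mu> lam" and lam1: "1 \<le> lam" and mass: "(\<integral>z. 1 \<partial>\<mu>) \<le> B * lam"
      and M: "0 < M" and F: "finite F" "F \<subseteq> dual_lattice lam" "F \<subseteq> {M..real \<kappa> * M}"
    interpret resonance_measure \<mu> lam by fact
    define A where "A = (\<Sum>\<xi>\<in>F. norm (a \<xi>) ^ 2)"
    have A: "0 \<le> A" by (simp add: A_def sum_nonneg)
    show "(\<integral>z. norm (wave_sum a F z) ^ 6 \<partial>\<mu>) \<le> C * M powr (6 * \<epsilon>) * (lam * (\<Sum>\<xi>\<in>F. norm (a \<xi>) ^ 2)) ^ 3"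
    proof (cases "M < 1")
      case True
      have "real (card F) \<le> lam * (\<kappa> * M)"
        using F M by (intro card_dual_lattice_pos_le lam) auto
      hence "(\<integral>z. norm (wave_sum a F z) ^ (2 * 2 + 2) \<partial>\<mu>) \<le> (lam * (\<kappa> * M)) ^ 2 * mass * A ^ (2 + 1)"
        unfolding A_def using F by (intro moment_bound)
      also have "\<dots> \<le> (lam * (\<kappa> * M)) ^ 2 * (B * lam) * A ^ (2 + 1)"
        using mass A by (intro mult_right_mono mult_left_mono) auto
      also have "\<dots> = B * (real \<kappa>)\<^sup>2 * (M ^ 2) * (lam * A) ^ 3" by (simp add: eval_nat_numeral algebra_simps)
      \<comment> \<open>The origin of the restriction \<epsilon> \<le> 1/3: for M < 1 the exponent 6
        \<epsilon> must not exceed 2.\<close>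
      also have "M ^ 2 \<le> M powr (6 * \<epsilon>)"
        using M True \<epsilon> powr_mono'[of "6 * \<epsilon>" 2 M] by (simp add: powr_numeral)
      hence "B * (real \<kappa>)\<^sup>2 * (M ^ 2) * (lam * A) ^ 3 \<le> C * M powr (6 * \<epsilon>) * (lam * A) ^ 3"
        using B C A lam by (intro mult_right_mono mult_mono) auto
      finally show ?thesis by (simp add: A_def)
    next
      case False
      hence M1: "1 \<le> M" by simp
      define \<delta> where "\<delta> = 1 / sqrt M"
      have dl: "0 < \<delta>" "\<delta> \<le> 1" "M * \<delta>\<^sup>2 = 1" using M1 by (simp_all add: \<delta>_def power_divide)
      interpret airy_data \<mu> lam M \<delta> \<kappa> F a
        by unfold_locales (use M dl \<kappa> F in auto)
      have "1 * (1 * 1) \<le> real \<kappa> * (M * sqrt M)" using \<kappa> M1 by (intro mult_mono) auto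
      then obtain n where n: "real \<kappa> * (M * sqrt M) < 2 ^ n" "2 ^ n \<le> 2 * (real \<kappa> * (M * sqrt M))"
        using ex_power2_between[of "real \<kappa> * (M * sqrt M)"] by auto
      have cell: "cell n 0 = F"
      proof -
        have "nat \<lfloor>\<xi> / \<delta>\<rfloor> < 2 ^ n" if "\<xi> \<in> F" for \<xi>
        proof -
          have "\<xi> / \<delta> = \<xi> * sqrt M" by (simp add: \<delta>_def)
          also have "\<dots> \<le> (real \<kappa> * M) * sqrt M" using that F M by (intro mult_right_mono) auto
          finally have "\<xi> / \<delta> < 2 ^ n" using n by (simp add: mult_ac)
          hence "\<lfloor>\<xi> / \<delta>\<rfloor> < 2 ^ n" by (simp add: floor_less_iff)
          thus ?thesis by (simp add: nat_less_iff)
        qed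
        thus ?thesis by (auto simp: cell_def)
      qed
      have small: "sq6 0 q \<le> 4 * B * lam * (\<Sum>\<xi>\<in>cell 0 q. norm (a \<xi>) ^ 2)" for q
      proof -
        define S where "S = (\<Sum>\<xi>\<in>cell 0 q. norm (a \<xi>) ^ 2)"
        have S: "0 \<le> S" by (simp add: S_def sum_nonneg)
        have lat: "cell 0 q \<subseteq> dual_lattice lam" using F cell_subset by blast
        have "real (card (cell 0 q)) \<le> lam * ((real q + 1) * \<delta> - real q * \<delta>) + 1"
          using cell_bounds[of _ 0 q] dl by (intro card_dual_lattice_le lam lat) (auto simp: less_imp_le)
        also have "\<dots> = lam * \<delta> + 1" by (simp add: algebra_simps)
        also have "\<dots> \<le> 2 * lam"
        proof -
          have "lam * \<delta> \<le> lam * 1" by (rule mult_left_mono) (use dl lam1 in auto)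
          thus ?thesis using lam1 by linarith
        qed
        finally have "(\<integral>z. norm (piece 0 q z) ^ (2 * 2 + 2) \<partial>\<mu>) \<le> (2 * lam) ^ 2 * mass * S ^ (2 + 1)"
          unfolding S_def by (intro moment_bound lat) auto
        also have "\<dots> \<le> (2 * lam) ^ 2 * (B * lam) * S ^ (2 + 1)"
          using mass S by (intro mult_right_mono mult_left_mono) auto
        also have "\<dots> = (4 * B) * (lam * S) ^ 3" by (simp add: eval_nat_numeral algebra_simps)
        also have "\<dots> \<le> (4 * B) ^ 3 * (lam * S) ^ 3"
          using B S lam1 power_increasing[of 1 3 "4 * B"] by (intro mult_right_mono) auto
        also have "\<dots> = (4 * B * lam * S) ^ 3" by (simp add: power_mult_distrib)
        finally have "sq6 0 q ^ 3 \<le> (4 * B * lam * S) ^ 3" by (simp add: sq6_power)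
        thus ?thesis unfolding S_def[symmetric]
          by (subst (asm) power_mono_iff) (use B S lam1 in \<open>auto simp: sq6_nonneg\<close>)
      qed
      have "energy n 0 \<le> (\<Sum>q\<in>children n 0. 4 * B * lam * (\<Sum>\<xi>\<in>cell 0 q. norm (a \<xi>) ^ 2))"
        unfolding energy_def by (intro sum_mono small)
      also have "\<dots> = 4 * B * lam * A"
        using sum_cell_refine[of 0 n "\<lambda>\<xi>. norm (a \<xi>) ^ 2" 0]
        by (simp add: A_def cell sum_distrib_left[symmetric])
      finally have en: "energy n 0 \<le> 4 * B * lam * A" .
      have "2 powr (\<eta> * n) = (2 ^ n) powr \<eta>" by (simp add: powr_powr mult_ac flip: powr_realpow)
      also have "\<dots> \<le> (2 * (real \<kappa> * (M * sqrt M))) powr \<eta>"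
        using n \<epsilon> by (intro powr_mono2) (auto simp: \<eta>_def)
      also have "\<dots> = (2 * \<kappa>) powr \<eta> * M powr (2 * \<epsilon>)"
      proof -
        have "M * sqrt M = M powr (3 / 2)"
          using M by (simp add: powr_half_sqrt[symmetric] powr_mult_base)
        moreover have "2 * (real \<kappa> * (M * sqrt M)) = (2 * \<kappa>) * (M * sqrt M)" by simp
        ultimately show ?thesis by (simp add: powr_mult powr_powr \<eta>_def)
      qed
      finally have pw: "2 powr (\<eta> * n) \<le> (2 * \<kappa>) powr \<eta> * M powr (2 * \<epsilon>)" .
      have "sq6 n 0 \<le> K * 2 powr (\<eta> * n) * energy n 0"
        by (rule dec) (unfold_locales, use dl in auto)
      also have "\<dots> \<le> K * ((2 * \<kappa>) powr \<eta> * M powr (2 * \<epsilon>)) * (4 * B * lam * A)"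
        using K by (intro mult_mono en pw mult_nonneg_nonneg energy_nonneg) auto
      also have "\<dots> = (K * (2 * \<kappa>) powr \<eta> * (4 * B)) * M powr (2 * \<epsilon>) * (lam * A)" by (simp add: mult_ac)
      finally have "sq6 n 0 ^ 3 \<le> ((K * (2 * \<kappa>) powr \<eta> * (4 * B)) * M powr (2 * \<epsilon>) * (lam * A)) ^ 3"
        by (intro power_mono sq6_nonneg)
      also have "\<dots> = (K * (2 * \<kappa>) powr \<eta> * (4 * B)) ^ 3 * M powr (6 * \<epsilon>) * (lam * A) ^ 3"
        using M by (simp add: power_mult_distrib powr_power)
      also have "\<dots> \<le> C * M powr (6 * \<epsilon>) * (lam * A) ^ 3"
        using C A lam1 by (intro mult_right_mono) auto
      finally show ?thesis by (simp add: sq6_power cell A_def)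
    qed
  qed
qed

text \<open>On the dual lattice itself the Whitney decomposition loses nothing: the bilinear bounds of
  the separated pairs sum geometrically.\<close>

lemma L8_bound:
  assumes B: "1 \<le> B" and \<kappa>: "1 \<le> \<kappa>"
  shows "positive_moment B \<kappa> 8 4 (\<lambda>lam M. 1 + M\<^sup>2 / lam)"
proof -
  define r where "r = root 4 2"
  have r: "1 < r" "r ^ 4 = 2" by (simp_all add: r_def)
  define c where "c = 1 + 3 / (r - 1)\<^sup>2 + 1 / (r - 1)"
  have c: "1 \<le> c" using r by (simp add: c_def)
  define C where "C = c ^ 4 * (256 * B * (real \<kappa>)\<^sup>2)"
  have C: "0 < C" using c B \<kappa> by (simp add: C_def)
  show ?thesis
    unfolding positive_moment_def
  proof (intro exI[of _ C] conjI allI impI C)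
    fix \<mu> lam M F and a :: "real \<Rightarrow> complex"
    assume rm: "resonance_measure \<mu> lam" and lam1: "1 \<le> lam" and mass: "(\<integral>z. 1 \<partial>\<mu>) \<le> B * lam"
      and M: "0 < M" and F: "finite F" "F \<subseteq> dual_lattice lam" "F \<subseteq> {M..real \<kappa> * M}"
    \<comment> \<open>The lattice spacing itself, so the finest cells have boundedly many
      frequencies.\<close>
    define \<delta> where "\<delta> = 1 / lam"
    interpret resonance_measure \<mu> lam by fact
    interpret airy_data \<mu> lam M \<delta> \<kappa> F a
      by unfold_locales (use M lam1 \<kappa> F in \<open>auto simp: \<delta>_def\<close>)
    define A where "A = (\<Sum>\<xi>\<in>F. norm (a \<xi>) ^ 2)"
    have A: "0 \<le> A" by (simp add: A_def sum_nonneg)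
    show "(\<integral>z. norm (wave_sum a F z) ^ 8 \<partial>\<mu>) \<le> C * (1 + M\<^sup>2 / lam) * (lam * (\<Sum>\<xi>\<in>F. norm (a \<xi>) ^ 2)) ^ 4"
    proof (cases "F = {}")
      case True
      thus ?thesis by (simp add: wave_sum_def)
    next
      case False
      \<comment> \<open>A nonempty \<open>F\<close> forces lam \<kappa> M \<ge> 1; only then can 2^n
        be bounded by a multiple of it.\<close>
      hence "1 \<le> card F" using F by (simp add: Suc_le_eq card_gt_0_iff)
      hence "1 \<le> real (card F)" by simp
      also have "real (card F) \<le> lam * (\<kappa> * M)"
        using F M by (intro card_dual_lattice_pos_le lam) auto
      finally obtain n where n: "2 * (lam * (\<kappa> * M)) < 2 ^ n" "2 ^ n \<le> 4 * (lam * (\<kappa> * M))"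
        using ex_power2_between[of "2 * (lam * (\<kappa> * M))"] by auto
      have cell_n: "cell n 0 = F"
      proof -
        have "nat \<lfloor>\<xi> / \<delta>\<rfloor> < 2 ^ n" if "\<xi> \<in> F" for \<xi>
        proof -
          have "\<xi> / \<delta> = lam * \<xi>" by (simp add: \<delta>_def)
          also have "\<dots> \<le> lam * (\<kappa> * M)" using that F lam1 by (intro mult_left_mono) auto
          also have "\<dots> \<le> 2 * (lam * (\<kappa> * M))" using M lam1 by simp
          finally have "\<xi> / \<delta> < 2 ^ n" using n by linarith
          hence "\<lfloor>\<xi> / \<delta>\<rfloor> < 2 ^ n" by (simp add: floor_less_iff)
          thus ?thesis by (simp add: nat_less_iff)
        qed
        thus ?thesis by (auto simp: cell_def)
      qed
      have lat: "cell j i \<subseteq> dual_lattice lam" for j i using F cell_subset by blast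
      have card_cell: "real (card (cell j i)) \<le> 2 * 2 ^ j" for j i
      proof -
        have "real (card (cell j i)) \<le> lam * ((real i + 1) * (2 ^ j * \<delta>) - real i * (2 ^ j * \<delta>)) + 1"
          using cell_bounds[of _ j i] lam1
          by (intro card_dual_lattice_le lam lat) (auto simp: less_imp_le \<delta>_def intro!: mult_right_mono divide_right_mono)
        also have "\<dots> = lam * \<delta> * 2 ^ j + 1" by (simp add: algebra_simps)
        also have "\<dots> = 2 ^ j + 1" using lam1 by (simp add: \<delta>_def)
        also have "\<dots> \<le> 2 * 2 ^ j" by simp
        finally show ?thesis .
      qed
      define S where "S j i = (\<Sum>\<xi>\<in>cell j i. norm (a \<xi>) ^ 2)" for j i
      have S: "0 \<le> S j i" for j i by (simp add: S_def sum_nonneg)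
      \<comment> \<open>Bilinear bound at level j: 4^j from the two cardinalities times lam \<rho> +
        1, where separation by 2^j / lam makes \<rho> of order lam / (M 2^j).\<close>
      define G where "G j = 16 * B * lam * (2 ^ j * (lam\<^sup>2 / M) + 4 ^ j)" for j :: nat
      have G: "0 \<le> G j" for j using B lam1 M by (simp add: G_def)
      interpret whitney "Lnorm 4" "{g. continuous_on UNIV g}" piece S "\<lambda>j. root 4 (G j)"
      proof
        fix j i i' :: nat assume i: "i + 2 \<le> i'"
        hence gap: "gap2 i' i" "gap2 i i'" by (auto simp: gap2_def)
        define D where "D = 2 ^ j * \<delta>"
        have D: "0 < D" using lam1 by (simp add: D_def \<delta>_def)
        \<comment> \<open>Resonance bounds the product of \<xi> - \<xi>' with the quadratic form Q
          below by 1, and separation by D gives Q \<ge> 6 M D.\<close>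
        define \<rho> where "\<rho> = 1 / (6 * M * D)"
        have "(\<integral>z. norm (piece j i z * piece j i' z) ^ 4 \<partial>\<mu>)
          \<le> (2 * 2 ^ j) * (2 * 2 ^ j) * (2 * \<rho> * lam + 1) * mass * (S j i * S j i') ^ 2"
          unfolding S_def
        proof (rule bilinear_L4[OF finite_cell lat card_cell finite_cell lat card_cell])
          show "0 \<le> \<rho>" using M D by (simp add: \<rho>_def)
          fix \<xi> \<xi>' \<eta> \<eta>' assume cells: "\<xi> \<in> cell j i" "\<xi>' \<in> cell j i" "\<eta> \<in> cell j i'" "\<eta>' \<in> cell j i'"
            and res: "resonant ((curve \<xi> + curve \<eta>) - (curve \<xi>' + curve \<eta>'))"
          have pos: "M \<le> \<xi>" "M \<le> \<xi>'" using cells F cell_subset by force+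
          define x where "x = max \<xi> \<xi>'"
          have x: "M \<le> x" "\<xi> \<le> x" "\<xi>' \<le> x" using pos by (auto simp: x_def)
          have ge: "x + D \<le> \<eta>" "x + D \<le> \<eta>'"
          proof -
            have "(real i + 1) * D + D \<le> real i' * D"
            proof -
              have "(real i + 2) * D \<le> real i' * D" using i D by (intro mult_right_mono) auto
              thus ?thesis by (simp add: algebra_simps)
            qed
            thus "x + D \<le> \<eta>" "x + D \<le> \<eta>'"
              using cell_bounds[OF cells(1)] cell_bounds[OF cells(2)] cell_bounds[OF cells(3)] cell_bounds[OF cells(4)]
              by (auto simp: x_def D_def[symmetric])
          qed
          define Q where "Q = \<eta>\<^sup>2 + \<eta> * \<eta>' + \<eta>'\<^sup>2 - (\<xi>\<^sup>2 + \<xi> * \<xi>' + \<xi>'\<^sup>2)"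
          have "(x + D) * (x + D) \<le> \<eta> * \<eta>" "(x + D) * (x + D) \<le> \<eta> * \<eta>'" "(x + D) * (x + D) \<le> \<eta>' * \<eta>'"
            using ge x M D by (auto intro!: mult_mono)
          moreover have "\<xi> * \<xi> \<le> x * x" "\<xi> * \<xi>' \<le> x * x" "\<xi>' * \<xi>' \<le> x * x"
            using x pos M by (auto intro!: mult_mono)
          ultimately have "3 * ((x + D) * (x + D)) - 3 * (x * x) \<le> Q"
            unfolding Q_def power2_eq_square by linarith
          moreover have "3 * ((x + D) * (x + D)) - 3 * (x * x) = 6 * (x * D) + 3 * (D * D)" by (simp add: algebra_simps)
          moreover have "M * D \<le> x * D" "0 \<le> D * D" using x D by (auto intro: mult_right_mono)
          ultimately have Q: "6 * (M * D) \<le> Q" by linarith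
          have e1: "\<xi> + \<eta> = \<xi>' + \<eta>'" and e2: "\<bar>(\<xi>^3 + \<eta>^3) - (\<xi>'^3 + \<eta>'^3)\<bar> < 1"
            using res by (auto simp: resonant_def curve_def)
          have \<eta>: "\<eta> = \<xi>' + \<eta>' - \<xi>" using e1 by simp
          have "(\<xi>^3 + \<eta>^3) - (\<xi>'^3 + \<eta>'^3) = (\<xi>' - \<xi>) * Q"
            unfolding Q_def \<eta> by (simp add: algebra_simps power2_eq_square power3_eq_cube)
          hence "\<bar>\<xi> - \<xi>'\<bar> * \<bar>Q\<bar> < 1" using e2 by (simp add: abs_mult abs_minus_commute)
          moreover have "\<bar>\<xi> - \<xi>'\<bar> * (6 * (M * D)) \<le> \<bar>\<xi> - \<xi>'\<bar> * \<bar>Q\<bar>" using Q by (intro mult_left_mono) auto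
          ultimately have "\<bar>\<xi> - \<xi>'\<bar> * (6 * (M * D)) \<le> 1" by linarith
          thus "\<bar>\<xi> - \<xi>'\<bar> \<le> \<rho>" using M D by (simp add: \<rho>_def field_simps)
        qed
        also have "\<dots> \<le> (2 * 2 ^ j) * (2 * 2 ^ j) * (2 * \<rho> * lam + 1) * (B * lam) * (S j i * S j i') ^ 2"
          using mass M D lam1 by (intro mult_right_mono mult_left_mono) (auto simp: \<rho>_def)
        also have "\<dots> = (4 * B * lam * (2 ^ j * (lam\<^sup>2 / M) / 3 + 4 ^ j)) * (S j i * S j i') ^ 2"
        proof -
          have "(2 * 2 ^ j) * (2 * 2 ^ j) * (2 * \<rho> * lam + 1) = 4 * (2 ^ j * (lam\<^sup>2 / M) / 3 + 4 ^ j)"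
            using M lam1 by (simp add: \<rho>_def D_def \<delta>_def field_simps power2_eq_square flip: power_mult_distrib)
          thus ?thesis by (simp add: mult_ac)
        qed
        also have "\<dots> \<le> G j * (S j i * S j i') ^ 2"
        proof -
          have third: "x / 3 \<le> x" if "0 \<le> x" for x :: real using that by simp
          have "2 ^ j * (lam\<^sup>2 / M) / 3 \<le> 2 ^ j * (lam\<^sup>2 / M)" by (rule third) (use M in simp)
          thus ?thesis
            unfolding G_def using B M lam1 by (intro mult_right_mono mult_mono add_mono) auto
        qed
        also have "\<dots> = (root 4 (G j) * sqrt (S j i * S j i')) ^ 4"
        proof -
          have "sqrt (S j i * S j i') ^ 4 = (sqrt (S j i * S j i') ^ 2) ^ 2" by (simp flip: power_mult)
          also have "\<dots> = (S j i * S j i') ^ 2" using S by simp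
          finally show ?thesis using G by (simp add: power_mult_distrib)
        qed
        finally show "Lnorm 4 (\<lambda>z. piece j i z * piece j i' z) \<le> root 4 (G j) * sqrt (S j i * S j i')"
          using G S by (intro Lnorm_le) auto
      next
        show "S (Suc j) i = S j (2 * i) + S j (2 * i + 1)" for j i
          unfolding S_def using sum_cell_refine[of j "Suc j" "\<lambda>\<xi>. norm (a \<xi>) ^ 2" i] by (simp add: children_Suc_0)
      next
        show "(\<lambda>z. piece j i z * piece j i' z) \<in> {g. continuous_on UNIV g}" for j i i'
          unfolding mem_Collect_eq by (intro continuous_intros)
      next
        show "Lnorm 4 (\<lambda>z. g z + h z) \<le> Lnorm 4 g + Lnorm 4 h"
          if "g \<in> {g. continuous_on UNIV g}" "h \<in> {g. continuous_on UNIV g}" for g h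
          using that by (intro Lnorm_triangle) simp_all
      next
        show "(\<lambda>z. g z + h z) \<in> {g. continuous_on UNIV g}"
          if "g \<in> {g. continuous_on UNIV g}" "h \<in> {g. continuous_on UNIV g}" for g h :: "real \<times> real \<Rightarrow> complex"
          using that unfolding mem_Collect_eq by (intro continuous_intros)
      next
        show "0 \<le> root 4 (G j)" for j using G by simp
      qed (rule piece_split S)+
      define A0 where "A0 = root 4 (16 * B * lam)"
      have A0: "0 \<le> A0" "A0 ^ 4 = 16 * B * lam" using B lam1 by (simp_all add: A0_def)
      have base: "Lnorm 4 (\<lambda>z. piece 0 i z * piece 0 i' z) \<le> A0 * sqrt (S 0 i * S 0 i')" for i i'
      proof (rule Lnorm_le)
        let ?f = "\<lambda>z. norm (piece 0 i z) ^ 4" and ?g = "\<lambda>z. norm (piece 0 i' z) ^ 4"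
        have m8: "(\<integral>z. norm (piece 0 k z) ^ 8 \<partial>\<mu>) \<le> 8 * (B * lam) * S 0 k ^ 4" for k
        proof -
          have "(\<integral>z. norm (piece 0 k z) ^ (2 * 3 + 2) \<partial>\<mu>) \<le> 2 ^ 3 * mass * S 0 k ^ (3 + 1)"
            unfolding S_def using card_cell[of 0 k] by (intro moment_bound lat) auto
          also have "\<dots> \<le> 2 ^ 3 * (B * lam) * S 0 k ^ (3 + 1)"
            using mass S by (intro mult_right_mono mult_left_mono) auto
          finally show ?thesis by simp
        qed
        have "(\<integral>z. ?f z * ?g z \<partial>\<mu>)\<^sup>2 \<le> (\<integral>z. (?f z)\<^sup>2 \<partial>\<mu>) * (\<integral>z. (?g z)\<^sup>2 \<partial>\<mu>)"
          by (intro Cauchy_Schwarz_integral continuous_intros) auto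
        hence "(\<integral>z. norm (piece 0 i z * piece 0 i' z) ^ 4 \<partial>\<mu>)\<^sup>2
            \<le> (\<integral>z. norm (piece 0 i z) ^ 8 \<partial>\<mu>) * (\<integral>z. norm (piece 0 i' z) ^ 8 \<partial>\<mu>)"
          unfolding norm_mult power_mult_distrib power_mult[symmetric] by simp
        also have "\<dots> \<le> (8 * (B * lam) * S 0 i ^ 4) * (8 * (B * lam) * S 0 i' ^ 4)"
          using B lam1 S by (intro mult_mono m8 integral_norm_power_nonneg) auto
        also have "\<dots> = (8 * B * lam * (S 0 i * S 0 i') ^ 2)\<^sup>2"
          by (simp add: eval_nat_numeral algebra_simps)
        finally have "(\<integral>z. norm (piece 0 i z * piece 0 i' z) ^ 4 \<partial>\<mu>) \<le> 8 * B * lam * (S 0 i * S 0 i') ^ 2"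
          by (rule power2_le_imp_le) (use B lam1 in auto)
        also have "\<dots> \<le> 16 * B * lam * (S 0 i * S 0 i') ^ 2"
          using B lam1 by (intro mult_right_mono) auto
        also have "\<dots> = (A0 * sqrt (S 0 i * S 0 i')) ^ 4"
        proof -
          have "sqrt (S 0 i * S 0 i') ^ 4 = (sqrt (S 0 i * S 0 i') ^ 2) ^ 2" by (simp flip: power_mult)
          also have "\<dots> = (S 0 i * S 0 i') ^ 2" using S by simp
          finally show ?thesis by (simp add: power_mult_distrib A0)
        qed
        finally show "(\<integral>z. norm (piece 0 i z * piece 0 i' z) ^ 4 \<partial>\<mu>) \<le> (A0 * sqrt (S 0 i * S 0 i')) ^ 4" .
      qed (use A0 S in auto)
      \<comment> \<open>Since 4^j \<le> 2^n 2^j, the level bounds grow no faster than 2^j with this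
        common factor. The fourth root has ratio 2^(1/4) > 1, so the top level dominates.\<close>
      define K where "K = root 4 (16 * B * lam * (lam\<^sup>2 / M + 2 ^ n))"
      have K: "0 \<le> K" "K ^ 4 = 16 * B * lam * (lam\<^sup>2 / M + 2 ^ n)" using B lam1 M by (simp_all add: K_def)
      have "Lnorm 4 (\<lambda>z. piece n 0 z * piece n 0 z) \<le> c * K * r ^ n * S n 0"
        unfolding c_def
      proof (rule square[where ?A0.0 = A0])
        show "Lnorm 4 (\<lambda>z. piece 0 i z * piece 0 (i + 1) z) \<le> A0 * sqrt (S 0 i * S 0 (i + 1))" for i by (rule base)
        show "Lnorm 4 (\<lambda>z. piece 0 i z * piece 0 i z) \<le> A0 * S 0 i" for i using base[of i i] S by simp
        have "16 * B * lam * 1 \<le> 16 * B * lam * (lam\<^sup>2 / M + 2 ^ n)"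
          using B lam1 M by (intro mult_left_mono add_increasing) auto
        thus "A0 \<le> K" unfolding A0_def K_def by (intro real_root_le_mono) auto
        show "root 4 (G j) \<le> K * r ^ j" if "j < n" for j
        proof -
          have "(2::real) ^ j \<le> 2 ^ n" using that by (intro power_increasing) auto
          hence "(2::real) ^ j * 2 ^ j \<le> 2 ^ n * 2 ^ j" by (intro mult_right_mono) auto
          hence "2 ^ j * (lam\<^sup>2 / M) + 4 ^ j \<le> (lam\<^sup>2 / M + 2 ^ n) * 2 ^ j"
            by (simp add: algebra_simps flip: power_mult_distrib)
          hence "G j \<le> 16 * B * lam * ((lam\<^sup>2 / M + 2 ^ n) * 2 ^ j)"
            unfolding G_def using B lam1 by (intro mult_left_mono) auto
          also have "\<dots> = (K * r ^ j) ^ 4"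
          proof -
            have "(r ^ j) ^ 4 = 2 ^ j" using r by (metis mult.commute power_mult)
            thus ?thesis by (simp add: power_mult_distrib K)
          qed
          finally have "root 4 (G j) \<le> root 4 ((K * r ^ j) ^ 4)" by (intro real_root_le_mono) auto
          also have "\<dots> = K * r ^ j" using K r by (simp add: real_root_power_cancel)
          finally show ?thesis .
        qed
      qed (use A0 r in auto)
      hence "Lnorm 4 (\<lambda>z. piece n 0 z * piece n 0 z) ^ 4 \<le> (c * K * r ^ n * A) ^ 4"
        by (intro power_mono Lnorm_nonneg) (simp add: S_def cell_n A_def)
      hence "(\<integral>z. norm (wave_sum a F z) ^ 8 \<partial>\<mu>) \<le> (c * K * r ^ n * A) ^ 4"
        by (simp add: Lnorm_power cell_n norm_mult power_mult_distrib flip: power_add)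
      also have "\<dots> = c ^ 4 * (16 * B * lam * (lam\<^sup>2 / M + 2 ^ n)) * 2 ^ n * A ^ 4"
      proof -
        have "(r ^ n) ^ 4 = 2 ^ n" using r by (metis mult.commute power_mult)
        thus ?thesis by (simp add: power_mult_distrib K)
      qed
      also have "\<dots> \<le> c ^ 4 * (16 * B * lam * (lam\<^sup>2 / M + 4 * (lam * (\<kappa> * M)))) * (4 * (lam * (\<kappa> * M))) * A ^ 4"
        using B lam1 M c by (intro mult_right_mono mult_mono mult_left_mono add_left_mono n(2)) auto
      also have "\<dots> = c ^ 4 * (64 * B * \<kappa> * lam ^ 4 + 256 * B * (real \<kappa>)\<^sup>2 * (lam ^ 3 * M\<^sup>2)) * A ^ 4"
        using M by (simp add: eval_nat_numeral field_simps)
      also have "\<dots> \<le> c ^ 4 * (256 * B * (real \<kappa>)\<^sup>2 * lam ^ 4 + 256 * B * (real \<kappa>)\<^sup>2 * (lam ^ 3 * M\<^sup>2)) * A ^ 4"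
      proof -
        have "64 * B * real \<kappa> \<le> 256 * B * (real \<kappa>)\<^sup>2"
          using B \<kappa> self_le_power[of "real \<kappa>" 2] by (intro mult_mono) auto
        thus ?thesis using lam1 c by (intro mult_right_mono mult_left_mono add_right_mono) auto
      qed
      also have "\<dots> = C * (1 + M\<^sup>2 / lam) * (lam * A) ^ 4"
        using lam1 by (simp add: C_def eval_nat_numeral field_simps)
      finally show ?thesis by (simp add: A_def)
    qed
  qed
qed

section \<open>Frequency shells and Bessel's inequality\<close>

lemma finite_dual_lattice_bounded:
  assumes "0 < lam"
  shows "finite {\<xi> \<in> dual_lattice lam. \<bar>\<xi>\<bar> \<le> X}"
proof (rule finite_subset)
  show "{\<xi> \<in> dual_lattice lam. \<bar>\<xi>\<bar> \<le> X} \<subseteq> (\<lambda>k::int. real_of_int k / lam) ` {- \<lceil>lam * X\<rceil>..\<lceil>lam * X\<rceil>}"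
  proof
    fix \<xi> assume "\<xi> \<in> {\<xi> \<in> dual_lattice lam. \<bar>\<xi>\<bar> \<le> X}"
    hence "\<bar>\<xi>\<bar> \<le> X" and "\<xi> \<in> dual_lattice lam" by auto
    from this(2) obtain k :: int where k: "\<xi> = real_of_int k / lam" unfolding dual_lattice_def by blast
    have "\<bar>real_of_int k\<bar> / lam \<le> X" using \<open>\<bar>\<xi>\<bar> \<le> X\<close> assms by (simp add: k abs_divide)
    hence "\<bar>real_of_int k\<bar> \<le> lam * X" using assms by (simp add: field_simps)
    hence "- \<lceil>lam * X\<rceil> \<le> k" "k \<le> \<lceil>lam * X\<rceil>" by linarith+
    thus "\<xi> \<in> (\<lambda>k::int. real_of_int k / lam) ` {- \<lceil>lam * X\<rceil>..\<lceil>lam * X\<rceil>}" using k by auto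
  qed
qed simp

lemma uminus_dual_lattice: "\<xi> \<in> dual_lattice lam \<Longrightarrow> - \<xi> \<in> dual_lattice lam"
proof -
  assume "\<xi> \<in> dual_lattice lam"
  then obtain k :: int where "\<xi> = real_of_int k / lam" by (auto simp: dual_lattice_def)
  hence "- \<xi> = real_of_int (- k) / lam" by simp
  thus ?thesis unfolding dual_lattice_def by blast
qed

lemma airy_flow_eq_wave_sum:
  assumes lam: "0 < lam" and supp: "fourier_supported lam \<phi> S" and S: "\<And>\<xi>. \<xi> \<in> S \<Longrightarrow> \<bar>\<xi>\<bar> \<le> X"
  shows "airy_flow lam t \<phi> x = wave_sum (\<lambda>\<xi>. torus_fourier lam \<phi> \<xi> / lam) (dual_lattice lam \<inter> S) (t, x)"
proof -
  let ?h = "\<lambda>\<xi>. cis (2 * pi * (\<xi> ^ 3 * t + \<xi> * x)) * torus_fourier lam \<phi> \<xi>"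
  have fin: "finite (dual_lattice lam \<inter> S)"
    by (rule finite_subset[OF _ finite_dual_lattice_bounded[OF lam, of X]]) (use S in auto)
  have "(\<Sum>\<^sub>\<infinity>\<xi>\<in>dual_lattice lam. ?h \<xi>) = (\<Sum>\<^sub>\<infinity>\<xi>\<in>dual_lattice lam \<inter> S. ?h \<xi>)"
    by (intro infsum_cong_neutral) (use supp in \<open>auto simp: fourier_supported_def\<close>)
  also have "\<dots> = (\<Sum>\<xi>\<in>dual_lattice lam \<inter> S. ?h \<xi>)" using fin by (rule infsum_finite)
  finally show ?thesis
    by (simp add: airy_flow_def dual_integral_def wave_sum_def char_def curve_def inner_prod_def
        scaleR_conv_of_real sum_distrib_left mult_ac)
qed

lemma integral_lebesgue_on_Icc:
  fixes g :: "real \<Rightarrow> complex"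
  assumes "continuous_on UNIV g"
  shows "integrable (lebesgue_on {a..b}) g"
    and "(\<integral>x. g x \<partial>lebesgue_on {a..b}) = (\<integral>x. indicator {a..b} x *\<^sub>R g x \<partial>lborel)"
proof -
  have g: "g \<in> borel_measurable borel" by (rule borel_measurable_continuous_onI[OF assms])
  have m: "(\<lambda>x. indicator {a..b} x *\<^sub>R g x) \<in> borel_measurable lborel" using g by simp
  have i: "integrable lborel (\<lambda>x. indicator {a..b} x *\<^sub>R g x)"
    by (intro borel_integrable_compact compact_Icc continuous_on_subset[OF assms]) auto
  show "integrable (lebesgue_on {a..b}) g"
    by (subst integrable_restrict_space) (use i m in \<open>auto simp: integrable_completion\<close>)
  show "(\<integral>x. g x \<partial>lebesgue_on {a..b}) = (\<integral>x. indicator {a..b} x *\<^sub>R g x \<partial>lborel)"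
    by (subst integral_restrict_space) (use m in \<open>auto simp: integral_completion\<close>)
qed

lemma Lp_norm_2_eq_1:
  assumes "Lp_norm 2 M \<phi> = 1" and \<phi>: "\<phi> \<in> borel_measurable M"
  shows "integrable M (\<lambda>x. (norm (\<phi> x))\<^sup>2)" "(\<integral>x. (norm (\<phi> x))\<^sup>2 \<partial>M) = 1"
proof -
  define I where "I = (\<integral>\<^sup>+ x. ennreal (norm (\<phi> x) powr 2) \<partial>M)"
  have "(if I = \<infinity> then \<infinity> else ennreal (enn2real I powr (1 / 2))) = 1"
    using assms(1) unfolding Lp_norm_def Let_def I_def .
  hence I: "I \<noteq> \<infinity>" "ennreal (enn2real I powr (1 / 2)) = 1" by (auto split: if_splits)
  hence "sqrt (enn2real I) = 1" by (simp add: powr_half_sqrt ennreal_eq_1)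
  hence "enn2real I = 1" by simp
  hence "I = 1" using I by (metis ennreal_1 ennreal_enn2real infinity_ennreal_def less_top)
  hence nn: "(\<integral>\<^sup>+ x. ennreal ((norm (\<phi> x))\<^sup>2) \<partial>M) = ennreal 1" by (simp add: I_def)
  show int: "integrable M (\<lambda>x. (norm (\<phi> x))\<^sup>2)"
    by (intro integrableI_nonneg) (use nn \<phi> in auto)
  show "(\<integral>x. (norm (\<phi> x))\<^sup>2 \<partial>M) = 1"
    using nn by (subst integral_eq_nn_integral) (use \<phi> in auto)
qed

text \<open>Pair \<phi> with the partial Fourier sum s with unnormalised coefficients. The pairing
  equals the sum X to be bounded, while the squared norm of s is lam X.\<close>

lemma Bessel_torus:
  assumes lam: "0 < lam" and \<phi>: "torus_fun lam \<phi>" "Lp_norm 2 (lebesgue_on {0..lam}) \<phi> = 1"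
    and F: "finite F" "F \<subseteq> dual_lattice lam"
  shows "(\<Sum>\<xi>\<in>F. (norm (torus_fourier lam \<phi> \<xi>))\<^sup>2) \<le> lam"
proof -
  define M where "M = lebesgue_on {0..lam}"
  interpret M: finite_measure M
    by (rule finite_measureI) (use lam in \<open>simp add: M_def emeasure_restrict_space\<close>)
  have m: "\<phi> \<in> borel_measurable M" unfolding M_def using \<phi>(1) by (auto simp: torus_fun_def intro: measurable_restrict_space1)
  note sq = Lp_norm_2_eq_1[OF \<phi>(2)[folded M_def] m]
  define f where "f \<xi> = torus_fourier lam \<phi> \<xi>" for \<xi>
  define e where "e \<xi> x = cis (2 * pi * \<xi> * x)" for \<xi> x :: real
  define s where "s x = (\<Sum>\<xi>\<in>F. f \<xi> * e \<xi> x)" for x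
  define X where "X = (\<Sum>\<xi>\<in>F. (norm (f \<xi>))\<^sup>2)"
  have ce: "continuous_on UNIV (e \<xi>)" for \<xi> unfolding e_def[abs_def] by (intro continuous_intros)
  have cs: "continuous_on UNIV s" unfolding s_def[abs_def] by (intro continuous_intros ce)
  have int\<phi>: "integrable M \<phi>"
  proof (rule Bochner_Integration.integrable_bound[OF _ m])
    show "integrable M (\<lambda>x. 1 + (norm (\<phi> x))\<^sup>2)" using sq by simp
    have "norm (\<phi> x) \<le> 1 + (norm (\<phi> x))\<^sup>2" for x
    proof -
      have "2 * norm (\<phi> x) \<le> (norm (\<phi> x))\<^sup>2 + 1" using sum_squares_bound[of "norm (\<phi> x)" 1] by simp
      moreover have "0 \<le> norm (\<phi> x)" by simp
      ultimately show ?thesis by linarith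
    qed
    thus "AE x in M. norm (\<phi> x) \<le> norm (1 + (norm (\<phi> x))\<^sup>2)" by (intro AE_I2) simp
  qed
  have me: "(\<lambda>x. cnj (e \<xi> x)) \<in> borel_measurable M" for \<xi>
    unfolding M_def by (intro borel_measurable_integrable integral_lebesgue_on_Icc(1) continuous_intros ce)
  have int\<phi>e: "integrable M (\<lambda>x. \<phi> x * cnj (e \<xi> x))" for \<xi>
  proof (rule Bochner_Integration.integrable_bound[OF int\<phi>])
    show "(\<lambda>x. \<phi> x * cnj (e \<xi> x)) \<in> borel_measurable M" by (rule borel_measurable_times[OF m me])
  qed (simp add: norm_mult e_def)
  have coef: "(\<integral>x. \<phi> x * cnj (e \<xi> x) \<partial>M) = f \<xi>" for \<xi>
  proof -
    have "\<phi> x * cnj (e \<xi> x) = cis (- 2 * pi * \<xi> * x) * \<phi> x" for x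
      by (simp add: e_def cis_cnj)
    thus ?thesis by (simp only: f_def torus_fourier_def M_def)
  qed
  have ee: "(\<integral>x. e \<xi> x * cnj (e \<zeta> x) \<partial>M) = (if \<zeta> = \<xi> then of_real lam else 0)" if "\<xi> \<in> F" "\<zeta> \<in> F" for \<xi> \<zeta>
  proof -
    have "e \<xi> x * cnj (e \<zeta> x) = cis (2 * pi * ((\<xi> - \<zeta>) * x))" for x
      by (simp add: e_def cis_cnj cis_mult right_diff_distrib left_diff_distrib mult.assoc)
    hence "(\<integral>x. e \<xi> x * cnj (e \<zeta> x) \<partial>M) = (\<integral>x. cis (2 * pi * ((\<xi> - \<zeta>) * x)) \<partial>M)" by simp
    also have "\<dots> = (\<integral>x. indicator {0..lam} x *\<^sub>R cis (2 * pi * ((\<xi> - \<zeta>) * x)) \<partial>lborel)"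
      unfolding M_def by (intro integral_lebesgue_on_Icc(2) continuous_intros)
    also have "\<dots> = (if \<zeta> = \<xi> then of_real lam else 0)"
    proof (cases "\<zeta> = \<xi>")
      case True thus ?thesis using lam by (simp add: scaleR_conv_of_real)
    next
      case False
      have "\<xi> * lam \<in> \<int>" "\<zeta> * lam \<in> \<int>" using F that lam curve_in_grid[of _ lam] by (auto simp: grid_def curve_def)
      hence "(\<xi> - \<zeta>) * (lam - 0) \<in> \<int>" by (simp add: left_diff_distrib)
      hence "(\<integral>x. indicator {0..lam} x *\<^sub>R cis (2 * pi * ((\<xi> - \<zeta>) * x)) \<partial>lborel) = 0"
        using False lam by (intro cis_integral_zero) simp_all
      thus ?thesis using False by simp
    qed
    finally show ?thesis .
  qed
  have iee: "integrable M (\<lambda>x. e \<xi> x * cnj (e \<zeta> x))" for \<xi> \<zeta>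
    unfolding M_def by (intro integral_lebesgue_on_Icc continuous_intros ce)
  have ss: "(\<integral>x. (norm (s x))\<^sup>2 \<partial>M) = lam * X"
  proof -
    have "complex_of_real (\<integral>x. (norm (s x))\<^sup>2 \<partial>M) = (\<integral>x. s x * cnj (s x) \<partial>M)"
      by (simp add: complex_norm_square del: of_real_power flip: integral_complex_of_real)
    also have "\<dots> = (\<integral>x. (\<Sum>\<xi>\<in>F. \<Sum>\<zeta>\<in>F. (f \<xi> * cnj (f \<zeta>)) * (e \<xi> x * cnj (e \<zeta> x))) \<partial>M)"
      by (simp add: s_def sum_product mult_ac)
    also have "\<dots> = (\<Sum>\<xi>\<in>F. \<integral>x. (\<Sum>\<zeta>\<in>F. (f \<xi> * cnj (f \<zeta>)) * (e \<xi> x * cnj (e \<zeta> x))) \<partial>M)"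
      by (intro Bochner_Integration.integral_sum Bochner_Integration.integrable_sum integrable_mult_right iee)
    also have "\<dots> = (\<Sum>\<xi>\<in>F. \<Sum>\<zeta>\<in>F. (f \<xi> * cnj (f \<zeta>)) * (\<integral>x. e \<xi> x * cnj (e \<zeta> x) \<partial>M))"
      by (intro sum.cong refl) (subst Bochner_Integration.integral_sum, auto intro!: integrable_mult_right iee)
    also have "\<dots> = (\<Sum>\<xi>\<in>F. (f \<xi> * cnj (f \<xi>)) * of_real lam)"
    proof (intro sum.cong refl)
      fix \<xi> assume \<xi>: "\<xi> \<in> F"
      have "(\<Sum>\<zeta>\<in>F. (f \<xi> * cnj (f \<zeta>)) * (\<integral>x. e \<xi> x * cnj (e \<zeta> x) \<partial>M))
          = (\<Sum>\<zeta>\<in>F. if \<zeta> = \<xi> then (f \<xi> * cnj (f \<zeta>)) * of_real lam else 0)"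
        by (intro sum.cong refl) (simp add: ee \<xi>)
      thus "(\<Sum>\<zeta>\<in>F. (f \<xi> * cnj (f \<zeta>)) * (\<integral>x. e \<xi> x * cnj (e \<zeta> x) \<partial>M)) = (f \<xi> * cnj (f \<xi>)) * of_real lam"
        using F \<xi> by (simp add: sum.delta)
    qed
    also have "\<dots> = complex_of_real (lam * X)"
      by (simp add: X_def complex_norm_square[symmetric] sum_distrib_left mult.commute)
    finally show ?thesis by (simp only: of_real_eq_iff)
  qed
  have iss: "integrable M (\<lambda>x. (norm (s x))\<^sup>2)"
  proof -
    have "integrable M (\<lambda>x. Re (complex_of_real ((norm (s x))\<^sup>2)))"
      unfolding M_def by (intro integrable_Re integral_lebesgue_on_Icc continuous_intros cs)
    thus ?thesis by simp
  qed
  have i\<phi>s: "integrable M (\<lambda>x. \<phi> x * cnj (s x))"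
  proof -
    have "integrable M (\<lambda>x. \<Sum>\<xi>\<in>F. cnj (f \<xi>) * (\<phi> x * cnj (e \<xi> x)))"
      by (intro Bochner_Integration.integrable_sum integrable_mult_right int\<phi>e)
    thus ?thesis by (simp add: s_def sum_distrib_left mult_ac)
  qed
  have "(\<integral>x. \<phi> x * cnj (s x) \<partial>M) = (\<integral>x. (\<Sum>\<xi>\<in>F. cnj (f \<xi>) * (\<phi> x * cnj (e \<xi> x))) \<partial>M)"
    by (simp add: s_def sum_distrib_left mult_ac)
  also have "\<dots> = (\<Sum>\<xi>\<in>F. cnj (f \<xi>) * f \<xi>)"
    by (subst Bochner_Integration.integral_sum) (auto intro!: integrable_mult_right int\<phi>e simp: coef)
  also have "\<dots> = of_real X" by (simp add: X_def complex_norm_square mult.commute del: of_real_power)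
  finally have "X = Re (\<integral>x. \<phi> x * cnj (s x) \<partial>M)" by simp
  also have "\<dots> = (\<integral>x. Re (\<phi> x * cnj (s x)) \<partial>M)" by (rule integral_Re[OF i\<phi>s, symmetric])
  \<comment> \<open>The weights are chosen so that the term in s integrates to X/2 and can be
    absorbed on the left.\<close>
  also have "\<dots> \<le> (\<integral>x. lam / 2 * (norm (\<phi> x))\<^sup>2 + 1 / (2 * lam) * (norm (s x))\<^sup>2 \<partial>M)"
  proof (intro integral_mono)
    fix x
    have "Re (\<phi> x * cnj (s x)) \<le> norm (\<phi> x) * norm (s x)"
      by (metis complex_Re_le_cmod complex_mod_cnj norm_mult)
    also have "\<dots> = (lam * norm (\<phi> x)) * norm (s x) / lam" using lam by simp
    also have "\<dots> \<le> ((lam * norm (\<phi> x))\<^sup>2 + (norm (s x))\<^sup>2) / 2 / lam"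
      using sum_squares_bound[of "lam * norm (\<phi> x)" "norm (s x)"] lam by (intro divide_right_mono) auto
    also have "\<dots> = lam / 2 * (norm (\<phi> x))\<^sup>2 + 1 / (2 * lam) * (norm (s x))\<^sup>2"
      using lam by (simp add: field_simps power2_eq_square)
    finally show "Re (\<phi> x * cnj (s x)) \<le> lam / 2 * (norm (\<phi> x))\<^sup>2 + 1 / (2 * lam) * (norm (s x))\<^sup>2" .
  next
    show "integrable M (\<lambda>x. Re (\<phi> x * cnj (s x)))" by (rule integrable_Re[OF i\<phi>s])
  qed (use iss sq in simp)
  also have "\<dots> = lam / 2 + X / 2"
    using iss sq lam by (subst Bochner_Integration.integral_add) (auto simp: ss)
  finally show ?thesis by (simp add: X_def f_def)
qed

lemma wave_sum_uminus:
  assumes "finite G"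
  shows "wave_sum a G z = cnj (wave_sum (\<lambda>\<xi>. cnj (a (- \<xi>))) (uminus ` G) z)"
proof -
  have "cnj (char (curve (- \<xi>)) z) = char (curve \<xi>) z" for \<xi>
    by (simp add: curve_def flip: char_uminus)
  thus ?thesis by (simp add: wave_sum_def sum.reindex)
qed

context resonance_measure
begin

text \<open>Conjugation reflects frequencies, so moments need only be bounded for positive frequencies.\<close>

lemma shell_moment:
  assumes pos: "\<And>F a. finite F \<Longrightarrow> F \<subseteq> dual_lattice lam \<Longrightarrow> F \<subseteq> {M..K} \<Longrightarrow>
      (\<integral>z. norm (wave_sum a F z) ^ p \<partial>\<mu>) \<le> X * (\<Sum>\<xi>\<in>F. norm (a \<xi>) ^ 2) ^ q"
    and X: "0 \<le> X" and p: "0 < p" and M: "0 < M"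
    and F: "finite F" "F \<subseteq> dual_lattice lam" "\<And>\<xi>. \<xi> \<in> F \<Longrightarrow> M \<le> \<bar>\<xi>\<bar> \<and> \<bar>\<xi>\<bar> \<le> K"
  shows "(\<integral>z. norm (wave_sum a F z) ^ p \<partial>\<mu>) \<le> 2 * 2 ^ p * X * (\<Sum>\<xi>\<in>F. norm (a \<xi>) ^ 2) ^ q"
proof -
  define P Q where "P = {\<xi> \<in> F. 0 < \<xi>}" and "Q = {\<xi> \<in> F. \<xi> < 0}"
  define b where "b \<xi> = cnj (a (- \<xi>))" for \<xi>
  define A where "A = (\<Sum>\<xi>\<in>F. norm (a \<xi>) ^ 2)"
  have "\<xi> \<noteq> 0" if "\<xi> \<in> F" for \<xi> using F(3)[OF that] M by auto
  hence PQ: "finite P" "finite Q" "F = P \<union> Q" "P \<inter> Q = {}"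
    using F(1) by (auto simp: P_def Q_def linorder_neq_iff)
  have rng: "P \<subseteq> {M..K}" "uminus ` Q \<subseteq> {M..K}"
  proof -
    show "P \<subseteq> {M..K}"
    proof
      fix \<xi> assume "\<xi> \<in> P"
      hence "\<xi> \<in> F" "0 < \<xi>" by (auto simp: P_def)
      thus "\<xi> \<in> {M..K}" using F(3)[of \<xi>] by simp
    qed
    show "uminus ` Q \<subseteq> {M..K}"
    proof
      fix x assume "x \<in> uminus ` Q"
      then obtain \<xi> where "x = - \<xi>" "\<xi> \<in> F" "\<xi> < 0" by (auto simp: Q_def)
      thus "x \<in> {M..K}" using F(3)[of \<xi>] by simp
    qed
  qed
  have split: "wave_sum a F z = wave_sum a P z + wave_sum a Q z" for z
    unfolding wave_sum_def PQ(3) using PQ by (intro sum.union_disjoint)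
  have A: "(\<Sum>\<xi>\<in>P. norm (a \<xi>) ^ 2) \<le> A" "(\<Sum>\<xi>\<in>Q. norm (a \<xi>) ^ 2) \<le> A"
    unfolding A_def using F(1) by (auto intro!: sum_mono2 simp: P_def Q_def)
  have Pb: "(\<integral>z. norm (wave_sum a P z) ^ p \<partial>\<mu>) \<le> X * A ^ q"
  proof -
    have "(\<integral>z. norm (wave_sum a P z) ^ p \<partial>\<mu>) \<le> X * (\<Sum>\<xi>\<in>P. norm (a \<xi>) ^ 2) ^ q"
      by (rule pos[OF PQ(1) _ rng(1)]) (use F(2) in \<open>auto simp: P_def\<close>)
    also have "\<dots> \<le> X * A ^ q" using A X by (intro mult_left_mono power_mono) (auto simp: sum_nonneg)
    finally show ?thesis .
  qed
  have Qb: "(\<integral>z. norm (wave_sum a Q z) ^ p \<partial>\<mu>) \<le> X * A ^ q"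
  proof -
    have "(\<integral>z. norm (wave_sum a Q z) ^ p \<partial>\<mu>) = (\<integral>z. norm (wave_sum b (uminus ` Q) z) ^ p \<partial>\<mu>)"
      by (simp add: wave_sum_uminus[OF PQ(2)] b_def[abs_def])
    also have "\<dots> \<le> X * (\<Sum>\<xi>\<in>uminus ` Q. norm (b \<xi>) ^ 2) ^ q"
    proof (rule pos[OF _ _ rng(2)])
      show "uminus ` Q \<subseteq> dual_lattice lam" using F(2) by (auto simp: Q_def intro: uminus_dual_lattice)
    qed (use PQ in simp)
    also have "(\<Sum>\<xi>\<in>uminus ` Q. norm (b \<xi>) ^ 2) = (\<Sum>\<xi>\<in>Q. norm (a \<xi>) ^ 2)"
      by (simp add: sum.reindex b_def)
    also have "X * \<dots> ^ q \<le> X * A ^ q" using A X by (intro mult_left_mono power_mono) (auto simp: sum_nonneg)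
    finally show ?thesis .
  qed
  have "norm (wave_sum a F z) ^ p \<le> 2 ^ p * (norm (wave_sum a P z) ^ p + norm (wave_sum a Q z) ^ p)" for z
  proof -
    let ?x = "norm (wave_sum a P z)" and ?y = "norm (wave_sum a Q z)"
    have "norm (wave_sum a F z) ^ p \<le> (2 * max ?x ?y) ^ p"
      using norm_triangle_ineq[of "wave_sum a P z" "wave_sum a Q z"] by (intro power_mono) (auto simp: split)
    also have "max ?x ?y ^ p \<le> ?x ^ p + ?y ^ p" by (auto simp: max_def)
    hence "(2 * max ?x ?y) ^ p \<le> 2 ^ p * (?x ^ p + ?y ^ p)" by (simp add: power_mult_distrib)
    finally show ?thesis .
  qed
  hence "(\<integral>z. norm (wave_sum a F z) ^ p \<partial>\<mu>) \<le> (\<integral>z. 2 ^ p * (norm (wave_sum a P z) ^ p + norm (wave_sum a Q z) ^ p) \<partial>\<mu>)"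
    by (intro integral_mono_real continuous_intros)
  also have "\<dots> = 2 ^ p * ((\<integral>z. norm (wave_sum a P z) ^ p \<partial>\<mu>) + (\<integral>z. norm (wave_sum a Q z) ^ p \<partial>\<mu>))"
    by (simp, subst Bochner_Integration.integral_add) (auto intro!: integrable_real continuous_intros)
  also have "\<dots> \<le> 2 ^ p * (X * A ^ q + X * A ^ q)" by (intro mult_left_mono add_mono Pb Qb) auto
  finally show ?thesis by (simp add: A_def mult_ac)
qed

end

lemma card_shell_le:
  assumes lam: "0 < lam" and F: "finite F" "F \<subseteq> dual_lattice lam" "F \<subseteq> freq_shell c0 C0 M"
    and M: "0 < M" "0 < c0" "0 < C0"
  shows "real (card F) \<le> 2 * C0 * M * lam"
proof -
  define P N where "P = {\<xi> \<in> F. 0 < \<xi>}" and "N = {\<xi> \<in> F. \<xi> < 0}"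
  define Q where "Q = uminus ` N"
  have sh: "c0 * M \<le> \<bar>\<xi>\<bar>" "\<bar>\<xi>\<bar> \<le> C0 * M" if "\<xi> \<in> F" for \<xi>
    using F(3) that by (auto simp: freq_shell_def)
  have "0 < c0 * M" using M by simp
  hence "\<xi> \<noteq> 0" if "\<xi> \<in> F" for \<xi> using sh(1)[OF that] by auto
  hence "F = P \<union> N" by (auto simp: P_def N_def linorder_neq_iff)
  hence "card F \<le> card P + card N" using card_Un_le[of P N] by simp
  also have "card N = card Q" unfolding Q_def by (rule card_image[symmetric]) simp
  finally have "real (card F) \<le> real (card P) + real (card Q)" by linarith
  also have "\<dots> \<le> lam * (C0 * M) + lam * (C0 * M)"
  proof (rule add_mono)
    have X: "0 \<le> C0 * M" using M by simp
    show "real (card P) \<le> lam * (C0 * M)"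
    proof (rule card_dual_lattice_pos_le[OF lam _ _ _ X])
      show "P \<subseteq> {0<..C0 * M}"
      proof
        fix \<xi> assume "\<xi> \<in> P"
        thus "\<xi> \<in> {0<..C0 * M}" using sh(2)[of \<xi>] by (simp add: P_def)
      qed
    qed (use F(1,2) in \<open>auto simp: P_def\<close>)
    show "real (card Q) \<le> lam * (C0 * M)"
    proof (rule card_dual_lattice_pos_le[OF lam _ _ _ X])
      show "Q \<subseteq> {0<..C0 * M}"
      proof
        fix x assume "x \<in> Q"
        then obtain \<xi> where "x = - \<xi>" "\<xi> \<in> F" "\<xi> < 0" by (auto simp: Q_def N_def)
        thus "x \<in> {0<..C0 * M}" using sh(2)[of \<xi>] by simp
      qed
      show "Q \<subseteq> dual_lattice lam"
        using F(2) by (auto simp: Q_def N_def intro: uminus_dual_lattice)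
      show "finite Q" using F(1) by (simp add: Q_def N_def)
    qed
  qed
  finally show ?thesis by (simp add: mult_ac)
qed

text \<open>All that the estimates retain of a torus function: its frequencies, and norm at most 1
  by Bessel's inequality.\<close>

definition shell_coeffs :: "real \<Rightarrow> real \<Rightarrow> real \<Rightarrow> real \<Rightarrow> real set \<Rightarrow> (real \<Rightarrow> complex) \<Rightarrow> bool" where
  "shell_coeffs c0 C0 lam N F a \<longleftrightarrow> finite F \<and> F \<subseteq> dual_lattice lam \<and> F \<subseteq> freq_shell c0 C0 N \<and>
    lam * (\<Sum>\<xi>\<in>F. norm (a \<xi>) ^ 2) \<le> 1"

lemma shell_coeffsD:
  assumes "shell_coeffs c0 C0 lam N F a"
  shows "finite F" "F \<subseteq> dual_lattice lam" "F \<subseteq> freq_shell c0 C0 N" "lam * (\<Sum>\<xi>\<in>F. norm (a \<xi>) ^ 2) \<le> 1"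
  using assms by (simp_all add: shell_coeffs_def)

text \<open>A shell with arbitrary constants is a two-sided range from c0 N to \<kappa> c0 N with an
  integer \<kappa> \<ge> C0 / c0; 32 is the mass constant of the Fejer measure.\<close>

lemma shell_bound:
  assumes c: "0 < c0" "c0 < C0" and p: "0 < p" and w: "\<And>lam M. 1 \<le> lam \<Longrightarrow> 0 < M \<Longrightarrow> 0 \<le> w lam M"
    and moment: "\<And>\<kappa>. 1 \<le> \<kappa> \<Longrightarrow> positive_moment 32 \<kappa> p q w"
  shows "\<exists>C>0. \<forall>lam N F a. 1 \<le> lam \<longrightarrow> 0 < N \<longrightarrow> shell_coeffs c0 C0 lam N F a \<longrightarrow>
    (\<integral>z. norm (wave_sum a F z) ^ p \<partial>fejer_measure lam) \<le> C * w lam (c0 * N)"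
proof -
  obtain \<kappa> :: nat where \<kappa>: "C0 / c0 \<le> real \<kappa>" using real_arch_simple by blast
  have "1 \<le> C0 / c0" using c by simp
  hence \<kappa>1: "1 \<le> \<kappa>" using \<kappa> by linarith
  have C0: "C0 \<le> \<kappa> * c0" using \<kappa> c by (simp add: field_simps)
  obtain C where C: "C > 0" and bound: "\<And>\<mu> lam M F a. resonance_measure \<mu> lam \<Longrightarrow> 1 \<le> lam \<Longrightarrow> (\<integral>z. 1 \<partial>\<mu>) \<le> 32 * lam \<Longrightarrow> 0 < M \<Longrightarrow>
    finite F \<Longrightarrow> F \<subseteq> dual_lattice lam \<Longrightarrow> F \<subseteq> {M..real \<kappa> * M} \<Longrightarrow>
    (\<integral>z. norm (wave_sum a F z) ^ p \<partial>\<mu>) \<le> C * w lam M * (lam * (\<Sum>\<xi>\<in>F. norm (a \<xi>) ^ 2)) ^ q"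
    using moment[OF \<kappa>1] unfolding positive_moment_def by (elim exE conjE) simp
  show ?thesis
  proof (intro exI[of _ "2 * 2 ^ p * C"] conjI allI impI)
    fix lam N F and a :: "real \<Rightarrow> complex"
    assume lam1: "1 \<le> lam" and N: "0 < N" and "shell_coeffs c0 C0 lam N F a"
    note F = shell_coeffsD[OF this(3)]
    interpret resonance_measure "fejer_measure lam" lam by (rule resonance_measure_fejer[OF lam1])
    have w0: "0 \<le> w lam (c0 * N)" using w lam1 c N by simp
    define X where "X = C * w lam (c0 * N) * lam ^ q"
    have X: "0 \<le> X" using C lam1 w0 by (simp add: X_def)
    have "(\<integral>z. norm (wave_sum a F z) ^ p \<partial>fejer_measure lam) \<le> 2 * 2 ^ p * X * (\<Sum>\<xi>\<in>F. norm (a \<xi>) ^ 2) ^ q"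
    proof (rule shell_moment[where M = "c0 * N" and K = "real \<kappa> * (c0 * N)"])
      fix F' and a' :: "real \<Rightarrow> complex"
      assume "finite F'" "F' \<subseteq> dual_lattice lam" "F' \<subseteq> {c0 * N..real \<kappa> * (c0 * N)}"
      thus "(\<integral>z. norm (wave_sum a' F' z) ^ p \<partial>fejer_measure lam) \<le> X * (\<Sum>\<xi>\<in>F'. norm (a' \<xi>) ^ 2) ^ q"
        using bound[OF resonance_measure_fejer[OF lam1] lam1 fejer_mass[OF lam1], of "c0 * N" F' a'] c N
        by (simp add: X_def power_mult_distrib mult_ac)
    next
      fix \<xi> assume "\<xi> \<in> F"
      hence "c0 * N \<le> \<bar>\<xi>\<bar>" "\<bar>\<xi>\<bar> \<le> C0 * N" using F(3) by (auto simp: freq_shell_def)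
      moreover have "C0 * N \<le> (\<kappa> * c0) * N" using C0 N by (intro mult_right_mono) auto
      ultimately show "c0 * N \<le> \<bar>\<xi>\<bar> \<and> \<bar>\<xi>\<bar> \<le> real \<kappa> * (c0 * N)" by (simp add: mult_ac)
    qed (use X p c N F in auto)
    also have "\<dots> = 2 * 2 ^ p * C * w lam (c0 * N) * (lam * (\<Sum>\<xi>\<in>F. norm (a \<xi>) ^ 2)) ^ q"
      by (simp add: X_def power_mult_distrib)
    also have "\<dots> \<le> 2 * 2 ^ p * C * w lam (c0 * N) * 1"
      using F(4) C lam1 w0 by (intro mult_left_mono power_le_one) (auto simp: sum_nonneg)
    finally show "(\<integral>z. norm (wave_sum a F z) ^ p \<partial>fejer_measure lam) \<le> 2 * 2 ^ p * C * w lam (c0 * N)"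
      by simp
  qed (use C in auto)
qed

text \<open>Hoelder with exponents \<open>12\<close> and \<open>6\<close>; the twelfth moment of the low-frequency factor follows from
  its sixth moment and the trivial supremum bound.\<close>

lemma product_bound_decoupling:
  assumes \<epsilon>: "0 < \<epsilon>" "\<epsilon> < 1 / 2" and c: "0 < c0" "c0 < C0"
  shows "\<exists>C>0. \<forall>lam L N F G a b. 1 \<le> lam \<longrightarrow> 0 < L \<longrightarrow> L \<le> N \<longrightarrow>
    shell_coeffs c0 C0 lam L F a \<longrightarrow> shell_coeffs c0 C0 lam N G b \<longrightarrow>
    (\<integral>z. norm (wave_sum a F z * wave_sum b G z) ^ 4 \<partial>fejer_measure lam) \<le> C * (L * N powr (4 * \<epsilon>))"
proof -
  \<comment> \<open>Chosen so that 6 \<epsilon>' = 4 \<epsilon>, the power of N after raising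
    N^\<epsilon> to the fourth power.\<close>
  define \<epsilon>' where "\<epsilon>' = 2 / 3 * \<epsilon>"
  have \<epsilon>': "0 < \<epsilon>'" "\<epsilon>' \<le> 1 / 3" using \<epsilon> by (auto simp: \<epsilon>'_def)
  have "\<exists>C>0. \<forall>lam N F a. 1 \<le> lam \<longrightarrow> 0 < N \<longrightarrow> shell_coeffs c0 C0 lam N F a \<longrightarrow>
      (\<integral>z. norm (wave_sum a F z) ^ 6 \<partial>fejer_measure lam) \<le> C * (c0 * N) powr (6 * \<epsilon>')"
    by (rule shell_bound[OF c]) (auto intro!: L6_bound \<epsilon>')
  then obtain C' where C': "0 < C'" and bound': "\<And>lam N F a. 1 \<le> lam \<Longrightarrow> 0 < N \<Longrightarrow> shell_coeffs c0 C0 lam N F a \<Longrightarrow>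
      (\<integral>z. norm (wave_sum a F z) ^ 6 \<partial>fejer_measure lam) \<le> C' * (c0 * N) powr (6 * \<epsilon>')"
    by (elim exE conjE) simp
  define C where "C = C' * c0 powr (6 * \<epsilon>')"
  have C: "0 < C" using C' c by (simp add: C_def)
  have bound: "(\<integral>z. norm (wave_sum a F z) ^ 6 \<partial>fejer_measure lam) \<le> C * N powr (6 * \<epsilon>')"
    if "1 \<le> lam" "0 < N" "shell_coeffs c0 C0 lam N F a" for lam N F a
    using bound'[OF that] c that by (simp add: C_def powr_mult)
  show ?thesis
  proof (intro exI[of _ "2 * C0 * C"] conjI allI impI)
    fix lam L N F G and a b :: "real \<Rightarrow> complex"
    assume lam1: "1 \<le> lam" and L: "0 < L" "L \<le> N"
      and sF: "shell_coeffs c0 C0 lam L F a" and sG: "shell_coeffs c0 C0 lam N G b"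
    note F = shell_coeffsD[OF sF] and G = shell_coeffsD[OF sG]
    interpret resonance_measure "fejer_measure lam" lam by (rule resonance_measure_fejer[OF lam1])
    define S where "S = 2 * C0 * L"
    have S: "0 < S" using c L by (simp add: S_def)
    have N: "0 < N" using L by simp
    have sup: "norm (wave_sum a F z) ^ 2 \<le> S" for z
    proof -
      have "norm (wave_sum a F z) ^ 2 \<le> real (card F) * (\<Sum>\<xi>\<in>F. norm (a \<xi>) ^ 2)" by (rule norm_wave_sum_le[OF F(1)])
      also have "\<dots> \<le> (2 * C0 * L * lam) * (\<Sum>\<xi>\<in>F. norm (a \<xi>) ^ 2)"
        using c L lam1 F by (intro mult_right_mono card_shell_le[of lam F c0]) (auto simp: sum_nonneg)
      also have "\<dots> = S * (lam * (\<Sum>\<xi>\<in>F. norm (a \<xi>) ^ 2))" by (simp add: S_def)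
      also have "\<dots> \<le> S * 1" using S F(4) by (intro mult_left_mono) auto
      finally show ?thesis by simp
    qed
    have "norm (wave_sum a F z) ^ 12 \<le> S ^ 3 * norm (wave_sum a F z) ^ 6" for z
    proof -
      have "(norm (wave_sum a F z) ^ 2) ^ 3 \<le> S ^ 3" using sup by (intro power_mono) auto
      hence "(norm (wave_sum a F z) ^ 2) ^ 3 * norm (wave_sum a F z) ^ 6 \<le> S ^ 3 * norm (wave_sum a F z) ^ 6"
        by (intro mult_right_mono) auto
      thus ?thesis by (simp flip: power_mult power_add)
    qed
    hence "(\<integral>z. norm (wave_sum a F z) ^ 12 \<partial>fejer_measure lam) \<le> (\<integral>z. S ^ 3 * norm (wave_sum a F z) ^ 6 \<partial>fejer_measure lam)"
      by (intro integral_mono_real continuous_intros)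
    also have "\<dots> \<le> S ^ 3 * (C * N powr (6 * \<epsilon>'))"
    proof -
      have "(\<integral>z. norm (wave_sum a F z) ^ 6 \<partial>fejer_measure lam) \<le> C * L powr (6 * \<epsilon>')"
        by (rule bound[OF lam1 L(1) sF])
      also have "\<dots> \<le> C * N powr (6 * \<epsilon>')" using C L \<epsilon>' by (intro mult_left_mono powr_mono2) auto
      finally show ?thesis using S by (simp add: mult_left_mono)
    qed
    finally have m12: "(\<integral>z. norm (wave_sum a F z) ^ 12 \<partial>fejer_measure lam) \<le> S ^ 3 * (C * N powr (6 * \<epsilon>'))" .
    have m6: "(\<integral>z. norm (wave_sum b G z) ^ 6 \<partial>fejer_measure lam) \<le> C * N powr (6 * \<epsilon>')"
      by (rule bound[OF lam1 N sG])
    define I where "I = (\<integral>z. norm (wave_sum a F z * wave_sum b G z) ^ 4 \<partial>fejer_measure lam)"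
    have I: "0 \<le> I" unfolding I_def by (rule integral_norm_power_nonneg)
    let ?f = "\<lambda>z. norm (wave_sum a F z)" and ?g = "\<lambda>z. norm (wave_sum b G z)"
    have "(\<integral>z. ?f z ^ 4 * (?g z ^ 2)\<^sup>2 \<partial>fejer_measure lam) ^ 3
      \<le> (\<integral>z. (?f z ^ 4) ^ 3 \<partial>fejer_measure lam) * (\<integral>z. (?g z ^ 2) ^ 3 \<partial>fejer_measure lam)\<^sup>2"
      by (intro Hoelder_integral_3 continuous_intros) auto
    moreover have "x ^ 4 * (y ^ 2)\<^sup>2 = (x * y) ^ 4" "(x ^ 4) ^ 3 = x ^ 12" "(y ^ 2) ^ 3 = y ^ 6" for x y :: real
      by (simp_all add: power_mult_distrib flip: power_mult)
    ultimately have "I ^ 3 \<le> (\<integral>z. ?f z ^ 12 \<partial>fejer_measure lam) * (\<integral>z. ?g z ^ 6 \<partial>fejer_measure lam)\<^sup>2"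
      by (simp add: I_def norm_mult)
    also have "\<dots> \<le> (S ^ 3 * (C * N powr (6 * \<epsilon>'))) * (C * N powr (6 * \<epsilon>'))\<^sup>2"
      using S C by (intro mult_mono power_mono m12 m6 integral_norm_power_nonneg) auto
    also have "\<dots> = (S * (C * N powr (6 * \<epsilon>'))) ^ 3" by (simp add: eval_nat_numeral algebra_simps)
    finally have "I \<le> S * (C * N powr (6 * \<epsilon>'))"
      by (subst (asm) power_mono_iff) (use I S C in auto)
    also have "\<dots> = 2 * C0 * C * (L * N powr (4 * \<epsilon>))" by (simp add: S_def \<epsilon>'_def mult_ac)
    finally show "(\<integral>z. norm (wave_sum a F z * wave_sum b G z) ^ 4 \<partial>fejer_measure lam) \<le> 2 * C0 * C * (L * N powr (4 * \<epsilon>))"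
      by (simp add: I_def)
  qed (use C c in auto)
qed

text \<open>Signs are arbitrary: the quadratic form in \<eta>, \<eta>' is at least 3/4 Y^2 even if
  they are opposite, while \<xi>, \<xi>' subtract at most 3/16 Y^2. Hence shells of very different
  size need no reduction to positive frequencies.\<close>

lemma transversal_resonance:
  fixes \<xi> \<xi>' \<eta> \<eta>' :: real
  assumes Y: "0 < Y" and \<xi>: "4 * \<bar>\<xi>\<bar> \<le> Y" "4 * \<bar>\<xi>'\<bar> \<le> Y" and \<eta>: "Y \<le> \<bar>\<eta>\<bar>" "Y \<le> \<bar>\<eta>'\<bar>"
    and res: "resonant ((curve \<xi> + curve \<eta>) - (curve \<xi>' + curve \<eta>'))"
  shows "\<bar>\<xi> - \<xi>'\<bar> \<le> 2 / Y\<^sup>2"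
proof -
  define Q where "Q = \<eta>\<^sup>2 + \<eta> * \<eta>' + \<eta>'\<^sup>2 - (\<xi>\<^sup>2 + \<xi> * \<xi>' + \<xi>'\<^sup>2)"
  have e1: "\<xi> + \<eta> = \<xi>' + \<eta>'" and e2: "\<bar>(\<xi>^3 + \<eta>^3) - (\<xi>'^3 + \<eta>'^3)\<bar> < 1"
    using res by (auto simp: resonant_def curve_def)
  have eq: "\<eta> = \<xi>' + \<eta>' - \<xi>" using e1 by simp
  have "(\<xi>^3 + \<eta>^3) - (\<xi>'^3 + \<eta>'^3) = (\<xi>' - \<xi>) * Q"
    unfolding Q_def eq by (simp add: algebra_simps power2_eq_square power3_eq_cube)
  hence le: "\<bar>\<xi> - \<xi>'\<bar> * \<bar>Q\<bar> < 1" using e2 by (simp add: abs_mult abs_minus_commute)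
  have Y2: "Y\<^sup>2 \<le> \<eta>\<^sup>2" using \<eta>(1) Y by (metis abs_le_square_iff abs_of_pos)
  have x: "16 * \<xi>\<^sup>2 \<le> Y\<^sup>2" "16 * \<xi>'\<^sup>2 \<le> Y\<^sup>2"
  proof -
    have "\<bar>4 * \<xi>\<bar> \<le> \<bar>Y\<bar>" "\<bar>4 * \<xi>'\<bar> \<le> \<bar>Y\<bar>" using \<xi> Y by auto
    thus "16 * \<xi>\<^sup>2 \<le> Y\<^sup>2" "16 * \<xi>'\<^sup>2 \<le> Y\<^sup>2" unfolding abs_le_square_iff by (simp_all add: power_mult_distrib)
  qed
  have "0 \<le> (\<eta>' + \<eta> / 2)\<^sup>2" "0 \<le> (\<xi> - \<xi>')\<^sup>2" by simp_all
  hence "3 / 4 * \<eta>\<^sup>2 \<le> \<eta>\<^sup>2 + \<eta> * \<eta>' + \<eta>'\<^sup>2" "2 * (\<xi> * \<xi>') \<le> \<xi>\<^sup>2 + \<xi>'\<^sup>2"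
    by (simp_all add: power2_eq_square algebra_simps)
  hence "Y\<^sup>2 / 2 \<le> Q" unfolding Q_def using x Y2 zero_le_power2[of Y] by linarith
  hence "\<bar>\<xi> - \<xi>'\<bar> * (Y\<^sup>2 / 2) \<le> \<bar>\<xi> - \<xi>'\<bar> * \<bar>Q\<bar>" by (intro mult_left_mono) auto
  hence "\<bar>\<xi> - \<xi>'\<bar> * (Y\<^sup>2 / 2) \<le> 1" using le by linarith
  thus ?thesis using Y by (simp add: field_simps)
qed

text \<open>If L is much smaller than N, the shells are transversal as a whole with \<rho> of order
  N^(-2). Otherwise Cauchy-Schwarz and the eighth moments give 1 + N^2 / lam, which equals N^2 (1 /
  lam + 1 / N^2) and is comparable to the claim as N = O(L).\<close>

lemma product_bound_bilinear:
  assumes c: "0 < c0" "c0 < C0"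
  shows "\<exists>C>0. \<forall>lam L N F G a b. 1 \<le> lam \<longrightarrow> 0 < L \<longrightarrow> L \<le> N \<longrightarrow>
    shell_coeffs c0 C0 lam L F a \<longrightarrow> shell_coeffs c0 C0 lam N G b \<longrightarrow>
    (\<integral>z. norm (wave_sum a F z * wave_sum b G z) ^ 4 \<partial>fejer_measure lam) \<le> C * (L * N * (1 / lam + 1 / N\<^sup>2))"
proof -
  have "\<exists>C>0. \<forall>lam N F a. 1 \<le> lam \<longrightarrow> 0 < N \<longrightarrow> shell_coeffs c0 C0 lam N F a \<longrightarrow>
      (\<integral>z. norm (wave_sum a F z) ^ 8 \<partial>fejer_measure lam) \<le> C * (1 + (c0 * N)\<^sup>2 / lam)"
    by (rule shell_bound[OF c]) (auto intro!: L8_bound)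
  then obtain C' where C': "0 < C'" and bound': "\<And>lam N F a. 1 \<le> lam \<Longrightarrow> 0 < N \<Longrightarrow> shell_coeffs c0 C0 lam N F a \<Longrightarrow>
      (\<integral>z. norm (wave_sum a F z) ^ 8 \<partial>fejer_measure lam) \<le> C' * (1 + (c0 * N)\<^sup>2 / lam)"
    by (elim exE conjE) simp
  define C where "C = C' * (1 + c0\<^sup>2)"
  have C: "0 < C" using C' by (auto simp: C_def intro!: mult_pos_pos add_pos_nonneg)
  have bound: "(\<integral>z. norm (wave_sum a F z) ^ 8 \<partial>fejer_measure lam) \<le> C * (1 + N\<^sup>2 / lam)"
    if "1 \<le> lam" "0 < N" "shell_coeffs c0 C0 lam N F a" for lam N F a
  proof -
    define q where "q = N\<^sup>2 / lam"
    have "0 \<le> q" using that by (simp add: q_def)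
    hence "1 + c0\<^sup>2 * q \<le> (1 + c0\<^sup>2) * (1 + q)" by (simp add: algebra_simps)
    hence "C' * (1 + c0\<^sup>2 * q) \<le> C' * ((1 + c0\<^sup>2) * (1 + q))" using C' by (intro mult_left_mono) auto
    thus ?thesis using bound'[OF that] by (simp add: C_def q_def power_mult_distrib mult.assoc)
  qed
  define K where "K = 128 * C0\<^sup>2 * (1 + 4 / c0\<^sup>2) + C * (4 * C0 / c0)"
  have K: "0 < K" "128 * C0\<^sup>2 * (1 + 4 / c0\<^sup>2) \<le> K" "C * (4 * C0 / c0) \<le> K"
    using C c by (auto simp: K_def intro!: add_nonneg_pos)
  show ?thesis
  proof (intro exI[of _ K] conjI allI impI K)
    fix lam L N F G and a b :: "real \<Rightarrow> complex"
    assume lam1: "1 \<le> lam" and L: "0 < L" "L \<le> N"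
      and sF: "shell_coeffs c0 C0 lam L F a" and sG: "shell_coeffs c0 C0 lam N G b"
    note F = shell_coeffsD[OF sF] and G = shell_coeffsD[OF sG]
    interpret resonance_measure "fejer_measure lam" lam by (rule resonance_measure_fejer[OF lam1])
    have N: "0 < N" using L by simp
    show "(\<integral>z. norm (wave_sum a F z * wave_sum b G z) ^ 4 \<partial>fejer_measure lam) \<le> K * (L * N * (1 / lam + 1 / N\<^sup>2))"
    \<comment> \<open>The threshold is the factor 4 of \<open>transversal_resonance\<close> applied
      to the outer edge of one shell and the inner edge of the other.\<close>
    proof (cases "4 * C0 * L \<le> c0 * N")
      case True
      define A B where "A = (\<Sum>\<xi>\<in>F. norm (a \<xi>) ^ 2)" and "B = (\<Sum>\<xi>\<in>G. norm (b \<xi>) ^ 2)"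
      have AB: "0 \<le> A" "0 \<le> B" "lam * A \<le> 1" "lam * B \<le> 1" using F G by (auto simp: A_def B_def sum_nonneg)
      have "(lam * A) * (lam * B) \<le> 1 * 1" using AB lam1 by (intro mult_mono) auto
      hence ab: "((lam * A) * (lam * B)) ^ 2 \<le> 1" using AB lam1 by (intro power_le_one) auto
      define \<rho> where "\<rho> = 2 / (c0 * N)\<^sup>2"
      have \<rho>: "0 \<le> \<rho>" by (simp add: \<rho>_def)
      have "(\<integral>z. norm (wave_sum a F z * wave_sum b G z) ^ 4 \<partial>fejer_measure lam)
          \<le> (2 * C0 * L * lam) * (2 * C0 * N * lam) * (2 * \<rho> * lam + 1) * mass * (A * B) ^ 2"
        unfolding A_def B_def
      proof (rule bilinear_L4[OF F(1,2) _ G(1,2)])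
        show "real (card F) \<le> 2 * C0 * L * lam" "real (card G) \<le> 2 * C0 * N * lam"
          using c L N lam1 F G by (auto intro!: card_shell_le[of lam _ c0])
        fix \<xi> \<xi>' \<eta> \<eta>' assume mem: "\<xi> \<in> F" "\<xi>' \<in> F" "\<eta> \<in> G" "\<eta>' \<in> G"
          and res: "resonant ((curve \<xi> + curve \<eta>) - (curve \<xi>' + curve \<eta>'))"
        have "\<bar>\<xi>\<bar> \<le> C0 * L" "\<bar>\<xi>'\<bar> \<le> C0 * L" using mem F(3) by (auto simp: freq_shell_def)
        moreover have "c0 * N \<le> \<bar>\<eta>\<bar>" "c0 * N \<le> \<bar>\<eta>'\<bar>" using mem G(3) by (auto simp: freq_shell_def)
        ultimately show "\<bar>\<xi> - \<xi>'\<bar> \<le> \<rho>"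
          unfolding \<rho>_def using True c N by (intro transversal_resonance[OF _ _ _ _ _ res]) auto
      qed (rule \<rho>)
      also have "\<dots> \<le> (2 * C0 * L * lam) * (2 * C0 * N * lam) * (2 * \<rho> * lam + 1) * (32 * lam) * (A * B) ^ 2"
        using fejer_mass[OF lam1] c L N lam1 \<rho> by (intro mult_right_mono mult_left_mono) auto
      also have "\<dots> = 128 * C0\<^sup>2 * L * N * (2 * \<rho> + 1 / lam) * ((lam * A) * (lam * B)) ^ 2"
        using lam1 by (simp add: field_simps power2_eq_square)
      also have "\<dots> \<le> 128 * C0\<^sup>2 * L * N * (2 * \<rho> + 1 / lam) * 1"
        using L N lam1 \<rho> by (intro mult_left_mono ab) auto
      also have "\<dots> \<le> 128 * C0\<^sup>2 * L * N * ((1 + 4 / c0\<^sup>2) * (1 / lam + 1 / N\<^sup>2))"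
      proof -
        have "2 * \<rho> + 1 / lam \<le> (1 + 4 / c0\<^sup>2) * (1 / lam + 1 / N\<^sup>2)"
        proof -
          define p q k where "p = 1 / lam" and "q = 1 / N\<^sup>2" and "k = 4 / c0\<^sup>2"
          have "0 \<le> p" "0 \<le> q" "0 \<le> k" using lam1 by (simp_all add: p_def q_def k_def)
          hence "k * q + p \<le> (1 + k) * (p + q)" by (simp add: algebra_simps)
          thus ?thesis by (simp add: p_def q_def k_def \<rho>_def power_mult_distrib)
        qed
        thus ?thesis using L N by (simp only: mult_1_right) (intro mult_left_mono, auto)
      qed
      also have "\<dots> = (128 * C0\<^sup>2 * (1 + 4 / c0\<^sup>2)) * (L * N * (1 / lam + 1 / N\<^sup>2))" by (simp add: mult_ac)
      also have "\<dots> \<le> K * (L * N * (1 / lam + 1 / N\<^sup>2))"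
        using K L N lam1 by (intro mult_right_mono) auto
      finally show ?thesis .
    next
      case False
      define I where "I = (\<integral>z. norm (wave_sum a F z * wave_sum b G z) ^ 4 \<partial>fejer_measure lam)"
      let ?f = "\<lambda>z. norm (wave_sum a F z) ^ 4" and ?g = "\<lambda>z. norm (wave_sum b G z) ^ 4"
      have mF: "(\<integral>z. norm (wave_sum a F z) ^ 8 \<partial>fejer_measure lam) \<le> C * (1 + N\<^sup>2 / lam)"
      proof -
        have "(\<integral>z. norm (wave_sum a F z) ^ 8 \<partial>fejer_measure lam) \<le> C * (1 + L\<^sup>2 / lam)"
          by (rule bound[OF lam1 L(1) sF])
        also have "\<dots> \<le> C * (1 + N\<^sup>2 / lam)"
          using C L lam1 by (intro mult_left_mono add_left_mono divide_right_mono power_mono) auto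
        finally show ?thesis .
      qed
      have mG: "(\<integral>z. norm (wave_sum b G z) ^ 8 \<partial>fejer_measure lam) \<le> C * (1 + N\<^sup>2 / lam)"
        by (rule bound[OF lam1 N sG])
      have "(\<integral>z. ?f z * ?g z \<partial>fejer_measure lam)\<^sup>2 \<le> (\<integral>z. (?f z)\<^sup>2 \<partial>fejer_measure lam) * (\<integral>z. (?g z)\<^sup>2 \<partial>fejer_measure lam)"
        by (intro Cauchy_Schwarz_integral continuous_intros) auto
      hence "I\<^sup>2 \<le> (\<integral>z. norm (wave_sum a F z) ^ 8 \<partial>fejer_measure lam) * (\<integral>z. norm (wave_sum b G z) ^ 8 \<partial>fejer_measure lam)"
        unfolding I_def norm_mult power_mult_distrib power_mult[symmetric] by simp
      also have "\<dots> \<le> (C * (1 + N\<^sup>2 / lam)) * (C * (1 + N\<^sup>2 / lam))"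
        using C lam1 by (intro mult_mono mF mG integral_norm_power_nonneg) auto
      finally have "I\<^sup>2 \<le> (C * (1 + N\<^sup>2 / lam))\<^sup>2" by (simp add: power2_eq_square)
      hence "I \<le> C * (1 + N\<^sup>2 / lam)" by (rule power2_le_imp_le) (use C lam1 in auto)
      also have "1 + N\<^sup>2 / lam \<le> (4 * C0 / c0) * (L * N * (1 / lam + 1 / N\<^sup>2))"
      proof -
        have "c0 * N \<le> 4 * C0 * L" using False by simp
        hence "N \<le> 4 * C0 / c0 * L" using c by (simp add: field_simps)
        hence "N * (N * (1 / lam + 1 / N\<^sup>2)) \<le> (4 * C0 / c0 * L) * (N * (1 / lam + 1 / N\<^sup>2))"
          using N lam1 by (intro mult_right_mono) auto
        moreover have "N * (N * (1 / lam + 1 / N\<^sup>2)) = 1 + N\<^sup>2 / lam"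
          using N lam1 by (simp add: field_simps power2_eq_square)
        ultimately show ?thesis by (simp add: mult_ac)
      qed
      hence "C * (1 + N\<^sup>2 / lam) \<le> C * ((4 * C0 / c0) * (L * N * (1 / lam + 1 / N\<^sup>2)))"
        using C by (intro mult_left_mono) auto
      also have "\<dots> = (C * (4 * C0 / c0)) * (L * N * (1 / lam + 1 / N\<^sup>2))" by (simp add: mult_ac)
      also have "\<dots> \<le> K * (L * N * (1 / lam + 1 / N\<^sup>2))"
        using K L N lam1 by (intro mult_right_mono) auto
      finally show ?thesis by (simp add: I_def)
    qed
  qed
qed

section \<open>The bilinear estimate\<close>

lemma bump_bounded:
  assumes "bump \<eta>"
  shows "\<exists>H\<ge>1. \<forall>t. \<bar>\<eta> t\<bar> \<le> H * indicator {-1..1} t"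
proof -
  have "\<eta> differentiable (at t)" for t
    using assms unfolding bump_def smooth_def by (metis funpow_0)
  hence "continuous_on {-1..1} \<eta>"
    by (intro continuous_at_imp_continuous_on ballI differentiable_imp_continuous_within) auto
  hence "bounded (\<eta> ` {-1..1})" by (intro compact_imp_bounded compact_continuous_image) auto
  then obtain B where "\<forall>y\<in>\<eta> ` {-1..1}. norm y \<le> B" unfolding bounded_iff by blast
  hence B: "\<bar>\<eta> t\<bar> \<le> B" if "t \<in> {-1..1}" for t using that by auto
  have zero: "\<eta> t = 0" if "t \<notin> {-1..1}" for t
    using assms that closure_subset[of "{t. \<eta> t \<noteq> 0}"] unfolding bump_def by blast
  show ?thesis
  proof (intro exI[of _ "max 1 B"] conjI allI)
    fix t show "\<bar>\<eta> t\<bar> \<le> max 1 B * indicator {-1..1} t"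
      using B[of t] zero[of t] by (cases "t \<in> {-1..1}") auto
  qed simp
qed

lemma Lp_norm_4_le:
  assumes I: "(\<integral>\<^sup>+ z. ennreal (norm (f z) ^ 4) \<partial>M) \<le> ennreal (R ^ 4)" and R: "0 \<le> R"
  shows "Lp_norm 4 M f \<le> ennreal R"
proof -
  define J where "J = (\<integral>\<^sup>+ z. ennreal (norm (f z) powr 4) \<partial>M)"
  have J: "J \<le> ennreal (R ^ 4)" using I by (simp add: J_def)
  hence fin: "J \<noteq> \<infinity>" by (metis ennreal_less_top infinity_ennreal_def leD)
  have "enn2real J \<le> R ^ 4" using enn2real_mono[OF J] R by simp
  hence "enn2real J powr (1 / 4) \<le> (R ^ 4) powr (1 / 4)" by (intro powr_mono2) auto
  also have "(R ^ 4) powr (1 / 4) = R"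
  proof (cases "R = 0")
    case False
    hence "R ^ 4 = R powr 4" using R by simp
    thus ?thesis using False R by (simp add: powr_powr del: powr_numeral)
  qed simp
  finally show ?thesis
    unfolding Lp_norm_def Let_def J_def[symmetric] using fin by (simp add: ennreal_leI)
qed

text \<open>Only boundedness and support of \<eta> are used: the cutoff is dominated by a multiple
  of the indicator of [-1, 1], and that in turn by the Fejer weight.\<close>

lemma localized_product_bound:
  assumes lam: "1 \<le> lam" and H: "1 \<le> H" "\<And>t. \<bar>\<eta> t\<bar> \<le> H * indicator {-1..1} t"
    and flows: "\<And>t x. u t x = wave_sum a F (t, x)" "\<And>t x. v t x = wave_sum b G (t, x)"
    and bound: "(\<integral>z. norm (wave_sum a F z * wave_sum b G z) ^ 4 \<partial>fejer_measure lam) \<le> C * R ^ 4"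
    and C: "0 \<le> C" and R: "0 \<le> R"
  shows "Lp_norm 4 (lebesgue_on (UNIV \<times> {0..lam})) (\<lambda>(t, x). of_real (\<eta> t) * u t x * v t x)
    \<le> ennreal ((2 * H ^ 4 * C + 1) * R)"
proof (rule Lp_norm_4_le)
  define g where "g z = norm (wave_sum a F z * wave_sum b G z) ^ 4" for z
  have g: "continuous_on UNIV g" "\<And>z. 0 \<le> g z" unfolding g_def[abs_def] by (auto intro!: continuous_intros)
  have strip: "UNIV \<times> {0..lam} \<in> sets (lebesgue :: (real \<times> real) measure)"
    by (intro sets_completionI_sets) (simp, intro borel_closed closed_Times, auto)
  have gm: "(\<lambda>z. indicator ({-1..1} \<times> {0..lam}) z * g z) \<in> borel_measurable lborel"
  proof -
    have "g \<in> borel_measurable borel" by (rule borel_measurable_continuous_onI[OF g(1)])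
    moreover have "{-1..1} \<times> {0..lam} \<in> sets (borel :: (real \<times> real) measure)"
      by (intro borel_closed closed_Times) auto
    ultimately show ?thesis by simp
  qed
  have "(\<integral>\<^sup>+ z. ennreal (norm (case z of (t, x) \<Rightarrow> of_real (\<eta> t) * u t x * v t x) ^ 4) \<partial>lebesgue_on (UNIV \<times> {0..lam}))
    = (\<integral>\<^sup>+ z. ennreal (norm (case z of (t, x) \<Rightarrow> of_real (\<eta> t) * u t x * v t x) ^ 4) * indicator (UNIV \<times> {0..lam}) z \<partial>lebesgue)"
    using strip by (subst nn_integral_restrict_space) auto
  also have "\<dots> \<le> (\<integral>\<^sup>+ z. ennreal (H ^ 4 * (indicator ({-1..1} \<times> {0..lam}) z * g z)) \<partial>lebesgue)"
  proof (rule nn_integral_mono)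
    fix z :: "real \<times> real"
    obtain t x where z: "z = (t, x)" by (cases z)
    have "norm (of_real (\<eta> t) * u t x * v t x) ^ 4 = \<bar>\<eta> t\<bar> ^ 4 * g z"
      by (simp add: g_def z flows norm_mult power_mult_distrib)
    also have "\<dots> \<le> (H * indicator {-1..1} t) ^ 4 * g z"
      using H g by (intro mult_right_mono power_mono) auto
    finally have "norm (of_real (\<eta> t) * u t x * v t x) ^ 4 \<le> (H * indicator {-1..1} t) ^ 4 * g z" .
    thus "ennreal (norm (case z of (t, x) \<Rightarrow> of_real (\<eta> t) * u t x * v t x) ^ 4) * indicator (UNIV \<times> {0..lam}) z
        \<le> ennreal (H ^ 4 * (indicator ({-1..1} \<times> {0..lam}) z * g z))"
      by (auto simp: z indicator_def intro!: ennreal_leI)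
  qed
  also have "\<dots> = (\<integral>\<^sup>+ z. ennreal (H ^ 4) * ennreal (indicator ({-1..1} \<times> {0..lam}) z * g z) \<partial>lborel)"
    using H g by (simp add: nn_integral_completion ennreal_mult)
  also have "\<dots> = ennreal (H ^ 4) * (\<integral>\<^sup>+ z. ennreal (indicator ({-1..1} \<times> {0..lam}) z * g z) \<partial>lborel)"
    by (rule nn_integral_cmult) (use gm in simp)
  also have "\<dots> \<le> ennreal (H ^ 4) * ennreal (2 * (\<integral>z. g z \<partial>fejer_measure lam))"
    by (intro mult_left_mono nn_integral_strip_le lam g) auto
  also have "\<dots> \<le> ennreal (H ^ 4) * ennreal (2 * (C * R ^ 4))"
    using bound by (intro mult_left_mono ennreal_leI) (auto simp: g_def)
  also have "\<dots> = ennreal (2 * H ^ 4 * C * R ^ 4)" using H C R by (simp add: mult_ac flip: ennreal_mult)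
  \<comment> \<open>No fourth root of the constant is taken: adding 1 makes it at least 1, hence at
    most its own fourth power.\<close>
  also have "\<dots> \<le> ennreal (((2 * H ^ 4 * C + 1) * R) ^ 4)"
  proof (rule ennreal_leI)
    have c0: "0 \<le> 2 * H ^ 4 * C" using H C by simp
    have "2 * H ^ 4 * C \<le> 2 * H ^ 4 * C + 1" by simp
    also have "\<dots> \<le> (2 * H ^ 4 * C + 1) ^ 4" using c0 self_le_power[of "2 * H ^ 4 * C + 1" 4] by simp
    finally show "2 * H ^ 4 * C * R ^ 4 \<le> ((2 * H ^ 4 * C + 1) * R) ^ 4"
      using R by (simp only: power_mult_distrib) (intro mult_right_mono, auto)
  qed
  finally show "(\<integral>\<^sup>+ z. ennreal (norm (case z of (t, x) \<Rightarrow> of_real (\<eta> t) * u t x * v t x) ^ 4) \<partial>lebesgue_on (UNIV \<times> {0..lam}))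
      \<le> ennreal (((2 * H ^ 4 * C + 1) * R) ^ 4)" .
  show "0 \<le> (2 * H ^ 4 * C + 1) * R" using H C R by simp
qed

lemma torus_coefficients:
  assumes lam: "1 \<le> lam" and M: "0 < M" and \<phi>: "torus_fun lam \<phi>" "Lp_norm 2 (lebesgue_on {0..lam}) \<phi> = 1"
    and supp: "fourier_supported lam \<phi> (freq_shell c0 C0 M)"
  shows "\<exists>F a. shell_coeffs c0 C0 lam M F a \<and> (\<forall>t x. airy_flow lam t \<phi> x = wave_sum a F (t, x))"
proof -
  define F where "F = dual_lattice lam \<inter> freq_shell c0 C0 M"
  define a where "a \<xi> = torus_fourier lam \<phi> \<xi> / lam" for \<xi>
  have l: "0 < lam" using lam by simp
  have fin: "finite F"
    by (rule finite_subset[OF _ finite_dual_lattice_bounded[OF l, of "C0 * M"]]) (auto simp: F_def freq_shell_def)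
  have "lam * (\<Sum>\<xi>\<in>F. norm (a \<xi>) ^ 2) = (\<Sum>\<xi>\<in>F. (norm (torus_fourier lam \<phi> \<xi>))\<^sup>2) / lam"
    using l by (simp add: a_def norm_divide power_divide sum_divide_distrib[symmetric] power2_eq_square)
  also have "\<dots> \<le> 1"
    using Bessel_torus[OF l \<phi> fin] l by (simp add: F_def)
  finally have "lam * (\<Sum>\<xi>\<in>F. norm (a \<xi>) ^ 2) \<le> 1" .
  moreover have "airy_flow lam t \<phi> x = wave_sum a F (t, x)" for t x
    unfolding a_def[abs_def] F_def
    by (rule airy_flow_eq_wave_sum[OF l supp, of "C0 * M"]) (auto simp: freq_shell_def)
  ultimately show ?thesis using fin by (intro exI[of _ F] exI[of _ a]) (auto simp: shell_coeffs_def F_def)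
qed

theorem theorem1p1:
  fixes \<eta> :: "real \<Rightarrow> real" and c0 C0 :: real
  assumes "bump \<eta>" and "0 < c0" and "c0 < C0"
  shows "\<exists>\<epsilon>0>0. \<forall>\<epsilon>::real. 0 < \<epsilon> \<and> \<epsilon> < \<epsilon>0 \<longrightarrow>
    (\<exists>C>0. \<forall>(lam::real) (L::real) (N::real) (\<phi>L::real \<Rightarrow> complex) (\<phi>N::real \<Rightarrow> complex).
      1 \<le> lam \<longrightarrow> dyadic L \<longrightarrow> dyadic N \<longrightarrow> L \<le> N \<longrightarrow>
      torus_fun lam \<phi>L \<longrightarrow> torus_fun lam \<phi>N \<longrightarrow>
      Lp_norm 2 (lebesgue_on {0..lam}) \<phi>L = 1 \<longrightarrow>
      Lp_norm 2 (lebesgue_on {0..lam}) \<phi>N = 1 \<longrightarrow>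
      fourier_supported lam \<phi>L (freq_shell c0 C0 L) \<longrightarrow>
      fourier_supported lam \<phi>N (freq_shell c0 C0 N) \<longrightarrow>
      Lp_norm 4 (lebesgue_on (UNIV \<times> {0..lam}))
        (\<lambda>(t, x). of_real (\<eta> t) * airy_flow lam t \<phi>L x * airy_flow lam t \<phi>N x)
      \<le> ennreal (C *
          ((1 / lam + 1 / N ^ 2) powr (1/4) * L powr (3/16 + \<epsilon>) * N powr (3/16 + \<epsilon>)
           + min (1 / N powr (1/4 - \<epsilon>)) (1 / lam powr (1/4) + 1 / N powr (1/2))
             * L powr (1/4) * N powr (1/4))))"
\<comment> \<open>The value 1/2 comes from the sixth moment at frequencies below 1: it is used with
  2/3 \<epsilon> in place of \<epsilon>, and this has to stay within 1/3.\<close>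
proof (rule exI[of _ "1/2"], intro conjI allI impI, goal_cases)
  case (2 \<epsilon>)
  note \<epsilon> = 2
  obtain H where H: "1 \<le> H" "\<And>t. \<bar>\<eta> t\<bar> \<le> H * indicator {-1..1} t"
    using bump_bounded[OF assms(1)] by blast
  obtain C1 where C1: "0 < C1" and bound1: "\<And>lam L N F G a b. 1 \<le> lam \<Longrightarrow> 0 < L \<Longrightarrow> L \<le> N \<Longrightarrow>
    shell_coeffs c0 C0 lam L F a \<Longrightarrow> shell_coeffs c0 C0 lam N G b \<Longrightarrow>
    (\<integral>z. norm (wave_sum a F z * wave_sum b G z) ^ 4 \<partial>fejer_measure lam) \<le> C1 * (L * N powr (4 * \<epsilon>))"
    using product_bound_decoupling[OF conjunct1[OF \<epsilon>] conjunct2[OF \<epsilon>] assms(2,3)] by (elim exE conjE) simp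
  obtain C2 where C2: "0 < C2" and bound2: "\<And>lam L N F G a b. 1 \<le> lam \<Longrightarrow> 0 < L \<Longrightarrow> L \<le> N \<Longrightarrow>
    shell_coeffs c0 C0 lam L F a \<Longrightarrow> shell_coeffs c0 C0 lam N G b \<Longrightarrow>
    (\<integral>z. norm (wave_sum a F z * wave_sum b G z) ^ 4 \<partial>fejer_measure lam) \<le> C2 * (L * N * (1 / lam + 1 / N\<^sup>2))"
    using product_bound_bilinear[OF assms(2,3)] by (elim exE conjE) simp
  define K where "K = 2 * H ^ 4 * (C1 + C2) + 1"
  have K: "0 < K" using H C1 C2 by (simp add: K_def add_nonneg_pos)
  show ?case
  proof (intro exI[of _ K] conjI allI impI K, goal_cases)
    case (1 lam L N \<phi>L \<phi>N)
    note lam = 1(1) and dy = 1(2,3) and LN = 1(4) and tL = 1(5) and tN = 1(6) and nL = 1(7) and nN = 1(8)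
      and sL = 1(9) and sN = 1(10)
    have L: "0 < L" and N: "0 < N" using dy by (auto simp: dyadic_def)
    obtain F a where F: "shell_coeffs c0 C0 lam L F a"
      and fF: "\<And>t x. airy_flow lam t \<phi>L x = wave_sum a F (t, x)"
      using torus_coefficients[OF lam L tL nL sL] by blast
    obtain G b where G: "shell_coeffs c0 C0 lam N G b"
      and fG: "\<And>t x. airy_flow lam t \<phi>N x = wave_sum b G (t, x)"
      using torus_coefficients[OF lam N tN nN sN] by blast
    define I where "I = (\<integral>z. norm (wave_sum a F z * wave_sum b G z) ^ 4 \<partial>fejer_measure lam)"
    define P where "P = (1 / lam + 1 / N ^ 2) powr (1/4) * L powr (3/16 + \<epsilon>) * N powr (3/16 + \<epsilon>)"
    define m1 where "m1 = 1 / N powr (1/4 - \<epsilon>)"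
    define m2 where "m2 = 1 / lam powr (1/4) + 1 / N powr (1/2)"
    define R where "R = min m1 m2 * L powr (1/4) * N powr (1/4)"
    have m: "0 \<le> m1" "0 \<le> m2" by (simp_all add: m1_def m2_def)
    have R: "0 \<le> R" using m by (simp add: R_def)
    have p4: "(x powr (1/4)) ^ 4 = x" if "0 < x" for x :: real using that by (simp add: powr_power)
    have I1: "I \<le> C1 * (m1 * L powr (1/4) * N powr (1/4)) ^ 4"
    proof -
      have "m1 * N powr (1/4) = N powr \<epsilon>" using N by (simp add: m1_def flip: powr_diff)
      hence "(m1 * L powr (1/4) * N powr (1/4)) ^ 4 = L * (N powr \<epsilon>) ^ 4"
        using L p4[OF L] by (metis mult.assoc mult.commute power_mult_distrib)
      also have "(N powr \<epsilon>) ^ 4 = N powr (4 * \<epsilon>)" using N by (simp add: powr_power)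
      finally show ?thesis using bound1[OF lam L LN F G] by (simp add: I_def)
    qed
    have I2: "I \<le> C2 * (m2 * L powr (1/4) * N powr (1/4)) ^ 4"
    proof -
      have "1 / lam + 1 / N\<^sup>2 \<le> m2 ^ 4"
      proof -
        have "(1 / lam powr (1/4)) ^ 4 = 1 / lam" "(1 / N powr (1/2)) ^ 4 = 1 / N\<^sup>2"
          using lam N p4[of lam] by (simp_all add: power_divide powr_power)
        \<comment> \<open>Superadditivity of the fourth power turns the sum of fourth roots in m2
          into 1 / lam + 1 / N^2.\<close>
        moreover have "x ^ 4 + y ^ 4 \<le> (x + y) ^ 4" if "0 \<le> x" "0 \<le> y" for x y :: real
        proof -
          have "(x + y) ^ 4 = x ^ 4 + y ^ 4 + (4 * x ^ 3 * y + 6 * x\<^sup>2 * y\<^sup>2 + 4 * x * y ^ 3)"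
            by (simp add: eval_nat_numeral algebra_simps)
          thus ?thesis using that by simp
        qed
        from this[of "1 / lam powr (1/4)" "1 / N powr (1/2)"]
        have "(1 / lam powr (1/4)) ^ 4 + (1 / N powr (1/2)) ^ 4 \<le> m2 ^ 4" by (simp add: m2_def)
        ultimately show ?thesis by simp
      qed
      hence "L * N * (1 / lam + 1 / N\<^sup>2) \<le> L * N * m2 ^ 4" using L N by (intro mult_left_mono) auto
      also have "\<dots> = (m2 * L powr (1/4) * N powr (1/4)) ^ 4" using p4[OF L] p4[OF N] by (simp add: power_mult_distrib mult_ac)
      finally have "C2 * (L * N * (1 / lam + 1 / N\<^sup>2)) \<le> C2 * (m2 * L powr (1/4) * N powr (1/4)) ^ 4"
        using C2 by (intro mult_left_mono) auto
      thus ?thesis using bound2[OF lam L LN F G] by (simp add: I_def)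
    qed
    have "I \<le> (C1 + C2) * R ^ 4"
    proof (cases "m1 \<le> m2")
      case True
      hence "R = m1 * L powr (1/4) * N powr (1/4)" by (simp add: R_def)
      moreover have "C1 * R ^ 4 \<le> (C1 + C2) * R ^ 4" using C2 by (intro mult_right_mono) auto
      ultimately show ?thesis using I1 by simp
    next
      case False
      hence "R = m2 * L powr (1/4) * N powr (1/4)" by (simp add: R_def)
      moreover have "C2 * R ^ 4 \<le> (C1 + C2) * R ^ 4" using C1 by (intro mult_right_mono) auto
      ultimately show ?thesis using I2 by simp
    qed
    hence "Lp_norm 4 (lebesgue_on (UNIV \<times> {0..lam})) (\<lambda>(t, x). of_real (\<eta> t) * airy_flow lam t \<phi>L x * airy_flow lam t \<phi>N x)
        \<le> ennreal (K * R)"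
      unfolding K_def I_def using C1 C2 by (intro localized_product_bound[OF lam H fF fG _ _ R]) auto
    also have "\<dots> \<le> ennreal (K * (P + R))"
      using K by (intro ennreal_leI mult_left_mono) (auto simp: P_def)
    finally show ?case by (simp only: P_def R_def m1_def m2_def)
  qed
qed simp

end
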